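(* Let $x_1,\dots,x_m\in\mathbb R^3$ be distinct, $\alpha_1,\dots,\alpha_m\in\mathbb R$, and let $H^{(3)}_{\alpha,X}$ be the self-adjoint operator in $L^2(\mathbb R^3)$ defined in the context. Let $K=\{k_i\}_{i=1}^{m'}$ be a subset of $\{1,\dots,m\}$ with $m'$ elements. (i) Suppose that $$\alpha_{k_i}<-\sum_{j\neq k_i}\frac1{4\pi|x_j-x_{k_i}|}\quad\text{for all }k_i\in K.$$ Then $\kappa_-(H^{(3)}_{\alpha,X})\ge m'$. (ii) If, in addition, $\alpha_k\ge\displaystyle\sum_{j\ne k}\frac1{4\pi|x_j-x_k|}$ for all $k\in\{1,\dots,m\}\setminus K$, then $\kappa_-(H^{(3)}_{\alpha,X})=m'$.
   Context: $\kappa_-(T)$ is the number of negative eigenvalues of a self-adjoint operator $T$, counted with multiplicity. Let $r_j=|x-x_j|$ and let $H=-\Delta$ in $L^2(\mathbb R^3)$ with $\operatorname{dom}(H)=\{f\in W_2^2(\mathbb R^3): f(x_j)=0,\ j=1,\dots,m\}$. Every $f\in\operatorname{dom}(H^* )$ is uniquely $f=\sum_{j=1}^m(\xi_{0j}e^{-r_j}/r_j+\xi_{1j}e^{-r_j})+f_H$ with $\xi_{0j},\xi_{1j}\in\mathbb C$, $f_H\in\operatorname{dom}(H)$. Put $\Gamma_0f=4\pi\{\xi_{0j}\}_{j=1}^m$, $\Gamma_1f=\{\lim_{x\to x_j}(f(x)-\xi_{0j}/|x-x_j|)\}_{j=1}^m$, vectors in $\mathbb C^m$. Then $$H^{(3)}_{\alpha,X}=H^*\upharpoonright\{f\in\operatorname{dom}(H^*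 ):\Gamma_1f=B_\alpha\Gamma_0f\},\qquad B_\alpha=\operatorname{diag}(\alpha_1,\dots,\alpha_m).$$ *)

theory Defs
  imports "HOL-Analysis.Analysis" "HOL-Library.Extended_Nat"
begin

section \<open>The Sobolev spaces \<open>W\<^sub>2\<^sup>k(\<real>\<^sup>3)\<close>\<close>

text \<open>
  Elements of \<open>L\<^sup>2(\<real>\<^sup>3)\<close> are represented by Borel functions; everything below that speaks about
  \<open>L\<^sup>2\<close>, Sobolev spaces or operators is invariant under changing a function on a null set
  (within the Borel functions).
\<close>

definition L2 :: "(real^3 \<Rightarrow> complex) set" where
  "L2 = {f \<in> borel_measurable lborel. integrable lborel (\<lambda>x. (cmod (f x))\<^sup>2)}"

definition L2_inner :: "(real^3 \<Rightarrow> complex) \<Rightarrow> (real^3 \<Rightarrow> complex) \<Rightarrow> complex" where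
  "L2_inner f g = (\<integral>x. f x * cnj (g x) \<partial>lborel)"

definition partial :: "3 \<Rightarrow> (real^3 \<Rightarrow> real) \<Rightarrow> real^3 \<Rightarrow> real" where
  "partial i \<phi> x = frechet_derivative \<phi> (at x) (axis i 1)"

fun Ck :: "nat \<Rightarrow> (real^3 \<Rightarrow> real) \<Rightarrow> bool" where
  "Ck 0 \<phi> \<longleftrightarrow> continuous_on UNIV \<phi>"
| "Ck (Suc k) \<phi> \<longleftrightarrow> (\<forall>x. \<phi> differentiable (at x)) \<and> (\<forall>i. Ck k (partial i \<phi>))"

text \<open>Real-valued test functions suffice for weak derivatives of complex-valued functions.\<close>

definition test_function :: "(real^3 \<Rightarrow> real) \<Rightarrow> bool" where
  "test_function \<phi> \<longleftrightarrow> (\<forall>k. Ck k \<phi>) \<and> (\<exists>C. compact C \<and> (\<forall>x. x \<notin> C \<longrightarrow> \<phi> x = 0))"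

text \<open>Both functions are required to be in \<open>L\<^sup>2\<close>, so that the integrals below converge.\<close>

definition weak_partial :: "3 \<Rightarrow> (real^3 \<Rightarrow> complex) \<Rightarrow> (real^3 \<Rightarrow> complex) \<Rightarrow> bool" where
  "weak_partial i f g \<longleftrightarrow> f \<in> L2 \<and> g \<in> L2 \<and>
     (\<forall>\<phi>. test_function \<phi> \<longrightarrow>
        (\<integral>x. partial i \<phi> x *\<^sub>R f x \<partial>lborel) = - (\<integral>x. \<phi> x *\<^sub>R g x \<partial>lborel))"

fun W2 :: "nat \<Rightarrow> (real^3 \<Rightarrow> complex) set" where
  "W2 0 = L2"
| "W2 (Suc k) = {f \<in> L2. \<forall>i. \<exists>g \<in> W2 k. weak_partial i f g}"

text \<open>\<open>g = \<Delta>f\<close> (almost everywhere), with weak second derivatives in \<open>L\<^sup>2\<close>.\<close>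

definition has_laplacian :: "(real^3 \<Rightarrow> complex) \<Rightarrow> (real^3 \<Rightarrow> complex) \<Rightarrow> bool" where
  "has_laplacian f g \<longleftrightarrow>
     (\<exists>p q. (\<forall>i. weak_partial i f (p i) \<and> weak_partial i (p i) (q i)) \<and>
            (AE x in lborel. g x = (\<Sum>i\<in>UNIV. q i x)))"


section \<open>Operators in \<open>L\<^sup>2(\<real>\<^sup>3)\<close>\<close>

text \<open>
  An operator is represented by its graph, i.e. the set of all pairs \<open>(f, g)\<close> of representatives
  with \<open>f\<close> in the domain and \<open>g\<close> almost everywhere equal to the image of \<open>f\<close>.
\<close>

type_synonym L2_operator = "((real^3 \<Rightarrow> complex) \<times> (real^3 \<Rightarrow> complex)) set"

definition adjoint_op :: "L2_operator \<Rightarrow> L2_operator" where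
  "adjoint_op T = {(u, v). u \<in> L2 \<and> v \<in> L2 \<and>
     (\<forall>(f, g) \<in> T. L2_inner g u = L2_inner f v)}"

definition eigenspace :: "L2_operator \<Rightarrow> real \<Rightarrow> (real^3 \<Rightarrow> complex) set" where
  "eigenspace T \<mu> = {f. (f, \<lambda>x. of_real \<mu> * f x) \<in> T}"

definition independent_ae :: "(real^3 \<Rightarrow> complex) set \<Rightarrow> bool" where
  "independent_ae S \<longleftrightarrow>
     (\<forall>c :: (real^3 \<Rightarrow> complex) \<Rightarrow> complex.
        (AE x in lborel. (\<Sum>f\<in>S. c f * f x) = 0) \<longrightarrow> (\<forall>f\<in>S. c f = 0))"

text \<open>
  The dimension of the eigenspace as a subspace of \<open>L\<^sup>2\<close>, i.e. modulo null functions; it is \<open>0\<close>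
  unless \<open>\<mu>\<close> is an eigenvalue.
\<close>

definition multiplicity_op :: "L2_operator \<Rightarrow> real \<Rightarrow> enat" where
  "multiplicity_op T \<mu> =
     (SUP S \<in> {S. finite S \<and> S \<subseteq> eigenspace T \<mu> \<and> independent_ae S}. enat (card S))"

text \<open>
  The sum of the multiplicities over all \<open>\<mu> < 0\<close>, as the supremum of its finite partial sums.
  Intended for self-adjoint \<open>T\<close>, whose eigenvalues are real.
\<close>

definition kappa_minus :: "L2_operator \<Rightarrow> enat" where
  "kappa_minus T = (SUP F \<in> {F. finite F \<and> F \<subseteq> {..<0}}. \<Sum>\<mu>\<in>F. multiplicity_op T \<mu>)"


section \<open>Point interactions\<close>

text \<open>
  The index set \<open>{1,\<dots>,m}\<close> is an arbitrary nonempty finite type \<open>'m\<close>. The values \<open>f(x\<^sub>j)\<close> of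
  \<open>f \<in> W\<^sub>2\<^sup>2(\<real>\<^sup>3)\<close> are those of its continuous representative.
\<close>

definition dom_H :: "('m::finite \<Rightarrow> real^3) \<Rightarrow> (real^3 \<Rightarrow> complex) set" where
  "dom_H X = {f \<in> W2 2. \<exists>F. continuous_on UNIV F \<and> (AE x in lborel. F x = f x) \<and>
                            (\<forall>j. F (X j) = 0)}"

definition op_H :: "('m::finite \<Rightarrow> real^3) \<Rightarrow> L2_operator" where
  "op_H X = {(f, g). f \<in> dom_H X \<and> g \<in> L2 \<and> has_laplacian f (\<lambda>x. - g x)}"

text \<open>
  The function \<open>\<Sum>\<^sub>j (\<xi>\<^sub>0\<^sub>j e\<^bsup>-r\<^sub>j\<^esup>/r\<^sub>j + \<xi>\<^sub>1\<^sub>j e\<^bsup>-r\<^sub>j\<^esup>) + f\<^sub>H\<close> with \<open>r\<^sub>j = |x - x\<^sub>j|\<close>.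
\<close>

definition decomp ::
  "('m::finite \<Rightarrow> real^3) \<Rightarrow> complex^'m \<Rightarrow> complex^'m \<Rightarrow> (real^3 \<Rightarrow> complex) \<Rightarrow> real^3 \<Rightarrow> complex" where
  "decomp X \<xi>0 \<xi>1 fH x =
     (\<Sum>j\<in>UNIV. \<xi>0 $ j * of_real (exp (- dist x (X j)) / dist x (X j))
             + \<xi>1 $ j * of_real (exp (- dist x (X j)))) + fH x"

text \<open>
  For distinct points, \<open>boundary_values X f g0 g1\<close> says \<open>\<Gamma>\<^sub>0 f = g0\<close> and \<open>\<Gamma>\<^sub>1 f = g1\<close>. It is the graph of
  \<open>(\<Gamma>\<^sub>0, \<Gamma>\<^sub>1)\<close>, which is single-valued and defined on all of \<open>dom(H\<^sup>*)\<close> because every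
  \<open>f \<in> dom(H\<^sup>*)\<close> has a unique decomposition. The limit defining \<open>\<Gamma>\<^sub>1 f\<close> is pointwise and is
  therefore taken for the representative of \<open>f\<close> given by a continuous \<open>f\<^sub>H\<close>.
\<close>

definition boundary_values ::
  "('m::finite \<Rightarrow> real^3) \<Rightarrow> (real^3 \<Rightarrow> complex) \<Rightarrow> complex^'m \<Rightarrow> complex^'m \<Rightarrow> bool" where
  "boundary_values X f g0 g1 \<longleftrightarrow>
     (\<exists>\<xi>0 \<xi>1 fH. fH \<in> dom_H X \<and> continuous_on UNIV fH \<and>
        (AE x in lborel. f x = decomp X \<xi>0 \<xi>1 fH x) \<and>
        g0 = (\<chi> j. of_real (4 * pi) * \<xi>0 $ j) \<and>
        (\<forall>j. ((\<lambda>x. decomp X \<xi>0 \<xi>1 fH x - \<xi>0 $ j / of_real (dist x (X j)))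
                \<longlongrightarrow> g1 $ j) (at (X j))))"

definition B_mat :: "('m::finite \<Rightarrow> real) \<Rightarrow> complex^'m^'m" where
  "B_mat \<alpha> = (\<chi> i j. if i = j then of_real (\<alpha> i) else 0)"

definition H3 :: "('m::finite \<Rightarrow> real) \<Rightarrow> ('m \<Rightarrow> real^3) \<Rightarrow> L2_operator" where
  "H3 \<alpha> X = {(f, g) \<in> adjoint_op (op_H X).
     \<exists>g0 g1. boundary_values X f g0 g1 \<and> g1 = B_mat \<alpha> *v g0}"

end

theory Submission
  imports Defs "HOL-Real_Asymp.Real_Asymp"
begin

text \<open>
  Why the theorem holds. For \<open>s > 0\<close> let \<open>G\<^sub>j(x) = exp(-s|x - x\<^sub>j|)/|x - x\<^sub>j|\<close> be the Yukawa potential with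
  pole \<open>x\<^sub>j\<close>. An eigenfunction of the point interaction at \<open>-s\<^sup>2\<close> solves \<open>(s\<^sup>2 - \<Delta>)f = 0\<close> away from the
  points, so it is a combination \<open>\<Sum>\<^sub>j c\<^sub>j G\<^sub>j\<close>, and the boundary condition \<open>\<Gamma>\<^sub>1 f = B\<^sub>\<alpha> \<Gamma>\<^sub>0 f\<close> says that \<open>c\<close> is in
  the kernel of the real symmetric matrix
  \<open>M(s) = diag(4\<pi>\<alpha>\<^sub>j + s) - (exp(-s|x\<^sub>i - x\<^sub>j|)/|x\<^sub>i - x\<^sub>j|)\<^bsub>i\<noteq>j\<^esub>\<close> (\<open>krein_mat\<close>). Hence the multiplicity of
  \<open>-s\<^sup>2\<close> is \<open>dim ker M(s)\<close> (\<open>multiplicity_H3\<close>), and \<open>\<kappa>\<^sub>-\<close> counts the zeros of \<open>M\<close> on \<open>(0,\<infinity>)\<close>.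

  The derivative of \<open>M(s)\<close> is the matrix \<open>(exp(-s|x\<^sub>i - x\<^sub>j|))\<^sub>i\<^sub>j\<close>, which is positive definite because it is
  a multiple of the Gram matrix of \<open>G\<^sub>1,\<dots>,G\<^sub>m\<close> (\<open>yukawa_gram\<close>, \<open>exp_dist_posdef\<close>). So \<open>M\<close> increases strictly,
  it is positive definite for large \<open>s\<close>, and the number of its zeros, counted with the dimensions of the
  kernels, is the number of negative directions of \<open>M(0)\<close> (\<open>negative_dim_le_null_spaces\<close>,
  \<open>null_spaces_le_negative_dim\<close>). By diagonal dominance \<open>M(0)\<close> is negative definite on the vectors
  supported in \<open>K\<close>, which gives (i), and under the hypothesis of (ii) it is nonnegative on the vectors
  supported off \<open>K\<close>, which leaves no room for more than \<open>m'\<close> negative directions.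

  The analytic input is Green's formula \<open>\<integral> G\<^sub>p (s\<^sup>2 u - \<Delta>u) = const u(p)\<close> for all \<open>u \<in> W\<^sub>2\<^sup>2\<close> and all points \<open>p\<close>
  (\<open>green_formula\<close>). Applied to functions vanishing at the points it shows that the \<open>G\<^sub>j\<close> belong to the
  adjoint; applied at every \<open>p\<close> it shows that \<open>(s\<^sup>2 - \<Delta>)u = 0\<close> forces \<open>u = 0\<close>, which yields that there are no
  further eigenfunctions; applied to \<open>u = exp(-s|x - q|)\<close> it evaluates the Gram matrix. It is proved by
  testing with the smooth functions obtained from \<open>exp(-s r)/r\<close> on replacing \<open>r\<close> by \<open>sqrt(r\<^sup>2 + \<epsilon>\<^sup>2)\<close>.
\<close>

section \<open>Smooth functions and cut-offs\<close>

definition smooth :: "(real^3 \<Rightarrow> real) \<Rightarrow> bool" where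
  "smooth f \<longleftrightarrow> (\<forall>k. Ck k f)"

lemma Ck_Suc_imp_Ck: "Ck (Suc k) f \<Longrightarrow> Ck k f"
proof (induction k arbitrary: f)
  case 0
  then show ?case
    by (simp add: differentiable_imp_continuous_within continuous_at_imp_continuous_on)
next
  case (Suc k)
  then show ?case by auto
qed

lemma smooth_iff: "smooth f \<longleftrightarrow> (\<forall>x. f differentiable (at x)) \<and> (\<forall>i. smooth (partial i f))"
proof
  assume "smooth f" then show "(\<forall>x. f differentiable (at x)) \<and> (\<forall>i. smooth (partial i f))"
    unfolding smooth_def by (metis Ck.simps(2))
next
  assume *: "(\<forall>x. f differentiable (at x)) \<and> (\<forall>i. smooth (partial i f))"
  have "Ck (Suc k) f" for k using * by (auto simp: smooth_def)
  then show "smooth f" unfolding smooth_def using Ck_Suc_imp_Ck by blast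
qed

lemma smooth_differentiable: "smooth f \<Longrightarrow> f differentiable (at x)"
  using smooth_iff by blast

lemma smooth_partial: "smooth f \<Longrightarrow> smooth (partial i f)"
  using smooth_iff by blast

lemma smooth_continuous: "smooth f \<Longrightarrow> continuous_on A f"
  by (meson differentiable_imp_continuous_within continuous_at_imp_continuous_on smooth_differentiable)

lemma smooth_measurable [measurable_dest]: "smooth f \<Longrightarrow> f \<in> borel_measurable borel"
  using smooth_continuous borel_measurable_continuous_onI by blast

lemma partial_eqI:
  "(f has_derivative D) (at x) \<Longrightarrow> partial i f x = D (axis i 1)"
  unfolding partial_def by (metis frechet_derivative_at)

lemma has_derivative_frechet: "f differentiable (at x) \<Longrightarrow> (f has_derivative frechet_derivative f (at x)) (at x)"
  using frechet_derivative_works by blast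

lemma partial_add:
  assumes "f differentiable (at x)" "g differentiable (at x)"
  shows "partial i (\<lambda>x. f x + g x) x = partial i f x + partial i g x"
  using partial_eqI[OF has_derivative_add[OF assms[THEN has_derivative_frechet]]]
  by (simp only: partial_def)

lemma partial_mult:
  assumes "f differentiable (at x)" "g differentiable (at x)"
  shows "partial i (\<lambda>x. f x * g x) x = f x * partial i g x + partial i f x * g x"
  using partial_eqI[OF has_derivative_mult[OF assms[THEN has_derivative_frechet]]]
  by (simp only: partial_def)

lemma partial_compose:
  assumes "(h has_real_derivative D) (at (f x))" "f differentiable (at x)"
  shows "partial i (\<lambda>x. h (f x)) x = D * partial i f x"
proof -
  have "((\<lambda>x. h (f x)) has_derivative (\<lambda>v. D * frechet_derivative f (at x) v)) (at x)"
    using has_derivative_compose[OF has_derivative_frechet[OF assms(2)]] assms(1)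
    by (simp add: has_field_derivative_def)
  from partial_eqI[OF this] show ?thesis by (simp only: partial_def)
qed

lemma partial_has_real_derivative:
  assumes "f differentiable (at x)"
  shows "((\<lambda>t. f (x + t *\<^sub>R axis i 1)) has_real_derivative partial i f x) (at 0)"
proof -
  let ?D = "frechet_derivative f (at x)"
  have d: "(f has_derivative ?D) (at (x + 0 *\<^sub>R axis i 1))"
    using has_derivative_frechet[OF assms] by simp
  have "((\<lambda>t. x + t *\<^sub>R axis i 1) has_derivative (\<lambda>t. t *\<^sub>R axis i 1)) (at 0)"
    by (auto intro!: derivative_eq_intros)
  from has_derivative_compose[OF this d]
  have "((\<lambda>t. f (x + t *\<^sub>R axis i 1)) has_derivative (\<lambda>t. ?D (t *\<^sub>R axis i 1))) (at 0)" .
  moreover have "?D (t *\<^sub>R axis i 1) = t * partial i f x" for t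
    using linear_frechet_derivative[OF assms] by (simp add: partial_def linear_cmul)
  ultimately show ?thesis by (simp add: has_field_derivative_def mult_commute_abs)
qed

lemma Ck_const: "Ck k (\<lambda>x. c)"
proof (induction k arbitrary: c)
  case (Suc k)
  have "partial i (\<lambda>x. c) = (\<lambda>x. 0)" for i
    using partial_eqI[OF has_derivative_const] by fastforce
  then show ?case using Suc by simp
qed simp

lemma Ck_add: "Ck k f \<Longrightarrow> Ck k g \<Longrightarrow> Ck k (\<lambda>x. f x + g x)"
proof (induction k arbitrary: f g)
  case (Suc k)
  then have "partial i (\<lambda>x. f x + g x) = (\<lambda>x. partial i f x + partial i g x)" for i
    by (auto simp: partial_add)
  then show ?case using Suc by (auto intro: differentiable_add)
qed (auto intro: continuous_on_add)

lemma Ck_mult: "Ck k f \<Longrightarrow> Ck k g \<Longrightarrow> Ck k (\<lambda>x. f x * g x)"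
proof (induction k arbitrary: f g)
  case (Suc k)
  then have "partial i (\<lambda>x. f x * g x) = (\<lambda>x. f x * partial i g x + partial i f x * g x)" for i
    by (auto simp: partial_mult)
  moreover have "Ck k f" "Ck k g" using Suc.prems Ck_Suc_imp_Ck by blast+
  ultimately show ?case using Suc by (simp add: Ck_add differentiable_mult)
qed (auto intro: continuous_on_mult)

text \<open>The induction on the order needs all derivatives of the outer function at once.\<close>

lemma Ck_compose:
  assumes D: "\<And>n t. t \<in> S \<Longrightarrow> (D n has_real_derivative D (Suc n) t) (at t)"
    and S: "\<And>x. f x \<in> S" and f: "smooth f"
  shows "Ck k (\<lambda>x. D n (f x))"
proof (induction k arbitrary: n)
  case 0
  have "isCont (D n) (f x)" for x using D[OF S] DERIV_isCont by blast
  moreover have "isCont f x" for x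
    using smooth_differentiable[OF f] differentiable_imp_continuous_within by blast
  ultimately have "isCont (\<lambda>x. D n (f x)) x" for x by (rule isCont_o2[rotated])
  then show ?case by (simp add: continuous_at_imp_continuous_on)
next
  case (Suc k)
  have "(\<lambda>x. D n (f x)) differentiable (at x)" for x
  proof -
    have "D n differentiable (at (f x))" 
      using D[OF S] real_differentiable_def by blast
    from differentiable_chain_at[OF smooth_differentiable[OF f] this]
    show ?thesis by (simp add: o_def)
  qed
  moreover have "partial i (\<lambda>x. D n (f x)) = (\<lambda>x. D (Suc n) (f x) * partial i f x)" for i
    using partial_compose[OF D[OF S] smooth_differentiable[OF f]] by blast
  moreover have "Ck k (partial i f)" for i using smooth_partial[OF f] smooth_def by blast
  ultimately show ?case using Suc by (simp add: Ck_mult)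
qed

lemma smooth_const: "smooth (\<lambda>x. c)" by (simp add: smooth_def Ck_const)
lemma smooth_add: "smooth f \<Longrightarrow> smooth g \<Longrightarrow> smooth (\<lambda>x. f x + g x)" by (simp add: smooth_def Ck_add)
lemma smooth_mult: "smooth f \<Longrightarrow> smooth g \<Longrightarrow> smooth (\<lambda>x. f x * g x)" by (simp add: smooth_def Ck_mult)
lemma smooth_minus: "smooth f \<Longrightarrow> smooth g \<Longrightarrow> smooth (\<lambda>x. f x - g x)"
  using smooth_add[of f "\<lambda>x. (-1) * g x"] smooth_mult[OF smooth_const, of g "-1"] by simp

lemma smooth_prod: "(\<And>i. i \<in> I \<Longrightarrow> smooth (f i)) \<Longrightarrow> smooth (\<lambda>x. \<Prod>i\<in>I. f i x)"
  by (induction I rule: infinite_finite_induct) (auto intro: smooth_const smooth_mult)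

lemma smooth_sum: "(\<And>i. i \<in> I \<Longrightarrow> smooth (f i)) \<Longrightarrow> smooth (\<lambda>x. \<Sum>i\<in>I. f i x)"
  by (induction I rule: infinite_finite_induct) (auto intro: smooth_const smooth_add)

lemma smooth_compose:
  assumes "\<And>n t. t \<in> S \<Longrightarrow> (D n has_real_derivative D (Suc n) t) (at t)"
    and "\<And>x. f x \<in> S" and "smooth f"
  shows "smooth (\<lambda>x. D 0 (f x))"
  unfolding smooth_def
  by (intro allI Ck_compose[where D = D and S = S]) (use assms in auto)

lemma smooth_coord: "smooth (\<lambda>x. x $ j)"
proof -
  have d: "((\<lambda>x::real^3. x $ j) has_derivative (\<lambda>x. x $ j)) (at x)" for x
    by (rule bounded_linear_imp_has_derivative) (rule bounded_linear_vec_nth)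
  then have "partial i (\<lambda>x. x $ j) = (\<lambda>x. axis i 1 $ j)" for i
    using partial_eqI by fastforce
  then show ?thesis 
    unfolding smooth_iff[of "\<lambda>x. x $ j"] using d by (auto simp: smooth_const differentiable_def)
qed

lemma norm3_sq: "(norm (x::real^3))\<^sup>2 = (\<Sum>i\<in>UNIV. (x $ i)\<^sup>2)"
  by (simp add: norm_vec_def L2_set_def sum_nonneg)

lemma smooth_norm_sq: "smooth (\<lambda>x. (norm (x - p))\<^sup>2)"
  unfolding norm3_sq unfolding power2_eq_square vector_minus_component
  by (intro smooth_sum smooth_mult smooth_minus smooth_coord smooth_const)

lemma partial_norm_sq: "partial i (\<lambda>x. (norm (x - p))\<^sup>2) x = 2 * (x - p) $ i"
proof -
  have "((\<lambda>x. (norm (x - p))\<^sup>2) has_derivative (\<lambda>v. 2 * ((x - p) \<bullet> v))) (at x)"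
    unfolding power2_norm_eq_inner by (auto intro!: derivative_eq_intros simp: inner_commute)
  then show ?thesis by (simp add: partial_eqI inner_axis)
qed

lemma smooth_powr:
  assumes "smooth f" "\<And>x. f x > 0" shows "smooth (\<lambda>x. f x powr a)"
proof -
  define c where "c = rec_nat 1 (\<lambda>n r. r * (a - real n))"
  have c: "c 0 = 1" "\<And>n. c (Suc n) = c n * (a - real n)" by (auto simp: c_def)
  have D: "((\<lambda>t. c n * t powr (a - real n)) has_real_derivative c (Suc n) * t powr (a - real (Suc n))) (at t)"
    if "t \<in> {0<..}" for n t
    using that by (auto intro!: derivative_eq_intros simp: c algebra_simps)
  have "smooth (\<lambda>x. c 0 * f x powr (a - real 0))"
    by (rule smooth_compose[where D = "\<lambda>n t. c n * t powr (a - real n)" and S = "{0<..}"])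
      (use D assms in auto)
  then show ?thesis by (simp add: c)
qed

lemma smooth_exp: assumes "smooth f" shows "smooth (\<lambda>x. exp (f x))"
  by (rule smooth_compose[where D = "\<lambda>n::nat. exp" and S = UNIV]) (use assms in auto)

text \<open>The family of these functions, \<open>p\<close> ranging over the polynomials, is closed under differentiation;
  this makes \<open>exp(-1/t)\<close>, extended by zero, smooth.\<close>

definition flat :: "real poly \<Rightarrow> real \<Rightarrow> real" where
  "flat p t = (if t > 0 then poly p (1 / t) * exp (- (1 / t)) else 0)"

lemma poly_exp_tendsto_0: "((\<lambda>t. poly p t * exp (- t)) \<longlongrightarrow> (0::real)) at_top"
proof -
  have "((\<lambda>t. \<Sum>i\<le>degree p. coeff p i * (t ^ i / exp t)) \<longlongrightarrow> (\<Sum>i\<le>degree p. coeff p i * 0)) at_top"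
    by (intro tendsto_sum tendsto_mult tendsto_const tendsto_power_div_exp_0)
  moreover have "(\<Sum>i\<le>degree p. coeff p i * (t ^ i / exp t)) = poly p t * exp (- t)" for t
    by (simp add: poly_altdef sum_distrib_right exp_minus divide_inverse mult.assoc)
  ultimately show ?thesis by simp
qed

lemma flat_tendsto_0: "(flat p \<longlongrightarrow> 0) (at 0)"
proof (rule filterlim_split_at)
  show "(flat p \<longlongrightarrow> 0) (at_left 0)"
    by (rule tendsto_eventually) (auto simp: eventually_at_filter flat_def)
  have "((\<lambda>t. poly p (inverse t) * exp (- inverse t)) \<longlongrightarrow> 0) (at_right 0)"
    by (rule filterlim_compose[OF poly_exp_tendsto_0 filterlim_inverse_at_top_right])
  then show "(flat p \<longlongrightarrow> 0) (at_right 0)"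
    by (rule Lim_transform_eventually)
      (auto simp: eventually_at_filter flat_def inverse_eq_divide)
qed

lemma flat_DERIV:
  "(flat p has_real_derivative flat ([:0, 0, 1:] * (p - pderiv p)) t) (at t)"
proof -
  consider "t > 0" | "t < 0" | "t = 0" by linarith
  then show ?thesis
  proof cases
    case 1
    have i: "((\<lambda>t. 1 / t) has_real_derivative (- (1 / t)\<^sup>2)) (at t)"
      using 1 by (auto intro!: derivative_eq_intros simp: power2_eq_square)
    have p: "((\<lambda>t. poly p (1 / t)) has_real_derivative poly (pderiv p) (1 / t) * (- (1 / t)\<^sup>2)) (at t)"
      by (rule DERIV_chain2[OF poly_DERIV i])
    have e: "((\<lambda>t. exp (- (1 / t))) has_real_derivative exp (- (1 / t)) * (1 / t)\<^sup>2) (at t)"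
      using DERIV_chain2[OF DERIV_exp DERIV_minus[OF i]] by simp
    have "poly (pderiv p) (1 / t) * (- (1 / t)\<^sup>2) * exp (- (1 / t)) + exp (- (1 / t)) * (1 / t)\<^sup>2 * poly p (1 / t)
      = flat ([:0, 0, 1:] * (p - pderiv p)) t"
      using 1 by (simp add: flat_def power2_eq_square algebra_simps)
    with DERIV_mult[OF p e] have "((\<lambda>t. poly p (1 / t) * exp (- (1 / t))) has_real_derivative
        flat ([:0, 0, 1:] * (p - pderiv p)) t) (at t)" by simp
    then show ?thesis
      by (rule has_field_derivative_transform_within_open[where S = "{0<..}"])
        (use 1 in \<open>auto simp: flat_def\<close>)
  next
    case 2
    have "((\<lambda>t. 0) has_real_derivative flat ([:0, 0, 1:] * (p - pderiv p)) t) (at t)"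
      using 2 by (simp add: flat_def)
    then show ?thesis
      by (rule has_field_derivative_transform_within_open[where S = "{..<0}"])
        (use 2 in \<open>auto simp: flat_def\<close>)
  next
    case 3
    have "((\<lambda>h. (flat p (0 + h) - flat p 0) / h) \<longlongrightarrow> 0) (at 0)"
      by (rule Lim_transform_eventually[OF flat_tendsto_0[of "pCons 0 p"]])
        (auto simp: eventually_at_filter flat_def)
    then show ?thesis using 3 by (simp add: DERIV_def flat_def)
  qed
qed

text \<open>A smooth bump of height one at the origin, supported in the unit ball.\<close>

definition bump :: "real^3 \<Rightarrow> real" where
  "bump x = exp 1 * flat 1 (1 - (norm x)\<^sup>2)"

lemma smooth_flat: assumes "smooth f" shows "smooth (\<lambda>x. flat p (f x))"
proof -
  define P where "P n = ((\<lambda>p. [:0, 0, 1:] * (p - pderiv p)) ^^ n) p" for n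
  have "smooth (\<lambda>x. flat (P 0) (f x))"
    by (rule smooth_compose[where D = "\<lambda>n. flat (P n)" and S = UNIV])
      (use assms flat_DERIV in \<open>auto simp: P_def simp del: mult_pCons_left\<close>)
  then show ?thesis by (simp add: P_def)
qed

lemma test_function_iff: 
  "test_function \<phi> \<longleftrightarrow> smooth \<phi> \<and> (\<exists>R. \<forall>x. norm x > R \<longrightarrow> \<phi> x = 0)"
proof -
  have "\<exists>R. \<forall>x. norm x > R \<longrightarrow> \<phi> x = 0" if "compact C" "\<forall>x. x \<notin> C \<longrightarrow> \<phi> x = 0" for C
    using compact_imp_bounded[OF that(1)] that(2) unfolding bounded_iff by (metis not_le)
  moreover have "\<exists>C. compact C \<and> (\<forall>x. x \<notin> C \<longrightarrow> \<phi> x = 0)" if "\<forall>x. norm x > R \<longrightarrow> \<phi> x = 0" for R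
    by (rule exI[of _ "cball 0 R"]) (use that in auto)
  ultimately show ?thesis unfolding test_function_def smooth_def by blast
qed

lemma test_function_smooth: "test_function \<phi> \<Longrightarrow> smooth \<phi>"
  by (simp add: test_function_iff)

lemma test_function_mult: "test_function \<phi> \<Longrightarrow> smooth f \<Longrightarrow> test_function (\<lambda>x. \<phi> x * f x)"
  unfolding test_function_iff using smooth_mult by auto

lemma test_function_partial: 
  assumes "test_function \<phi>" shows "test_function (partial i \<phi>)"
proof -
  obtain R where R: "\<And>x. norm x > R \<Longrightarrow> \<phi> x = 0" and s: "smooth \<phi>"
    using assms unfolding test_function_iff by blast
  have "partial i \<phi> x = 0" if "norm x > R" for x
  proof -
    have "open {x::real^3. norm x > R}"
      by (rule open_Collect_less) (rule continuous_on_const, rule continuous_on_norm_id)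
    then have "(\<phi> has_derivative (\<lambda>_. 0)) (at x)"
      by (intro has_derivative_transform_within_open[of "\<lambda>_. 0" "\<lambda>_. 0" x UNIV "{x. norm x > R}" \<phi>])
        (use that R in auto)
    then show ?thesis by (simp add: partial_eqI)
  qed
  then show ?thesis using s smooth_partial unfolding test_function_iff by blast
qed

lemma smooth_bounded_on_ball: 
  assumes "smooth f" obtains B where "\<And>x. norm x \<le> R \<Longrightarrow> \<bar>f x\<bar> \<le> B"
proof -
  have "bounded (f ` cball 0 R)"
    by (intro compact_imp_bounded compact_continuous_image smooth_continuous assms) auto
  then show ?thesis using that unfolding bounded_iff by force
qed

lemma test_function_bounded:
  assumes "test_function \<phi>" obtains B where "B \<ge> 0" "\<And>x. \<bar>\<phi> x\<bar> \<le> B"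
proof -
  obtain R where R: "\<And>x. norm x > R \<Longrightarrow> \<phi> x = 0" and s: "smooth \<phi>"
    using assms unfolding test_function_iff by blast
  obtain B where B: "\<And>x. norm x \<le> R \<Longrightarrow> \<bar>\<phi> x\<bar> \<le> B" using smooth_bounded_on_ball[OF s] by blast
  have "\<bar>\<phi> x\<bar> \<le> max B 0" for x using R[of x] B[of x] by (cases "norm x \<le> R") auto
  then show ?thesis using that[of "max B 0"] by auto
qed

text \<open>The cut-offs increase to one pointwise while their gradients are of order \<open>1/n\<close>; dominated
  convergence asks for no more, so there is no region where a cut-off is identically one.\<close>

definition cutoff :: "nat \<Rightarrow> real^3 \<Rightarrow> real" where
  "cutoff n x = bump (x /\<^sub>R real (Suc n))"

lemma cutoff_eq: "cutoff n x = exp 1 * flat 1 (1 - (norm x)\<^sup>2 / (real (Suc n))\<^sup>2)"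
  by (simp add: cutoff_def bump_def power_mult_distrib power2_eq_square divide_inverse mult_ac
      del: of_nat_Suc)

lemma test_function_cutoff: "test_function (cutoff n)"
proof -
  have "smooth (\<lambda>x. exp 1 * flat 1 (1 - (norm (x - 0))\<^sup>2 * (1 / (real (Suc n))\<^sup>2)))"
    by (intro smooth_mult smooth_const smooth_flat smooth_minus smooth_norm_sq)
  then have "smooth (cutoff n)" by (simp add: cutoff_eq[abs_def])
  moreover have "cutoff n x = 0" if "norm x > real (Suc n)" for x
  proof -
    have "(norm x)\<^sup>2 > (real (Suc n))\<^sup>2" using that by (intro power_strict_mono) auto
    then show ?thesis by (simp add: cutoff_eq flat_def field_simps del: of_nat_Suc)
  qed
  ultimately show ?thesis unfolding test_function_iff by blast
qed

lemma flat_1_bounds: "t \<le> 1 \<Longrightarrow> 0 \<le> flat 1 t \<and> exp 1 * flat 1 t \<le> 1"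
  by (auto simp: flat_def exp_add[symmetric] field_simps simp del: exp_add)

lemma cutoff_bounds: "0 \<le> cutoff n x" "cutoff n x \<le> 1"
  using flat_1_bounds[of "1 - (norm x)\<^sup>2 / (real (Suc n))\<^sup>2"] by (auto simp: cutoff_eq)

lemma cutoff_tendsto_1: "(\<lambda>n. cutoff n x) \<longlonglongrightarrow> 1"
proof -
  have "(\<lambda>n. 1 - (norm x)\<^sup>2 / (real (Suc n))\<^sup>2) \<longlonglongrightarrow> 1" by real_asymp
  from isCont_tendsto_compose[OF DERIV_isCont[OF flat_DERIV] this]
  have "(\<lambda>n. exp 1 * flat 1 (1 - (norm x)\<^sup>2 / (real (Suc n))\<^sup>2)) \<longlonglongrightarrow> exp 1 * flat 1 1"
    by (intro tendsto_mult tendsto_const)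
  then show ?thesis by (simp add: cutoff_eq flat_def exp_minus)
qed

lemma partial_cutoff: "partial i (cutoff n) x = partial i bump (x /\<^sub>R real (Suc n)) / real (Suc n)"
proof -
  let ?c = "inverse (real (Suc n))"
  have "smooth bump" using test_function_smooth[OF test_function_cutoff[of 0]]
    by (simp add: cutoff_def[abs_def])
  then have d: "(bump has_derivative frechet_derivative bump (at (?c *\<^sub>R x))) (at (?c *\<^sub>R x))"
    by (intro has_derivative_frechet smooth_differentiable)
  have "((\<lambda>x::real^3. ?c *\<^sub>R x) has_derivative (\<lambda>v. ?c *\<^sub>R v)) (at x)"
    by (auto intro!: derivative_eq_intros)
  from has_derivative_compose[OF this d]
  have "(cutoff n has_derivative (\<lambda>v. frechet_derivative bump (at (?c *\<^sub>R x)) (?c *\<^sub>R v))) (at x)"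
    by (simp add: cutoff_def[abs_def])
  then have "partial i (cutoff n) x = frechet_derivative bump (at (?c *\<^sub>R x)) (?c *\<^sub>R axis i 1)"
    by (rule partial_eqI)
  also have "\<dots> = ?c * partial i bump (?c *\<^sub>R x)"
    using linear_frechet_derivative[of bump "at (?c *\<^sub>R x)"] \<open>smooth bump\<close>
    by (simp add: partial_def linear_cmul smooth_differentiable)
  finally show ?thesis by (simp add: divide_inverse mult.commute)
qed

lemma partial_cutoff_bound: 
  obtains B where "B \<ge> 0" "\<And>n i x. \<bar>partial i (cutoff n) x\<bar> \<le> B / real (Suc n)"
proof -
  have "test_function bump" using test_function_cutoff[of 0] by (simp add: cutoff_def[abs_def])
  then have "\<exists>B\<ge>0. \<forall>x. \<bar>partial i bump x\<bar> \<le> B" for i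
    using test_function_bounded[OF test_function_partial] by metis
  then obtain B where B: "\<And>i. B i \<ge> 0" "\<And>i x. \<bar>partial i bump x\<bar> \<le> B i" by metis
  have "\<bar>partial i bump x\<bar> \<le> sum B UNIV" for i x
    using B by (meson member_le_sum finite iso_tuple_UNIV_I order_trans)
  then show ?thesis
    by (intro that[of "sum B UNIV"]) (auto simp: partial_cutoff divide_right_mono sum_nonneg B(1))
qed

section \<open>Radial integrals and square integrability\<close>

text \<open>Polar coordinates for radial functions: the volume of balls determines the image of Lebesgue
  measure under the norm.\<close>

lemma distr_norm3:
  "distr lborel borel (norm :: real^3 \<Rightarrow> real) =
   density lborel (\<lambda>t. ennreal (4 * pi * t\<^sup>2 * indicator {0..} t))"
proof (rule measure_eqI_generator_eq[where E = "range (\<lambda>a::real. {..a})" and \<Omega> = UNIV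
      and A = "\<lambda>i. {..real i}"])
  let ?M = "distr lborel borel (norm :: real^3 \<Rightarrow> real)"
  let ?N = "density lborel (\<lambda>t::real. ennreal (4 * pi * t\<^sup>2 * indicator {0..} t))"
  show "Int_stable (range (\<lambda>a::real. {..a}))"
    by (auto simp: Int_stable_def)
  show "sets ?M = sigma_sets UNIV (range (\<lambda>a::real. {..a}))"
    "sets ?N = sigma_sets UNIV (range (\<lambda>a::real. {..a}))"
    by (simp_all add: borel_eq_atMost)
  have M: "emeasure ?M {..a} = (if a \<ge> 0 then ennreal (4 / 3 * pi * a ^ 3) else 0)" for a
  proof -
    have "(norm :: real^3 \<Rightarrow> real) -` {..a} = cball 0 a" by auto
    then have "emeasure ?M {..a} = emeasure lborel (cball (0::real^3) a)"
      by (simp add: emeasure_distr)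
    then show ?thesis by (simp add: emeasure_cball eval_unit_ball_vol power3_eq_cube)
  qed
  have N: "emeasure ?N {..a} = (if a \<ge> 0 then ennreal (4 / 3 * pi * a ^ 3) else 0)" for a
  proof -
    have "emeasure ?N {..a} = (\<integral>\<^sup>+t. ennreal (4 * pi * t\<^sup>2) * indicator {0..a} t \<partial>lborel)"
      by (subst emeasure_density) (auto intro!: nn_integral_cong split: split_indicator)
    also have "\<dots> = (if a \<ge> 0 then ennreal (4 / 3 * pi * a ^ 3) else 0)"
    proof (cases "a \<ge> 0")
      case True
      have "(\<integral>\<^sup>+t. ennreal (4 * pi * t\<^sup>2) * indicator {0..a} t \<partial>lborel) =
         ennreal (4 / 3 * pi * a ^ 3 - 4 / 3 * pi * 0 ^ 3)"
        using True by (intro nn_integral_FTC_Icc) (auto intro!: derivative_eq_intros)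
      then show ?thesis using True by simp
    qed simp
    finally show ?thesis .
  qed
  show "emeasure ?M X = emeasure ?N X" if "X \<in> range (\<lambda>a::real. {..a})" for X
    using that M N by auto
  show "(\<Union>i. {..real i}) = UNIV" by (auto simp: real_arch_simple)
  show "emeasure ?M {..real i} \<noteq> \<infinity>" for i unfolding M by simp
qed auto

lemma integrable_radial:
  fixes h :: "real \<Rightarrow> real"
  assumes [measurable]: "h \<in> borel_measurable borel"
    and "set_integrable lborel {0..} (\<lambda>t. t\<^sup>2 * h t)"
  shows "integrable lborel (\<lambda>x::real^3. h (dist x p))"
proof -
  have "integrable lborel (\<lambda>t. (4 * pi) * (indicator {0..} t *\<^sub>R (t\<^sup>2 * h t)))"
    using assms(2) unfolding set_integrable_def by simp
  then have "integrable (density lborel (\<lambda>t. ennreal (4 * pi * t\<^sup>2 * indicator {0..} t))) h"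
    by (subst integrable_density) (auto simp: mult_ac)
  then have "integrable (distr lborel borel (norm :: real^3 \<Rightarrow> real)) h" 
    by (simp add: distr_norm3)
  then have n: "integrable lborel (\<lambda>x::real^3. h (norm x))"
    by (subst (asm) integrable_distr_eq) auto
  have "integrable (distr lborel borel ((+) (-p))) (\<lambda>x. h (norm x))"
    using n by (simp add: lborel_distr_plus)
  then show ?thesis
    by (subst (asm) integrable_distr_eq) (auto simp: dist_norm)
qed

lemma integrable_exp_neg: "a > 0 \<Longrightarrow> set_integrable lborel {0..} (\<lambda>t::real. exp (- a * t))"
proof -
  assume a: "a > 0"
  have "((\<lambda>t. - exp (- a * t) / a) \<longlongrightarrow> 0) at_top" using a by real_asymp
  then have "(\<integral>\<^sup>+t. ennreal (exp (- a * t)) * indicator {0..} t \<partial>lborel) = ennreal (0 - (- exp (- a * 0) / a))"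
    using a by (intro nn_integral_FTC_atLeast) (auto intro!: derivative_eq_intros)
  then have "(\<integral>\<^sup>+t. ennreal (indicator {0..} t * exp (- a * t)) \<partial>lborel) < \<infinity>"
    by (simp add: ennreal_mult' ennreal_indicator mult.commute)
  then show ?thesis unfolding set_integrable_def 
    by (intro integrableI_nonneg) auto
qed

text \<open>Exponential decay and a pole of order one: in three dimensions this is square integrable. It
  bounds the Yukawa potentials, and the explicit elements of \<open>W\<^sub>2\<^sup>2\<close> with their derivatives up to order two.\<close>

definition majorant :: "real \<Rightarrow> real \<Rightarrow> real" where
  "majorant a r = exp (- a * r) * (1 + 1 / r)"

lemma one_plus_le_exp: assumes "a > 0" "(t::real) \<ge> 0" shows "1 + t \<le> max 1 (1 / a) * exp (a * t)"
proof -
  have "1 + t \<le> max 1 (1/a) * (1 + a * t)"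
  proof -
    have "t \<le> max 1 (1/a) * (a * t)"
      using mult_right_mono[of "1/a" "max 1 (1/a)" "a * t"] assms by auto
    then show ?thesis by (simp add: distrib_left add_mono)
  qed
  also have "\<dots> \<le> max 1 (1/a) * exp (a * t)"
    by (intro mult_left_mono exp_ge_add_one_self) auto
  finally show ?thesis .
qed

lemma integrable_majorant_sq: 
  assumes "a > 0" shows "integrable lborel (\<lambda>x::real^3. (majorant a (dist x p))\<^sup>2)"
proof (rule integrable_radial[where h = "\<lambda>t. (majorant a t)\<^sup>2"])
  show "(\<lambda>t. (majorant a t)\<^sup>2) \<in> borel_measurable borel" unfolding majorant_def by measurable
  let ?K = "(max 1 (1 / (a / 2)))\<^sup>2"
  have b: "t\<^sup>2 * (majorant a t)\<^sup>2 \<le> ?K * exp (- a * t)" if "t \<ge> 0" for t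
  proof (cases "t = 0")
    case False
    have "t\<^sup>2 * (majorant a t)\<^sup>2 = exp (- a * t) * exp (- a * t) * (1 + t)\<^sup>2"
      using False by (simp add: majorant_def power2_eq_square field_simps)
    also have "\<dots> \<le> exp (- a * t) * exp (- a * t) * (max 1 (1 / (a/2)) * exp (a/2 * t))\<^sup>2"
      using assms that by (intro mult_left_mono power_mono one_plus_le_exp) auto
    also have "(exp (a/2 * t))\<^sup>2 = exp (a * t)" by (simp add: power2_eq_square exp_add[symmetric])
    then have "exp (- a * t) * exp (- a * t) * (max 1 (1 / (a/2)) * exp (a/2 * t))\<^sup>2
       = ?K * exp (- a * t) * (exp (- a * t) * exp (a * t))"
      by (simp add: power_mult_distrib)
    also have "exp (- a * t) * exp (a * t) = 1" by (simp add: exp_add[symmetric])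
    finally show ?thesis by simp
  qed simp
  have "set_integrable lborel {0..} (\<lambda>t. ?K * exp (- a * t))"
    using integrable_exp_neg[OF assms] by simp
  then show "set_integrable lborel {0..} (\<lambda>t. t\<^sup>2 * (majorant a t)\<^sup>2)"
    unfolding set_integrable_def
    by (rule Bochner_Integration.integrable_bound) (use b in \<open>auto simp: majorant_def indicator_def\<close>)
qed

lemma L2_by_majorant:
  assumes [measurable]: "f \<in> borel_measurable borel" and "a > 0"
    and "\<And>x. x \<noteq> p \<Longrightarrow> cmod (f x) \<le> C * majorant a (dist x p)"
  shows "f \<in> L2"
proof -
  have i: "integrable lborel (\<lambda>x. C\<^sup>2 * (majorant a (dist x p))\<^sup>2)"
    using integrable_majorant_sq[OF assms(2)] by simp
  have "AE x in lborel. x \<noteq> p" by (rule AE_lborel_singleton)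
  then have b: "AE x in lborel. norm ((cmod (f x))\<^sup>2) \<le> norm (C\<^sup>2 * (majorant a (dist x p))\<^sup>2)"
  proof eventually_elim
    case (elim x)
    have "(cmod (f x))\<^sup>2 \<le> (C * majorant a (dist x p))\<^sup>2"
      using assms(3)[OF elim] by (intro power_mono) auto
    then show ?case by (simp add: power_mult_distrib)
  qed
  have "integrable lborel (\<lambda>x. (cmod (f x))\<^sup>2)"
    by (rule Bochner_Integration.integrable_bound[OF i _ b]) measurable
  then show ?thesis by (simp add: L2_def)
qed

lemma L2_measurable [measurable_dest]: "f \<in> L2 \<Longrightarrow> f \<in> borel_measurable borel"
  by (simp add: L2_def)

lemma L2_sq_integrable: "f \<in> L2 \<Longrightarrow> integrable lborel (\<lambda>x. (cmod (f x))\<^sup>2)"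
  by (simp add: L2_def)

lemma L2_mult_integrable:
  assumes f: "f \<in> L2" and g: "g \<in> L2" shows "integrable lborel (\<lambda>x. f x * g x)"
proof -
  have [measurable]: "f \<in> borel_measurable borel" "g \<in> borel_measurable borel"
    using f g by (auto simp: L2_def)
  have b: "cmod (f x * g x) \<le> (cmod (f x))\<^sup>2 + (cmod (g x))\<^sup>2" for x
  proof -
    have "0 \<le> cmod (f x) * cmod (g x)" by simp
    then show ?thesis
      using sum_squares_bound[of "cmod (f x)" "cmod (g x)"] unfolding norm_mult mult.assoc by linarith
  qed
  show ?thesis
  proof (rule Bochner_Integration.integrable_bound)
    show "integrable lborel (\<lambda>x. (cmod (f x))\<^sup>2 + (cmod (g x))\<^sup>2)"
      using L2_sq_integrable f g by simp
    show "AE x in lborel. norm (f x * g x) \<le> norm ((cmod (f x))\<^sup>2 + (cmod (g x))\<^sup>2)"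
      using b by simp
  qed simp
qed

lemma L2_bound:
  assumes "g \<in> L2" and [measurable]: "f \<in> borel_measurable borel"
    and "AE x in lborel. cmod (f x) \<le> C * cmod (g x)"
  shows "f \<in> L2"
proof -
  have i: "integrable lborel (\<lambda>x. C\<^sup>2 * (cmod (g x))\<^sup>2)" using L2_sq_integrable[OF assms(1)] by simp
  have b: "AE x in lborel. norm ((cmod (f x))\<^sup>2) \<le> norm (C\<^sup>2 * (cmod (g x))\<^sup>2)"
    using assms(3)
  proof eventually_elim
    case (elim x)
    then have "(cmod (f x))\<^sup>2 \<le> (C * cmod (g x))\<^sup>2" by (intro power_mono) auto
    then show ?case by (simp add: power_mult_distrib)
  qed
  have "integrable lborel (\<lambda>x. (cmod (f x))\<^sup>2)"
    by (rule Bochner_Integration.integrable_bound[OF i _ b]) measurable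
  then show ?thesis by (simp add: L2_def)
qed

lemma L2_cmult: assumes "f \<in> L2" shows "(\<lambda>x. c * f x) \<in> L2"
  by (rule L2_bound[OF assms, where C = "cmod c"]) (use assms in \<open>auto simp: norm_mult L2_def\<close>)

lemma L2_add: assumes f: "f \<in> L2" and g: "g \<in> L2" shows "(\<lambda>x. f x + g x) \<in> L2"
proof -
  have [measurable]: "f \<in> borel_measurable borel" "g \<in> borel_measurable borel"
    using f g by (auto simp: L2_def)
  have b: "(cmod (f x + g x))\<^sup>2 \<le> 2 * (cmod (f x))\<^sup>2 + 2 * (cmod (g x))\<^sup>2" for x
  proof -
    have "(cmod (f x + g x))\<^sup>2 \<le> (cmod (f x) + cmod (g x))\<^sup>2"
      by (intro power_mono norm_triangle_ineq) auto
    also have "\<dots> \<le> 2 * (cmod (f x))\<^sup>2 + 2 * (cmod (g x))\<^sup>2"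
      using sum_squares_bound[of "cmod (f x)" "cmod (g x)"] by (simp add: power2_sum)
    finally show ?thesis .
  qed
  have "integrable lborel (\<lambda>x. 2 * (cmod (f x))\<^sup>2 + 2 * (cmod (g x))\<^sup>2)"
    using L2_sq_integrable f g by auto
  then have "integrable lborel (\<lambda>x. (cmod (f x + g x))\<^sup>2)"
    by (rule Bochner_Integration.integrable_bound) (use b in auto)
  then show ?thesis by (simp add: L2_def)
qed

lemma L2_zero: "(\<lambda>x. 0) \<in> L2" by (simp add: L2_def)

lemma L2_uminus: "f \<in> L2 \<Longrightarrow> (\<lambda>x. - f x) \<in> L2" using L2_cmult[of f "-1"] by simp

lemma L2_diff: "f \<in> L2 \<Longrightarrow> g \<in> L2 \<Longrightarrow> (\<lambda>x. f x - g x) \<in> L2"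
  using L2_add[of f "\<lambda>x. - g x"] L2_uminus by simp

lemma L2_sum: "(\<And>i. i \<in> I \<Longrightarrow> f i \<in> L2) \<Longrightarrow> (\<lambda>x. \<Sum>i\<in>I. f i x) \<in> L2"
  by (induction I rule: infinite_finite_induct) (auto intro: L2_zero L2_add)

lemma L2_cnj: assumes "f \<in> L2" shows "(\<lambda>x. cnj (f x)) \<in> L2"
proof -
  have c: "cnj \<in> borel_measurable borel"
    by (intro borel_measurable_continuous_onI continuous_on_cnj continuous_on_id)
  have "(\<lambda>x. cnj (f x)) \<in> borel_measurable borel"
    by (rule measurable_compose[OF L2_measurable[OF assms] c])
  then show ?thesis
    by (rule L2_bound[OF assms, where C = 1]) simp
qed

lemma L2_test_function: assumes \<phi>: "test_function \<phi>" shows "(\<lambda>x. of_real (\<phi> x)) \<in> L2"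
proof -
  obtain B where B: "\<And>x. \<bar>\<phi> x\<bar> \<le> B" "B \<ge> 0" using test_function_bounded[OF \<phi>] by auto
  obtain R where R: "\<And>x. norm x > R \<Longrightarrow> \<phi> x = 0" using \<phi> unfolding test_function_iff by blast
  have [measurable]: "\<phi> \<in> borel_measurable borel" 
    using test_function_smooth[OF \<phi>] smooth_measurable by blast
  have "cmod (of_real (\<phi> x)) \<le> (B * exp R) * majorant 1 (dist x 0)" if "x \<noteq> 0" for x
  proof (cases "norm x > R")
    case True
    then show ?thesis using B by (simp add: R majorant_def)
  next
    case False
    have "1 * 1 \<le> exp (R - norm x) * (1 + 1 / norm x)" using False by (intro mult_mono) auto
    then have "B * 1 \<le> B * (exp (R - norm x) * (1 + 1 / norm x))" using B(2) by (intro mult_left_mono) auto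
    moreover have "B * (exp (R - norm x) * (1 + 1 / norm x)) = (B * exp R) * majorant 1 (dist x 0)"
      by (simp add: majorant_def exp_diff exp_minus divide_inverse)
    ultimately show ?thesis using B(1)[of x] by simp
  qed
  then show ?thesis by (intro L2_by_majorant[where p = 0]) auto
qed

section \<open>Integration by parts\<close>

lemma measurable_dist3 [measurable]: "(\<lambda>x::real^3. dist x p) \<in> borel_measurable borel"
  by (intro borel_measurable_continuous_onI continuous_on_dist continuous_on_id continuous_on_const)

lemma measurable_coord3 [measurable]: "(\<lambda>x::real^3. (x - p) $ i) \<in> borel_measurable borel"
  by (intro borel_measurable_continuous_onI continuous_on_component continuous_on_diff
      continuous_on_id continuous_on_const)

lemma AE_coord_ne: "AE x in lborel. (x::real^3) $ j \<noteq> c"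
proof -
  have "negligible {x::real^3. x \<bullet> axis j 1 = c}"
    by (rule negligible_standard_hyperplane) (auto simp: Basis_vec_def)
  then have "{x::real^3. x $ j = c} \<in> null_sets (completion lborel)"
    by (simp add: inner_axis negligible_iff_null_sets)
  moreover have "{x::real^3. x $ j = c} \<in> sets lborel"
    by measurable
  ultimately have "{x::real^3. x $ j = c} \<in> null_sets lborel"
    using null_sets_completion_iff by blast
  then show ?thesis using AE_not_in by force
qed

lemma integral_translate:
  fixes w :: "real^3 \<Rightarrow> 'a::{banach, second_countable_topology}"
  assumes [measurable]: "w \<in> borel_measurable borel"
  shows "(\<integral>x. w (v + x) \<partial>lborel) = (\<integral>x. w x \<partial>lborel)"
    and "integrable lborel (\<lambda>x. w (v + x)) = integrable lborel w"
proof -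
  have "(\<integral>x. w x \<partial>distr lborel borel ((+) v)) = (\<integral>x. w (v + x) \<partial>lborel)"
    by (rule integral_distr) auto
  then show "(\<integral>x. w (v + x) \<partial>lborel) = (\<integral>x. w x \<partial>lborel)"
    by (simp add: lborel_distr_plus)
  have "integrable (distr lborel borel ((+) v)) w = integrable lborel (\<lambda>x. w (v + x))"
    by (rule integrable_distr_eq) auto
  then show "integrable lborel (\<lambda>x. w (v + x)) = integrable lborel w"
    by (simp add: lborel_distr_plus)
qed

lemma integrable_bounded_support:
  fixes w :: "real^3 \<Rightarrow> real"
  assumes [measurable]: "w \<in> borel_measurable borel"
    and bw: "\<And>x. \<bar>w x\<bar> \<le> L" and supp: "\<And>x. norm x > R \<Longrightarrow> w x = 0"
  shows "integrable lborel w"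
proof -
  have "emeasure lborel (cball (0::real^3) R) < \<infinity>"
    using emeasure_bounded_finite[of "cball (0::real^3) R"] by simp
  then have i: "integrable lborel (\<lambda>x::real^3. indicator (cball 0 R) x *\<^sub>R L)"
    by simp
  have "norm (w x) \<le> norm (indicator (cball 0 R) x *\<^sub>R L)" for x
    using bw[of x] supp[of x] by (cases "norm x > R") (auto simp: indicator_def)
  then show ?thesis
    by (intro Bochner_Integration.integrable_bound[OF i]) auto
qed

text \<open>Lebesgue measure is translation invariant, so the difference quotients of \<open>w\<close> have integral
  zero. A single exceptional point only spoils the difference quotients on one line.\<close>

lemma integral_partial_zero:
  fixes w w' :: "real^3 \<Rightarrow> real"
  assumes [measurable]: "w \<in> borel_measurable borel" "w' \<in> borel_measurable borel"
    and d: "\<And>x. x \<noteq> p \<Longrightarrow> ((\<lambda>t. w (x + t *\<^sub>R axis i 1)) has_real_derivative w' x) (at 0)"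
    and bw: "\<And>x. \<bar>w x\<bar> \<le> L" and bw': "\<And>x. x \<noteq> p \<Longrightarrow> \<bar>w' x\<bar> \<le> L"
    and supp: "\<And>x. norm x > R \<Longrightarrow> w x = 0"
  shows "(\<integral>x. w' x \<partial>lborel) = 0"
proof -
  let ?e = "axis i 1 :: real^3"
  define h where "h n = 1 / real (Suc n)" for n
  have h: "h n > 0" "h n \<le> 1" for n by (auto simp: h_def)
  define D where "D n x = (w (x + h n *\<^sub>R ?e) - w x) / h n" for n x
  have [measurable]: "D n \<in> borel_measurable borel" for n unfolding D_def by measurable
  have iw: "integrable lborel w" by (rule integrable_bounded_support) (use bw supp in auto)
  have D0: "(\<integral>x. D n x \<partial>lborel) = 0" for n
  proof -
    have "integrable lborel (\<lambda>x. w (x + h n *\<^sub>R ?e))" 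
      "(\<integral>x. w (x + h n *\<^sub>R ?e) \<partial>lborel) = (\<integral>x. w x \<partial>lborel)"
      using integral_translate[of w "h n *\<^sub>R ?e"] iw by (auto simp: add.commute)
    then show ?thesis using iw by (simp add: D_def[abs_def])
  qed
  have h0: "filterlim h (at 0) sequentially" 
  proof -
    have "h \<longlonglongrightarrow> 0" unfolding h_def by real_asymp
    then show ?thesis using h by (auto simp: filterlim_at less_imp_neq[symmetric])
  qed
  have lim: "(\<lambda>n. D n x) \<longlonglongrightarrow> w' x" if "x \<noteq> p" for x
  proof -
    have "((\<lambda>t. (w (x + t *\<^sub>R ?e) - w x) / t) \<longlongrightarrow> w' x) (at 0)"
      using d[OF that] by (simp add: DERIV_def)
    from filterlim_compose[OF this h0] show ?thesis by (simp add: D_def)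
  qed
  \<comment> \<open>If \<open>x\<close> and \<open>p\<close> differ in a coordinate \<open>j \<noteq> i\<close>, the line through \<open>x\<close> in direction \<open>i\<close> avoids \<open>p\<close>.\<close>
  obtain j where j: "j \<noteq> i"
    by (metis (full_types) zero_neq_one)
  have b: "\<bar>D n x\<bar> \<le> L * indicator (cball 0 (\<bar>R\<bar> + 1)) x" if x: "x $ j \<noteq> p $ j" for n x
  proof (cases "norm x > \<bar>R\<bar> + 1")
    case True
    have "norm x \<le> norm (x + h n *\<^sub>R ?e) + norm (h n *\<^sub>R ?e)"
      by (metis add_diff_cancel norm_triangle_ineq4)
    then have "norm (x + h n *\<^sub>R ?e) > R" using True h[of n] by (simp add: norm_axis_1)
    moreover have "norm x > R" using True by linarith
    ultimately have "D n x = 0" by (simp add: D_def supp)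
    moreover have "L \<ge> 0" using bw[of x] by linarith
    ultimately show ?thesis by simp
  next
    case False
    define u where "u t = w (x + t *\<^sub>R ?e)" for t
    have ne: "x + t *\<^sub>R ?e \<noteq> p" for t
    proof
      assume "x + t *\<^sub>R ?e = p"
      then have "(x + t *\<^sub>R ?e) $ j = p $ j" by simp
      then show False using j x by (simp add: axis_def)
    qed
    have "(u has_real_derivative w' (x + t *\<^sub>R ?e)) (at t)" for t
    proof -
      have "((\<lambda>s. u (s + t)) has_real_derivative w' (x + t *\<^sub>R ?e)) (at 0)"
        using d[OF ne[of t]] by (simp add: u_def scaleR_add_left algebra_simps)
      then show ?thesis using DERIV_shift[of u _ 0 t] by simp
    qed
    from MVT2[OF h(1)[of n], of u, OF this]
    obtain z where "u (h n) - u 0 = (h n - 0) * w' (x + z *\<^sub>R ?e)" by blast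
    then have "D n x = w' (x + z *\<^sub>R ?e)" using h(1)[of n] by (simp add: D_def u_def)
    then show ?thesis using bw'[OF ne[of z]] False by simp
  qed
  have "(\<lambda>n. \<integral>x. D n x \<partial>lborel) \<longlonglongrightarrow> (\<integral>x. w' x \<partial>lborel)"
  proof (rule integral_dominated_convergence[where w = "\<lambda>x. L * indicator (cball 0 (\<bar>R\<bar> + 1)) x"])
    have "emeasure lborel (cball (0::real^3) (\<bar>R\<bar> + 1)) < \<infinity>"
      using emeasure_bounded_finite[of "cball (0::real^3) (\<bar>R\<bar> + 1)"] by simp
    then show "integrable lborel (\<lambda>x::real^3. L * indicator (cball 0 (\<bar>R\<bar> + 1)) x)" by simp
    show "AE x in lborel. (\<lambda>n. D n x) \<longlonglongrightarrow> w' x"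
      using AE_lborel_singleton[of p] by eventually_elim (rule lim)
    show "AE x in lborel. norm (D n x) \<le> L * indicator (cball 0 (\<bar>R\<bar> + 1)) x" for n
      using AE_coord_ne[of j "p $ j"] by eventually_elim (use b in simp)
  qed auto
  then show ?thesis by (simp add: D0 LIMSEQ_const_iff)
qed

text \<open>On a bounded set \<open>1 + 1/r\<close> is dominated by a multiple of the square of the majorant.\<close>

lemma integrable_test_pole:
  assumes \<phi>: "test_function \<phi>" 
  shows "integrable lborel (\<lambda>x. \<bar>\<phi> x\<bar> * (1 + 1 / dist x p))"
proof -
  obtain B where B: "\<And>x. \<bar>\<phi> x\<bar> \<le> B" "B \<ge> 0" using test_function_bounded[OF \<phi>] by auto
  obtain R where R: "\<And>x. norm x > R \<Longrightarrow> \<phi> x = 0" using \<phi> unfolding test_function_iff by blast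
  have [measurable]: "\<phi> \<in> borel_measurable borel" 
    using test_function_smooth[OF \<phi>] smooth_measurable by blast
  define K where "K = B * exp (2 * (R + norm p))"
  have b: "\<bar>\<phi> x\<bar> * (1 + 1 / dist x p) \<le> K * (majorant 1 (dist x p))\<^sup>2" for x
  proof (cases "norm x > R")
    case True
    then show ?thesis using B by (simp add: R K_def)
  next
    case False
    let ?r = "dist x p"
    have "?r \<le> R + norm p" using False norm_triangle_ineq4[of x p] by (simp add: dist_norm)
    then have "1 \<le> exp (2 * (R + norm p)) * exp (- (2 * ?r))" by (simp add: exp_add[symmetric])
    then have "B * 1 \<le> B * (exp (2 * (R + norm p)) * exp (- (2 * ?r)))"
      using B(2) by (intro mult_left_mono)
    then have 1: "\<bar>\<phi> x\<bar> \<le> K * exp (- (2 * ?r))" using B(1)[of x] by (simp add: K_def mult.assoc)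
    have 2: "1 + 1 / ?r \<le> (1 + 1 / ?r)\<^sup>2" by (rule self_le_power) auto
    have e: "exp (- (2 * ?r)) = (exp (- ?r))\<^sup>2" by (simp add: power2_eq_square exp_add[symmetric])
    have "\<bar>\<phi> x\<bar> * (1 + 1 / ?r) \<le> K * exp (- (2 * ?r)) * (1 + 1 / ?r)\<^sup>2"
      using 1 2 B(2) by (intro mult_mono) (auto simp: K_def)
    also have "\<dots> = K * ((exp (- ?r))\<^sup>2 * (1 + 1 / ?r)\<^sup>2)"
      by (simp only: e mult.assoc)
    also have "\<dots> = K * (majorant 1 ?r)\<^sup>2" by (simp add: majorant_def power_mult_distrib)
    finally show ?thesis .
  qed
  show ?thesis
  proof (rule Bochner_Integration.integrable_bound)
    show "integrable lborel (\<lambda>x. K * (majorant 1 (dist x p))\<^sup>2)"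
      using integrable_majorant_sq[of 1 p] by simp
    show "AE x in lborel. norm (\<bar>\<phi> x\<bar> * (1 + 1 / dist x p)) \<le> norm (K * (majorant 1 (dist x p))\<^sup>2)"
    proof (rule AE_I2)
      fix x show "norm (\<bar>\<phi> x\<bar> * (1 + 1 / dist x p)) \<le> norm (K * (majorant 1 (dist x p))\<^sup>2)"
        using order_trans[OF b[of x] abs_ge_self] by (simp add: abs_mult)
    qed
  qed simp
qed

lemma integrable_test_mult_pole:
  fixes g :: "real^3 \<Rightarrow> real"
  assumes \<phi>: "test_function \<phi>" and [measurable]: "g \<in> borel_measurable borel"
    and bg: "\<And>x. x \<noteq> p \<Longrightarrow> \<bar>g x\<bar> \<le> C * (1 + 1 / dist x p)"
  shows "integrable lborel (\<lambda>x. \<phi> x * g x)"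
proof (rule Bochner_Integration.integrable_bound)
  have [measurable]: "\<phi> \<in> borel_measurable borel" 
    using test_function_smooth[OF \<phi>] smooth_measurable by blast
  show "integrable lborel (\<lambda>x. C * (\<bar>\<phi> x\<bar> * (1 + 1 / dist x p)))"
    using integrable_test_pole[OF \<phi>] by simp
  show "AE x in lborel. norm (\<phi> x * g x) \<le> norm (C * (\<bar>\<phi> x\<bar> * (1 + 1 / dist x p)))"
    using AE_lborel_singleton[of p]
  proof eventually_elim
    case (elim x)
    have "\<bar>\<phi> x\<bar> * \<bar>g x\<bar> \<le> \<bar>\<phi> x\<bar> * (C * (1 + 1 / dist x p))"
      by (intro mult_left_mono bg elim) auto
    then have "\<bar>\<phi> x * g x\<bar> \<le> C * (\<bar>\<phi> x\<bar> * (1 + 1 / dist x p))" by (simp add: abs_mult mult_ac)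
    then show ?case unfolding real_norm_def by (rule order_trans[OF _ abs_ge_self])
  qed
  show "(\<lambda>x. \<phi> x * g x) \<in> borel_measurable lborel" by simp
qed

lemma norm_line_derivative:
  fixes x p :: "real^3"
  assumes "x \<noteq> p"
  shows "((\<lambda>t. dist (x + t *\<^sub>R axis i 1) p) has_real_derivative (x - p) $ i / dist x p) (at 0)"
proof -
  have "((\<lambda>t. (x - p) + t *\<^sub>R axis i 1) has_derivative (\<lambda>t. t *\<^sub>R axis i 1)) (at 0)"
    by (auto intro!: derivative_eq_intros)
  moreover have "(norm has_derivative (\<lambda>v. sgn (x - p) \<bullet> v)) (at ((x - p) + 0 *\<^sub>R axis i 1))"
    using has_derivative_norm[of "x - p"] assms by (simp add: inner_commute)
  ultimately have "((\<lambda>t. norm ((x - p) + t *\<^sub>R axis i 1)) has_derivative (\<lambda>t. sgn (x - p) \<bullet> (t *\<^sub>R axis i 1))) (at 0)"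
    by (rule has_derivative_compose)
  moreover have "(\<lambda>t. sgn (x - p) \<bullet> (t *\<^sub>R axis i 1)) = (*) ((x - p) $ i / dist x p)"
    by (auto simp: sgn_div_norm inner_axis dist_norm divide_inverse)
  ultimately have "((\<lambda>t. norm ((x - p) + t *\<^sub>R axis i 1)) has_real_derivative (x - p) $ i / dist x p) (at 0)"
    by (simp add: has_field_derivative_def)
  then show ?thesis by (simp add: dist_norm algebra_simps)
qed

text \<open>The singularity is removed with the factor \<open>r/(r+\<epsilon>)\<close>: it makes the derivative bounded, and its own
  gradient is dominated by the locally integrable function \<open>1/r\<close> and tends to zero.\<close>

lemma integration_by_parts_pole:
  fixes f g :: "real^3 \<Rightarrow> real"
  assumes \<phi>: "test_function \<phi>" 
    and [measurable]: "f \<in> borel_measurable borel" "g \<in> borel_measurable borel"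
    and d: "\<And>x. x \<noteq> p \<Longrightarrow> ((\<lambda>t. f (x + t *\<^sub>R axis i 1)) has_real_derivative g x) (at 0)"
    and bf: "\<And>x. \<bar>f x\<bar> \<le> C" and bg: "\<And>x. x \<noteq> p \<Longrightarrow> \<bar>g x\<bar> \<le> C * (1 + 1 / dist x p)"
  shows "(\<integral>x. partial i \<phi> x * f x \<partial>lborel) = - (\<integral>x. \<phi> x * g x \<partial>lborel)"
proof -
  have C: "C \<ge> 0" using bf[of 0] by linarith
  have \<phi>': "test_function (partial i \<phi>)" by (rule test_function_partial[OF \<phi>])
  obtain B where B: "\<And>x. \<bar>\<phi> x\<bar> \<le> B" "B \<ge> 0" using test_function_bounded[OF \<phi>] by auto
  obtain B' where B': "\<And>x. \<bar>partial i \<phi> x\<bar> \<le> B'" "B' \<ge> 0" using test_function_bounded[OF \<phi>'] by auto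
  obtain R where R: "\<And>x. norm x > R \<Longrightarrow> \<phi> x = 0" using \<phi> unfolding test_function_iff by blast
  have [measurable]: "\<phi> \<in> borel_measurable borel" "partial i \<phi> \<in> borel_measurable borel"
    using test_function_smooth \<phi> \<phi>' smooth_measurable by blast+
  define \<epsilon> where "\<epsilon> n = 1 / real (Suc n)" for n
  have \<epsilon>: "\<epsilon> n > 0" for n by (auto simp: \<epsilon>_def)
  have \<epsilon>0: "\<epsilon> \<longlonglongrightarrow> 0" unfolding \<epsilon>_def by real_asymp
  define \<theta> where "\<theta> n x = dist x p / (dist x p + \<epsilon> n)" for n x
  define \<theta>' where "\<theta>' n x = \<epsilon> n / (dist x p + \<epsilon> n)\<^sup>2 * ((x - p) $ i / dist x p)" for n x
  have [measurable]: "\<theta> n \<in> borel_measurable borel" "\<theta>' n \<in> borel_measurable borel" for n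
    unfolding \<theta>_def \<theta>'_def by measurable
  have \<theta>d: "((\<lambda>t. \<theta> n (x + t *\<^sub>R axis i 1)) has_real_derivative \<theta>' n x) (at 0)" if "x \<noteq> p" for n x
  proof -
    have "dist x p + \<epsilon> n \<noteq> 0" using \<epsilon>[of n] by (smt (verit) zero_le_dist)
    then have "((\<lambda>r. r / (r + \<epsilon> n)) has_real_derivative \<epsilon> n / (dist x p + \<epsilon> n)\<^sup>2) 
        (at (dist (x + 0 *\<^sub>R axis i 1) p))"
      by (auto intro!: derivative_eq_intros simp: power2_eq_square field_simps)
    from DERIV_chain2[OF this norm_line_derivative[OF that]]
    show ?thesis unfolding \<theta>_def \<theta>'_def .
  qed
  have \<theta>b: "0 \<le> \<theta> n x" "\<theta> n x \<le> 1" for n x 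
    using add_nonneg_pos[OF zero_le_dist[of x p] \<epsilon>[of n]] \<epsilon>[of n] by (auto simp: \<theta>_def divide_le_eq_1)
  have c: "\<bar>(x - p) $ i / dist x p\<bar> \<le> 1" for x
    using component_le_norm_cart[of "x - p" i] by (simp add: dist_norm divide_le_eq_1)
  have \<theta>'b: "\<bar>\<theta>' n x\<bar> \<le> 1 / \<epsilon> n" "x \<noteq> p \<Longrightarrow> \<bar>\<theta>' n x\<bar> \<le> 1 / dist x p" for n x
  proof -
    let ?r = "dist x p" and ?e = "\<epsilon> n"
    have e: "?e > 0" by (rule \<epsilon>)
    have pos: "?r + ?e > 0" by (rule add_nonneg_pos[OF zero_le_dist e])
    have *: "\<bar>\<theta>' n x\<bar> \<le> ?e / (?r + ?e)\<^sup>2"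
    proof -
      have "\<bar>\<theta>' n x\<bar> = ?e / (?r + ?e)\<^sup>2 * \<bar>(x - p) $ i / ?r\<bar>"
        using e by (simp add: \<theta>'_def abs_mult)
      also have "\<dots> \<le> ?e / (?r + ?e)\<^sup>2 * 1" using e by (intro mult_left_mono c) auto
      finally show ?thesis by simp
    qed
    also have "?e / (?r + ?e)\<^sup>2 \<le> ?e / ?e\<^sup>2"
      using e pos by (intro divide_left_mono power_mono mult_pos_pos zero_less_power) auto
    also have "\<dots> = 1 / ?e" by (simp add: power2_eq_square)
    finally show "\<bar>\<theta>' n x\<bar> \<le> 1 / ?e" .
    assume "x \<noteq> p"
    then have r: "?r > 0" by simp
    have "?e / (?r + ?e)\<^sup>2 \<le> (?r + ?e) / (?r + ?e)\<^sup>2" using e by (intro divide_right_mono) auto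
    also have "\<dots> = 1 / (?r + ?e)" by (simp add: power2_eq_square)
    also have "\<dots> \<le> 1 / ?r" using r e pos by (intro divide_left_mono mult_pos_pos) auto
    finally show "\<bar>\<theta>' n x\<bar> \<le> 1 / dist x p" using * by linarith
  qed
  define w where "w n x = \<phi> x * f x * \<theta> n x" for n x
  define w' where "w' n x = partial i \<phi> x * f x * \<theta> n x + \<phi> x * g x * \<theta> n x + \<phi> x * f x * \<theta>' n x" for n x
  have [measurable]: "w n \<in> borel_measurable borel" "w' n \<in> borel_measurable borel" for n
    unfolding w_def w'_def by measurable
  have w'0: "(\<integral>x. w' n x \<partial>lborel) = 0" for n
  proof (rule integral_partial_zero[where w = "w n" and p = p and i = i and R = R 
      and L = "B' * C + B * C * (1 + 1 / \<epsilon> n) + B * C * (1 / \<epsilon> n)"])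
    fix x assume x: "x \<noteq> p"
    have "((\<lambda>t. \<phi> (x + t *\<^sub>R axis i 1)) has_real_derivative partial i \<phi> x) (at 0)"
      using test_function_smooth[OF \<phi>] by (intro partial_has_real_derivative smooth_differentiable)
    from DERIV_mult[OF DERIV_mult[OF this d[OF x]] \<theta>d[OF x]]
    show "((\<lambda>t. w n (x + t *\<^sub>R axis i 1)) has_real_derivative w' n x) (at 0)"
      unfolding w_def w'_def by (simp add: algebra_simps)
    have 1: "\<bar>partial i \<phi> x * f x * \<theta> n x\<bar> \<le> B' * C"
    proof -
      have "\<bar>partial i \<phi> x\<bar> * \<bar>f x\<bar> * \<bar>\<theta> n x\<bar> \<le> B' * C * 1"
        using B' bf C \<theta>b by (intro mult_mono) auto
      then show ?thesis by (simp add: abs_mult)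
    qed
    have "\<bar>g x\<bar> * \<bar>\<theta> n x\<bar> \<le> C * (1 + 1 / \<epsilon> n)"
    proof -
      have r: "dist x p > 0" using x by simp
      have "\<bar>g x\<bar> * \<bar>\<theta> n x\<bar> \<le> C * (1 + 1 / dist x p) * \<theta> n x"
        using bg[OF x] \<theta>b[of n x] by (simp add: mult_right_mono)
      also have "\<dots> = C * (((1 + 1 / dist x p) * dist x p) / (dist x p + \<epsilon> n))"
        by (simp add: \<theta>_def)
      also have "(1 + 1 / dist x p) * dist x p = dist x p + 1"
        using r by (simp add: distrib_right)
      also have "(dist x p + 1) / (dist x p + \<epsilon> n) \<le> 1 + 1 / \<epsilon> n"
      proof -
        have "dist x p / (dist x p + \<epsilon> n) \<le> 1"
          using \<theta>b(2)[of n x] by (simp add: \<theta>_def)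
        moreover have "1 / (dist x p + \<epsilon> n) \<le> 1 / \<epsilon> n"
          using r \<epsilon>[of n] by (intro divide_left_mono mult_pos_pos add_pos_pos) auto
        ultimately show ?thesis by (simp add: add_divide_distrib)
      qed
      finally show ?thesis using C by (simp add: mult_left_mono)
    qed
    then have "\<bar>\<phi> x\<bar> * (\<bar>g x\<bar> * \<bar>\<theta> n x\<bar>) \<le> B * (C * (1 + 1 / \<epsilon> n))"
      by (rule mult_mono[rotated]) (use B in auto)
    then have 2: "\<bar>\<phi> x * g x * \<theta> n x\<bar> \<le> B * C * (1 + 1 / \<epsilon> n)" by (simp add: abs_mult mult.assoc)
    have 3: "\<bar>\<phi> x * f x * \<theta>' n x\<bar> \<le> B * C * (1 / \<epsilon> n)"
    proof -
      have "\<bar>\<phi> x\<bar> * \<bar>f x\<bar> * \<bar>\<theta>' n x\<bar> \<le> B * C * (1 / \<epsilon> n)"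
        using B bf C \<theta>'b(1) by (intro mult_mono) auto
      then show ?thesis by (simp add: abs_mult)
    qed
    show "\<bar>w' n x\<bar> \<le> B' * C + B * C * (1 + 1 / \<epsilon> n) + B * C * (1 / \<epsilon> n)"
      unfolding w'_def using 1 2 3 by linarith
  next
    fix x
    have "\<bar>\<phi> x\<bar> * \<bar>f x\<bar> * \<bar>\<theta> n x\<bar> \<le> B * C * 1"
      using B bf C \<theta>b by (intro mult_mono) auto
    then have 1: "\<bar>w n x\<bar> \<le> B * C" by (simp add: abs_mult w_def)
    have "0 \<le> B' * C" "0 \<le> B * C * (1 / \<epsilon> n)" using B B' C \<epsilon>[of n] by auto
    then show "\<bar>w n x\<bar> \<le> B' * C + B * C * (1 + 1 / \<epsilon> n) + B * C * (1 / \<epsilon> n)"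
      using 1 by (simp add: distrib_left)
  qed (auto simp: w_def R)
  have i1: "integrable lborel (\<lambda>x. partial i \<phi> x * f x)"
  proof (rule integrable_test_mult_pole[OF \<phi>', where C = C and p = p])
    fix x 
    have "C * 1 \<le> C * (1 + 1 / dist x p)" using C by (intro mult_left_mono) auto
    then show "\<bar>f x\<bar> \<le> C * (1 + 1 / dist x p)" using bf[of x] by linarith
  qed simp
  have i2: "integrable lborel (\<lambda>x. \<phi> x * g x)"
    by (rule integrable_test_mult_pole[OF \<phi> _ bg]) auto
  have "(\<lambda>n. \<integral>x. w' n x \<partial>lborel) \<longlonglongrightarrow> (\<integral>x. partial i \<phi> x * f x + \<phi> x * g x \<partial>lborel)"
  proof (rule integral_dominated_convergence[where 
      w = "\<lambda>x. \<bar>partial i \<phi> x * f x\<bar> + \<bar>\<phi> x * g x\<bar> + C * (\<bar>\<phi> x\<bar> * (1 + 1 / dist x p))"])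
    show "integrable lborel (\<lambda>x. \<bar>partial i \<phi> x * f x\<bar> + \<bar>\<phi> x * g x\<bar> + C * (\<bar>\<phi> x\<bar> * (1 + 1 / dist x p)))"
      using i1 i2 integrable_test_pole[OF \<phi>] by auto
    show "AE x in lborel. (\<lambda>n. w' n x) \<longlonglongrightarrow> partial i \<phi> x * f x + \<phi> x * g x"
      using AE_lborel_singleton[of p]
    proof eventually_elim
      case (elim x)
      then have r: "dist x p + 0 \<noteq> 0" by simp
      have "(\<lambda>n. \<theta> n x) \<longlonglongrightarrow> dist x p / (dist x p + 0)"
        unfolding \<theta>_def by (intro tendsto_intros \<epsilon>0 r)
      then have 1: "(\<lambda>n. \<theta> n x) \<longlonglongrightarrow> 1" using elim by simp
      have "(\<lambda>n. \<theta>' n x) \<longlonglongrightarrow> 0 / (dist x p + 0)\<^sup>2 * ((x - p) $ i / dist x p)"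
        unfolding \<theta>'_def by (intro tendsto_intros \<epsilon>0) (use r in auto)
      then have 2: "(\<lambda>n. \<theta>' n x) \<longlonglongrightarrow> 0" by simp
      have "(\<lambda>n. w' n x) \<longlonglongrightarrow> partial i \<phi> x * f x * 1 + \<phi> x * g x * 1 + \<phi> x * f x * 0"
        unfolding w'_def by (intro tendsto_intros 1 2)
      then show ?case by simp
    qed
    show "AE x in lborel. norm (w' n x) \<le> \<bar>partial i \<phi> x * f x\<bar> + \<bar>\<phi> x * g x\<bar> + C * (\<bar>\<phi> x\<bar> * (1 + 1 / dist x p))" for n
      using AE_lborel_singleton[of p]
    proof eventually_elim
      case (elim x)
      have 1: "\<bar>partial i \<phi> x * f x * \<theta> n x\<bar> \<le> \<bar>partial i \<phi> x * f x\<bar>"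
        using \<theta>b[of n x] by (simp add: abs_mult mult_left_le)
      have 2: "\<bar>\<phi> x * g x * \<theta> n x\<bar> \<le> \<bar>\<phi> x * g x\<bar>"
        using \<theta>b[of n x] by (simp add: abs_mult mult_left_le)
      have "\<bar>\<phi> x\<bar> * \<bar>f x\<bar> * \<bar>\<theta>' n x\<bar> \<le> \<bar>\<phi> x\<bar> * C * (1 + 1 / dist x p)"
      proof (rule mult_mono)
        show "\<bar>\<theta>' n x\<bar> \<le> 1 + 1 / dist x p" using \<theta>'b(2)[OF elim, of n] by linarith
      qed (auto intro: mult_left_mono bf simp: C)
      then have 3: "\<bar>\<phi> x * f x * \<theta>' n x\<bar> \<le> C * (\<bar>\<phi> x\<bar> * (1 + 1 / dist x p))"
        by (simp add: abs_mult mult_ac)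
      show ?case unfolding w'_def real_norm_def using 1 2 3 by linarith
    qed
  qed auto
  then have "(\<integral>x. partial i \<phi> x * f x + \<phi> x * g x \<partial>lborel) = 0" 
    by (simp add: w'0 LIMSEQ_const_iff)
  then show ?thesis using i1 i2 by simp
qed

text \<open>Multiplying with a cut-off turns \<open>\<phi>\<close> into a test function, and the derivative of the cut-off
  contributes a term of order \<open>1/n\<close>.\<close>

lemma weak_partial_L2_test:
  assumes w: "weak_partial i f g" and s: "smooth \<phi>"
    and \<phi>: "(\<lambda>x. of_real (\<phi> x)) \<in> L2" and \<phi>': "(\<lambda>x. of_real (partial i \<phi> x)) \<in> L2"
  shows "(\<integral>x. of_real (partial i \<phi> x) * f x \<partial>lborel) = - (\<integral>x. of_real (\<phi> x) * g x \<partial>lborel)"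
proof -
  have f: "f \<in> L2" and g: "g \<in> L2" using w unfolding weak_partial_def by auto
  have [measurable]: "f \<in> borel_measurable borel" "g \<in> borel_measurable borel"
    using f g L2_measurable by auto
  have [measurable]: "\<phi> \<in> borel_measurable borel" "partial i \<phi> \<in> borel_measurable borel"
    using s smooth_partial smooth_measurable by blast+
  obtain B where B: "B \<ge> 0" "\<And>n i x. \<bar>partial i (cutoff n) x\<bar> \<le> B / real (Suc n)"
    using partial_cutoff_bound by blast
  have [measurable]: "cutoff n \<in> borel_measurable borel" "partial i (cutoff n) \<in> borel_measurable borel" for n
    using test_function_smooth[OF test_function_cutoff] smooth_partial smooth_measurable by blast+
  have p: "partial i (\<lambda>x. cutoff n x * \<phi> x) x = cutoff n x * partial i \<phi> x + partial i (cutoff n) x * \<phi> x" for n x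
    by (intro partial_mult smooth_differentiable s test_function_smooth[OF test_function_cutoff])
  have eq: "(\<integral>x. of_real (cutoff n x * partial i \<phi> x + partial i (cutoff n) x * \<phi> x) * f x \<partial>lborel)
     = - (\<integral>x. of_real (cutoff n x * \<phi> x) * g x \<partial>lborel)" for n
  proof -
    have "test_function (\<lambda>x. cutoff n x * \<phi> x)"
      by (intro test_function_mult test_function_cutoff s)
    then show ?thesis using w unfolding weak_partial_def p[symmetric] scaleR_conv_of_real by blast
  qed
  have B0: "(\<lambda>n. B / real (Suc n)) \<longlonglongrightarrow> 0" by real_asymp
  have c0: "(\<lambda>n. partial i (cutoff n) x) \<longlonglongrightarrow> 0" for x
    by (rule tendsto_rabs_zero_cancel, rule tendsto_sandwich[OF _ _ tendsto_const B0]) (use B in auto)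
  have "B / real (Suc n) \<le> B" for n using B(1) by (simp add: field_simps)
  then have cB: "\<bar>partial i (cutoff n) x\<bar> \<le> B" for n x using B(2) order_trans by blast
  have "(\<lambda>n. \<integral>x. of_real (cutoff n x * partial i \<phi> x + partial i (cutoff n) x * \<phi> x) * f x \<partial>lborel)
     \<longlonglongrightarrow> (\<integral>x. of_real (partial i \<phi> x) * f x \<partial>lborel)"
  proof (rule integral_dominated_convergence[where 
      w = "\<lambda>x. cmod (of_real (partial i \<phi> x) * f x) + B * cmod (of_real (\<phi> x) * f x)"])
    show "integrable lborel (\<lambda>x. cmod (of_real (partial i \<phi> x) * f x) + B * cmod (of_real (\<phi> x) * f x))"
      using L2_mult_integrable[OF \<phi> f] L2_mult_integrable[OF \<phi>' f] by simp
    show "AE x in lborel. (\<lambda>n. of_real (cutoff n x * partial i \<phi> x + partial i (cutoff n) x * \<phi> x) * f x) 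
       \<longlonglongrightarrow> of_real (partial i \<phi> x) * f x"
    proof (rule AE_I2)
      fix x 
      have "(\<lambda>n. of_real (cutoff n x * partial i \<phi> x + partial i (cutoff n) x * \<phi> x) * f x) 
       \<longlonglongrightarrow> of_real (1 * partial i \<phi> x + 0 * \<phi> x) * f x"
        by (intro tendsto_intros cutoff_tendsto_1 c0)
      then show "(\<lambda>n. of_real (cutoff n x * partial i \<phi> x + partial i (cutoff n) x * \<phi> x) * f x) 
       \<longlonglongrightarrow> of_real (partial i \<phi> x) * f x" by simp
    qed
    show "AE x in lborel. cmod (of_real (cutoff n x * partial i \<phi> x + partial i (cutoff n) x * \<phi> x) * f x)
       \<le> cmod (of_real (partial i \<phi> x) * f x) + B * cmod (of_real (\<phi> x) * f x)" for n
    proof (rule AE_I2)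
      fix x
      have 1: "\<bar>cutoff n x * partial i \<phi> x\<bar> \<le> \<bar>partial i \<phi> x\<bar>"
        using cutoff_bounds[of n x] by (simp add: abs_mult mult_left_le_one_le)
      have 2: "\<bar>partial i (cutoff n) x * \<phi> x\<bar> \<le> B * \<bar>\<phi> x\<bar>"
        using cB[of n x] by (simp add: abs_mult mult_right_mono)
      have "\<bar>cutoff n x * partial i \<phi> x + partial i (cutoff n) x * \<phi> x\<bar> \<le> \<bar>partial i \<phi> x\<bar> + B * \<bar>\<phi> x\<bar>"
        using 1 2 by linarith
      from mult_right_mono[OF this, of "cmod (f x)"]
      show "cmod (of_real (cutoff n x * partial i \<phi> x + partial i (cutoff n) x * \<phi> x) * f x)
       \<le> cmod (of_real (partial i \<phi> x) * f x) + B * cmod (of_real (\<phi> x) * f x)"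
        unfolding norm_mult norm_of_real by (simp add: distrib_right mult.assoc)
    qed
  qed measurable
  moreover have "(\<lambda>n. \<integral>x. of_real (cutoff n x * \<phi> x) * g x \<partial>lborel) \<longlonglongrightarrow> (\<integral>x. of_real (\<phi> x) * g x \<partial>lborel)"
  proof (rule integral_dominated_convergence[where w = "\<lambda>x. cmod (of_real (\<phi> x) * g x)"])
    show "integrable lborel (\<lambda>x. cmod (of_real (\<phi> x) * g x))"
      using L2_mult_integrable[OF \<phi> g] by simp
    show "AE x in lborel. (\<lambda>n. of_real (cutoff n x * \<phi> x) * g x) \<longlonglongrightarrow> of_real (\<phi> x) * g x"
    proof (rule AE_I2)
      fix x 
      have "(\<lambda>n. of_real (cutoff n x * \<phi> x) * g x) \<longlonglongrightarrow> of_real (1 * \<phi> x) * g x"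
        by (intro tendsto_intros cutoff_tendsto_1)
      then show "(\<lambda>n. of_real (cutoff n x * \<phi> x) * g x) \<longlonglongrightarrow> of_real (\<phi> x) * g x" by simp
    qed
    show "AE x in lborel. cmod (of_real (cutoff n x * \<phi> x) * g x) \<le> cmod (of_real (\<phi> x) * g x)" for n
    proof (rule AE_I2)
      fix x
      have "\<bar>cutoff n x * \<phi> x\<bar> \<le> \<bar>\<phi> x\<bar>"
        using cutoff_bounds[of n x] by (simp add: abs_mult mult_left_le_one_le)
      then show "cmod (of_real (cutoff n x * \<phi> x) * g x) \<le> cmod (of_real (\<phi> x) * g x)"
        unfolding norm_mult norm_of_real by (intro mult_right_mono) auto
    qed
  qed measurable
  ultimately show ?thesis unfolding eq using LIMSEQ_unique tendsto_minus by blast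
qed

section \<open>Elements of \<open>W\<^sub>2\<^sup>2(\<real>\<^sup>3)\<close> and their Laplacians\<close>

lemma weak_partial_add:
  assumes "weak_partial i f g" "weak_partial i f' g'"
  shows "weak_partial i (\<lambda>x. f x + f' x) (\<lambda>x. g x + g' x)"
  unfolding weak_partial_def
proof (intro conjI allI impI)
  have L: "f \<in> L2" "f' \<in> L2" "g \<in> L2" "g' \<in> L2" using assms by (auto simp: weak_partial_def)
  then show "(\<lambda>x. f x + f' x) \<in> L2" "(\<lambda>x. g x + g' x) \<in> L2" by (auto intro: L2_add)
  fix \<phi> assume \<phi>: "test_function \<phi>"
  have int: "integrable lborel (\<lambda>x. \<phi> x *\<^sub>R u x)" "integrable lborel (\<lambda>x. partial i \<phi> x *\<^sub>R u x)" if "u \<in> L2" for u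
    using L2_mult_integrable[OF L2_test_function[OF \<phi>] that]
      L2_mult_integrable[OF L2_test_function[OF test_function_partial[OF \<phi>]] that]
    by (auto simp: scaleR_conv_of_real)
  show "(\<integral>x. partial i \<phi> x *\<^sub>R (f x + f' x) \<partial>lborel) = - (\<integral>x. \<phi> x *\<^sub>R (g x + g' x) \<partial>lborel)"
    using assms \<phi> int L by (simp add: scaleR_add_right weak_partial_def)
qed

lemma weak_partial_cmult:
  assumes "weak_partial i f g"
  shows "weak_partial i (\<lambda>x. c * f x) (\<lambda>x. c * g x)"
proof -
  have "(\<integral>x. a x *\<^sub>R (c * u x) \<partial>lborel) = c * (\<integral>x. a x *\<^sub>R u x \<partial>lborel)"
    for a :: "real^3 \<Rightarrow> real" and u :: "real^3 \<Rightarrow> complex"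
    by (simp flip: mult_scaleR_right)
  then show ?thesis using assms unfolding weak_partial_def by (simp add: L2_cmult)
qed

lemma weak_partial_L2: "weak_partial i f g \<Longrightarrow> g \<in> L2"
  by (simp add: weak_partial_def)

lemma W22_iff: 
  "f \<in> W2 2 \<longleftrightarrow> f \<in> L2 \<and> (\<forall>i. \<exists>g. weak_partial i f g \<and> (\<forall>k. \<exists>h. weak_partial k g h))"
proof -
  have "f \<in> W2 2 \<longleftrightarrow> f \<in> L2 \<and> (\<forall>i. \<exists>g. (g \<in> L2 \<and> (\<forall>k. \<exists>h. h \<in> L2 \<and> weak_partial k g h)) \<and> weak_partial i f g)"
    by (simp add: numeral_2_eq_2 Bex_def)
  then show ?thesis using weak_partial_L2 by (smt (verit))
qed

lemma W22_L2: "f \<in> W2 2 \<Longrightarrow> f \<in> L2" by (simp add: W22_iff)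

lemma W22_add: assumes "f \<in> W2 2" "g \<in> W2 2" shows "(\<lambda>x. f x + g x) \<in> W2 2"
proof -
  obtain p q p' q' where *: "\<And>i. weak_partial i f (p i) \<and> (\<forall>k. weak_partial k (p i) (q i k))"
     "\<And>i. weak_partial i g (p' i) \<and> (\<forall>k. weak_partial k (p' i) (q' i k))"
    using assms unfolding W22_iff by metis
  then have "\<exists>u. weak_partial i (\<lambda>x. f x + g x) u \<and> (\<forall>k. \<exists>h. weak_partial k u h)" for i
    by (intro exI[of _ "\<lambda>x. p i x + p' i x"] conjI allI weak_partial_add
        exI[of _ "\<lambda>x. q i k x + q' i k x" for k]) auto
  then show ?thesis using assms L2_add unfolding W22_iff by blast
qed

lemma W22_cmult: assumes "f \<in> W2 2" shows "(\<lambda>x. c * f x) \<in> W2 2"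
proof -
  obtain p q where *: "\<And>i. weak_partial i f (p i) \<and> (\<forall>k. weak_partial k (p i) (q i k))"
    using assms unfolding W22_iff by metis
  then have "\<exists>u. weak_partial i (\<lambda>x. c * f x) u \<and> (\<forall>k. \<exists>h. weak_partial k u h)" for i
    by (intro exI[of _ "\<lambda>x. c * p i x"] conjI allI weak_partial_cmult
        exI[of _ "\<lambda>x. c * q i k x" for k]) auto
  then show ?thesis using assms L2_cmult unfolding W22_iff by blast
qed

lemma weak_partial_zero: "weak_partial i (\<lambda>x. 0) (\<lambda>x. 0)"
  by (simp add: weak_partial_def L2_zero)

lemma W22_zero: "(\<lambda>x. 0) \<in> W2 2"
  unfolding W22_iff using weak_partial_zero L2_zero by blast

lemma W22_sum: "(\<And>i. i \<in> I \<Longrightarrow> f i \<in> W2 2) \<Longrightarrow> (\<lambda>x. \<Sum>i\<in>I. f i x) \<in> W2 2"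
  by (induction I rule: infinite_finite_induct) (auto intro: W22_zero W22_add)

lemma has_laplacian_AE_cong:
  assumes "has_laplacian f g" "AE x in lborel. g' x = g x" shows "has_laplacian f g'"
proof -
  obtain p q where *: "\<forall>i. weak_partial i f (p i) \<and> weak_partial i (p i) (q i)" "AE x in lborel. g x = (\<Sum>i\<in>UNIV. q i x)"
    using assms(1) unfolding has_laplacian_def by blast
  from *(2) assms(2) have "AE x in lborel. g' x = (\<Sum>i\<in>UNIV. q i x)" by eventually_elim simp
  with *(1) show ?thesis unfolding has_laplacian_def by blast
qed

lemma W22_has_laplacian: 
  assumes "f \<in> W2 2" obtains v where "v \<in> L2" "has_laplacian f v"
proof -
  obtain p q where "\<And>i. weak_partial i f (p i) \<and> (\<forall>k. weak_partial k (p i) (q i k))"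
    using assms unfolding W22_iff by metis
  then have *: "\<And>i. weak_partial i f (p i) \<and> weak_partial i (p i) (q i i)"
    by blast
  then have "\<And>i. q i i \<in> L2" by (auto simp: weak_partial_def)
  then have "(\<lambda>x. \<Sum>i\<in>UNIV. q i i x) \<in> L2" by (intro L2_sum)
  moreover have "has_laplacian f (\<lambda>x. \<Sum>i\<in>UNIV. q i i x)"
    unfolding has_laplacian_def using * by (intro exI[of _ p] exI[of _ "\<lambda>i. q i i"]) auto
  ultimately show ?thesis using that by blast
qed

lemma weak_partial_pole:
  fixes f g :: "real^3 \<Rightarrow> real"
  assumes meas: "f \<in> borel_measurable borel" "g \<in> borel_measurable borel"
    and d: "\<And>x. x \<noteq> p \<Longrightarrow> ((\<lambda>t. f (x + t *\<^sub>R axis i 1)) has_real_derivative g x) (at 0)"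
    and bf: "\<And>x. \<bar>f x\<bar> \<le> C" and bg: "\<And>x. x \<noteq> p \<Longrightarrow> \<bar>g x\<bar> \<le> C * (1 + 1 / dist x p)"
    and L: "(\<lambda>x. of_real (f x)) \<in> L2" "(\<lambda>x. of_real (g x)) \<in> L2"
  shows "weak_partial i (\<lambda>x. of_real (f x)) (\<lambda>x. of_real (g x))"
  unfolding weak_partial_def
proof (intro conjI L allI impI)
  fix \<phi> assume \<phi>: "test_function \<phi>"
  have "complex_of_real (\<integral>x. partial i \<phi> x * f x \<partial>lborel) = of_real (- (\<integral>x. \<phi> x * g x \<partial>lborel))"
    using integration_by_parts_pole[OF \<phi> meas d bf bg] by simp
  then show "(\<integral>x. partial i \<phi> x *\<^sub>R complex_of_real (f x) \<partial>lborel) = - (\<integral>x. \<phi> x *\<^sub>R complex_of_real (g x) \<partial>lborel)"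
    by (simp add: scaleR_conv_of_real flip: of_real_mult)
qed

lemma weak_partial_test_function:
  assumes \<phi>: "test_function \<phi>"
  shows "weak_partial i (\<lambda>x. of_real (\<phi> x)) (\<lambda>x. of_real (partial i \<phi> x))"
proof -
  have \<phi>': "test_function (partial i \<phi>)" by (rule test_function_partial[OF \<phi>])
  obtain B where B: "\<And>x. \<bar>\<phi> x\<bar> \<le> B" "B \<ge> 0" using test_function_bounded[OF \<phi>] by auto
  obtain B' where B': "\<And>x. \<bar>partial i \<phi> x\<bar> \<le> B'" "B' \<ge> 0" using test_function_bounded[OF \<phi>'] by auto
  show ?thesis
  proof (rule weak_partial_pole[where p = 0 and C = "B + B'"])
    show "\<phi> \<in> borel_measurable borel" "partial i \<phi> \<in> borel_measurable borel"
      using test_function_smooth \<phi> \<phi>' smooth_measurable by blast+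
    show "((\<lambda>t. \<phi> (x + t *\<^sub>R axis i 1)) has_real_derivative partial i \<phi> x) (at 0)" for x
      using test_function_smooth[OF \<phi>] by (intro partial_has_real_derivative smooth_differentiable)
    show "\<bar>\<phi> x\<bar> \<le> B + B'" for x using B(1)[of x] B'(2) by linarith
    show "\<bar>partial i \<phi> x\<bar> \<le> (B + B') * (1 + 1 / dist x 0)" for x
    proof -
      have "(B + B') * 1 \<le> (B + B') * (1 + 1 / dist x 0)" using B(2) B'(2) by (intro mult_left_mono) auto
      moreover have "\<bar>partial i \<phi> x\<bar> \<le> (B + B') * 1" using B'(1)[of x] B(2) by simp
      ultimately show ?thesis by (rule order_trans[rotated])
    qed
  qed (intro L2_test_function \<phi> \<phi>')+
qed

lemma test_function_W22: 
  assumes "test_function \<phi>" shows "(\<lambda>x. of_real (\<phi> x)) \<in> W2 2"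
  unfolding W22_iff using L2_test_function weak_partial_test_function test_function_partial assms by blast

definition laplacian :: "(real^3 \<Rightarrow> real) \<Rightarrow> real^3 \<Rightarrow> real" where
  "laplacian \<phi> x = (\<Sum>i\<in>UNIV. partial i (partial i \<phi>) x)"

lemma test_function_has_laplacian:
  assumes "test_function \<phi>" 
  shows "has_laplacian (\<lambda>x. of_real (\<phi> x)) (\<lambda>x. of_real (laplacian \<phi> x))"
  unfolding has_laplacian_def laplacian_def
  by (rule exI[of _ "\<lambda>i x. of_real (partial i \<phi> x)"], rule exI[of _ "\<lambda>i x. of_real (partial i (partial i \<phi>) x)"])
    (auto intro: weak_partial_test_function test_function_partial assms)

subsection \<open>Radial functions\<close>

text \<open>A radial function \<open>\<psi>(r)\<close> has gradient \<open>a(r) (x - p)\<close> and Hessian \<open>a(r) I + b(r) (x - p)(x - p)\<^sup>T\<close>,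
  where \<open>a = \<psi>'/r\<close> and \<open>b = a'/r\<close>. The bounds make the gradient bounded and leave a pole of order one in
  the Hessian, so two integrations by parts are possible.\<close>

lemma radial_W22:
  fixes \<psi> a b :: "real \<Rightarrow> real" and p :: "real^3"
  assumes [measurable]: "\<psi> \<in> borel_measurable borel" "a \<in> borel_measurable borel" "b \<in> borel_measurable borel"
    and \<kappa>: "\<kappa> > 0"
    and d\<psi>: "\<And>r. r > 0 \<Longrightarrow> (\<psi> has_real_derivative r * a r) (at r)"
    and da: "\<And>r. r > 0 \<Longrightarrow> (a has_real_derivative r * b r) (at r)"
    and b\<psi>: "\<And>r. r \<ge> 0 \<Longrightarrow> \<bar>\<psi> r\<bar> \<le> C * exp (- \<kappa> * r)"
    and ba: "\<And>r. r > 0 \<Longrightarrow> \<bar>a r\<bar> \<le> C * exp (- \<kappa> * r) / r"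
    and bb: "\<And>r. r > 0 \<Longrightarrow> \<bar>b r\<bar> \<le> C * exp (- \<kappa> * r) * (1 + 1 / r) / r\<^sup>2"
  shows "(\<lambda>x. of_real (\<psi> (dist x p))) \<in> W2 2"
    and "has_laplacian (\<lambda>x. of_real (\<psi> (dist x p))) 
      (\<lambda>x. of_real (3 * a (dist x p) + b (dist x p) * (dist x p)\<^sup>2))"
proof -
  define P where "P i x = a (dist x p) * (x - p) $ i" for i :: 3 and x
  define Q where "Q k i x = (if i = k then a (dist x p) else 0) + b (dist x p) * (x - p) $ k * (x - p) $ i" for i k :: 3 and x
  have C: "C \<ge> 0" using b\<psi>[of 0] by simp
  have c: "\<bar>(x - p) $ i\<bar> \<le> dist x p" for x i
    using component_le_norm_cart[of "x - p" i] by (simp add: dist_norm)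
  have mf: "(\<lambda>x. \<psi> (dist x p)) \<in> borel_measurable borel" by measurable
  have mP: "P i \<in> borel_measurable borel" for i unfolding P_def by measurable
  have mQ: "Q k i \<in> borel_measurable borel" for k i unfolding Q_def by measurable
  have e1: "exp (- \<kappa> * dist x p) \<le> 1" for x using \<kappa> by simp
  have y: "exp (- \<kappa> * dist x p) \<le> majorant \<kappa> (dist x p)" "exp (- \<kappa> * dist x p) / dist x p \<le> majorant \<kappa> (dist x p)" for x
    by (auto simp: majorant_def distrib_left divide_inverse)
  have B1: "\<bar>\<psi> (dist x p)\<bar> \<le> C * exp (- \<kappa> * dist x p)" for x
    using b\<psi>[of "dist x p"] by simp
  have B2: "\<bar>P i x\<bar> \<le> C * exp (- \<kappa> * dist x p)" for i x
  proof (cases "x = p")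
    case False
    then have r: "dist x p > 0" by simp
    have "\<bar>P i x\<bar> \<le> C * exp (- \<kappa> * dist x p) / dist x p * dist x p"
      unfolding P_def abs_mult by (intro mult_mono ba c r) (use C in auto)
    then show ?thesis using r by simp
  qed (use C in \<open>simp add: P_def\<close>)
  have B3: "\<bar>Q k i x\<bar> \<le> 2 * C * majorant \<kappa> (dist x p)" if "x \<noteq> p" for k i x
  proof -
    from that have r: "dist x p > 0" by simp
    let ?r = "dist x p"
    have "\<bar>if i = k then a ?r else 0\<bar> \<le> \<bar>a ?r\<bar>" by simp
    also have "\<dots> \<le> C * (exp (- \<kappa> * ?r) / ?r)" using ba[OF r] by simp
    also have "\<dots> \<le> C * majorant \<kappa> ?r" by (intro mult_left_mono y C)
    finally have 1: "\<bar>if i = k then a ?r else 0\<bar> \<le> C * majorant \<kappa> ?r" .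
    have "\<bar>b ?r\<bar> * (\<bar>(x - p) $ k\<bar> * \<bar>(x - p) $ i\<bar>) \<le> C * exp (- \<kappa> * ?r) * (1 + 1 / ?r) / ?r\<^sup>2 * (?r * ?r)"
      by (intro mult_mono bb r c) (use C in auto)
    also have "\<dots> = C * majorant \<kappa> ?r" using r by (simp add: majorant_def power2_eq_square)
    finally have 2: "\<bar>b ?r * (x - p) $ k * (x - p) $ i\<bar> \<le> C * majorant \<kappa> ?r"
      by (simp add: abs_mult mult.assoc)
    have "\<bar>Q k i x\<bar> \<le> \<bar>if i = k then a ?r else 0\<bar> + \<bar>b ?r * (x - p) $ k * (x - p) $ i\<bar>"
      unfolding Q_def by (rule abs_triangle_ineq)
    also have "\<dots> \<le> C * majorant \<kappa> ?r + C * majorant \<kappa> ?r" using 1 2 by (rule add_mono)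
    finally show ?thesis by simp
  qed
  have L: "(\<lambda>x. of_real (\<psi> (dist x p))) \<in> L2"
    by (rule L2_by_majorant[where a = \<kappa> and p = p and C = C])
      (use \<kappa> mf order_trans[OF B1 mult_left_mono[OF y(1) C]] in auto)
  have LP: "(\<lambda>x. of_real (P i x)) \<in> L2" for i
    by (rule L2_by_majorant[where a = \<kappa> and p = p and C = C])
      (use \<kappa> mP order_trans[OF B2 mult_left_mono[OF y(1) C]] in auto)
  have LQ: "(\<lambda>x. of_real (Q k i x)) \<in> L2" for k i
    by (rule L2_by_majorant[where a = \<kappa> and p = p and C = "2 * C"]) (use \<kappa> mQ B3 in auto)
  have le1: "C * exp (- \<kappa> * dist x p) \<le> C" for x using mult_left_mono[OF e1 C] by simp
  have le2: "z \<le> 2 * C * (1 + 1 / dist x p)" if "z \<le> C" for x z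
  proof -
    have "C * 1 \<le> 2 * C * (1 + 1 / dist x p)" using C by (intro mult_mono) auto
    then show ?thesis using that by simp
  qed
  have W1: "weak_partial i (\<lambda>x. of_real (\<psi> (dist x p))) (\<lambda>x. of_real (P i x))" for i
  proof (rule weak_partial_pole[where p = p and C = "2 * C"])
    show "\<bar>\<psi> (dist x p)\<bar> \<le> 2 * C" for x using B1[of x] le1[of x] C by linarith
    show "\<bar>P i x\<bar> \<le> 2 * C * (1 + 1 / dist x p)" for x
      by (rule le2) (use B2[of i x] le1[of x] in linarith)
    fix x assume x: "x \<noteq> p"
    then have "(\<psi> has_real_derivative dist x p * a (dist x p)) (at (dist (x + 0 *\<^sub>R axis i 1) p))"
      by (simp add: d\<psi>)
    from DERIV_chain2[OF this norm_line_derivative[OF x]]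
    show "((\<lambda>t. \<psi> (dist (x + t *\<^sub>R axis i 1) p)) has_real_derivative P i x) (at 0)"
      using x by (simp add: P_def)
  qed (intro mf mP L LP)+
  have W2: "weak_partial k (\<lambda>x. of_real (P i x)) (\<lambda>x. of_real (Q k i x))" for i k
  proof (rule weak_partial_pole[where p = p and C = "2 * C"])
    show "\<bar>P i x\<bar> \<le> 2 * C" for x using B2[of i x] le1[of x] C by linarith
    fix x assume x: "x \<noteq> p"
    have "majorant \<kappa> (dist x p) \<le> 1 * (1 + 1 / dist x p)"
      unfolding majorant_def by (intro mult_right_mono e1) auto
    then have "2 * C * majorant \<kappa> (dist x p) \<le> 2 * C * (1 + 1 / dist x p)"
      using C by (simp add: mult_left_mono)
    then show "\<bar>Q k i x\<bar> \<le> 2 * C * (1 + 1 / dist x p)"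
      using B3[OF x, of k i] by linarith
    have "(a has_real_derivative dist x p * b (dist x p)) (at (dist (x + 0 *\<^sub>R axis k 1) p))"
      using x by (simp add: da)
    from DERIV_chain2[OF this norm_line_derivative[OF x]]
    have 1: "((\<lambda>t. a (dist (x + t *\<^sub>R axis k 1) p)) has_real_derivative b (dist x p) * (x - p) $ k) (at 0)"
      using x by (simp add: mult_ac)
    have 2: "((\<lambda>t. (x + t *\<^sub>R axis k 1 - p) $ i) has_real_derivative (if i = k then 1 else 0)) (at 0)"
      by (auto intro!: derivative_eq_intros simp: axis_def)
    show "((\<lambda>t. P i (x + t *\<^sub>R axis k 1)) has_real_derivative Q k i x) (at 0)"
      unfolding P_def by (rule DERIV_cong[OF DERIV_mult[OF 1 2]]) (simp add: Q_def)
  qed (intro mP mQ LP LQ)+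
  show "(\<lambda>x. of_real (\<psi> (dist x p))) \<in> W2 2"
    unfolding W22_iff using L W1 W2 by blast
  have "3 * a (dist x p) + b (dist x p) * (dist x p)\<^sup>2 = (\<Sum>i\<in>UNIV. Q i i x)" for x
    unfolding dist_norm norm3_sq by (simp add: Q_def sum.distrib power2_eq_square sum_distrib_left mult.assoc dist_norm)
  then show "has_laplacian (\<lambda>x. of_real (\<psi> (dist x p))) 
      (\<lambda>x. of_real (3 * a (dist x p) + b (dist x p) * (dist x p)\<^sup>2))"
    unfolding has_laplacian_def using W1 W2
    by (intro exI[of _ "\<lambda>i x. of_real (P i x)"] exI[of _ "\<lambda>i x. of_real (Q i i x)"]) simp
qed

subsection \<open>Yukawa potentials\<close>

definition yukawa :: "real \<Rightarrow> real^3 \<Rightarrow> real^3 \<Rightarrow> real" where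
  "yukawa s p x = exp (- s * dist x p) / dist x p"

text \<open>The profile \<open>\<psi> = exp(-s r)/r\<close> together with the coefficients \<open>a = \<psi>'/r\<close> and \<open>b = a'/r\<close> of its gradient
  and its Hessian.\<close>

definition yuk_prof :: "real \<Rightarrow> real \<Rightarrow> real" where
  "yuk_prof s r = exp (- s * r) / r"

definition yuk_grad :: "real \<Rightarrow> real \<Rightarrow> real" where
  "yuk_grad s r = - exp (- s * r) * (s / r\<^sup>2 + 1 / r ^ 3)"

definition yuk_hess :: "real \<Rightarrow> real \<Rightarrow> real" where
  "yuk_hess s r = exp (- s * r) * (s\<^sup>2 / r ^ 3 + 3 * s / r ^ 4 + 3 / r ^ 5)"

lemma yukawa_eq: "yukawa s p x = yuk_prof s (dist x p)"
  by (simp add: yukawa_def yuk_prof_def)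

lemma yuk_prof_DERIV: "r > 0 \<Longrightarrow> (yuk_prof s has_real_derivative r * yuk_grad s r) (at r)"
  unfolding yuk_prof_def yuk_grad_def
  by (auto intro!: derivative_eq_intros simp: field_simps power2_eq_square power3_eq_cube)

lemma yuk_grad_DERIV: "r > 0 \<Longrightarrow> (yuk_grad s has_real_derivative r * yuk_hess s r) (at r)"
  unfolding yuk_grad_def yuk_hess_def
  by (auto intro!: derivative_eq_intros simp: field_simps eval_nat_numeral)

lemma yuk_prof_laplacian: "r \<noteq> 0 \<Longrightarrow> 3 * yuk_grad s r + yuk_hess s r * r\<^sup>2 = s\<^sup>2 * yuk_prof s r"
  by (simp add: yuk_grad_def yuk_hess_def yuk_prof_def field_simps eval_nat_numeral)

lemma yukawa_measurable [measurable]: "yukawa s p \<in> borel_measurable borel"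
  unfolding yukawa_def by measurable

lemma yukawa_L2: assumes "s > 0" shows "(\<lambda>x. of_real (yukawa s p x)) \<in> L2"
  by (rule L2_by_majorant[where a = s and p = p and C = 1])
    (use assms in \<open>auto simp: yukawa_def majorant_def distrib_left norm_divide\<close>)

lemma exp_dist_W22:
  assumes s: "s > 0"
  shows "(\<lambda>x. of_real (exp (- s * dist x p))) \<in> W2 2"
    and "has_laplacian (\<lambda>x. of_real (exp (- s * dist x p))) 
      (\<lambda>x. of_real (s\<^sup>2 * exp (- s * dist x p) - 2 * s * yukawa s p x))"
proof -
  define a where "a r = - s * exp (- s * r) / r" for r :: real
  define b where "b r = exp (- s * r) * (s\<^sup>2 / r\<^sup>2 + s / r ^ 3)" for r :: real
  have m: "(\<lambda>r. exp (- s * r)) \<in> borel_measurable borel" "a \<in> borel_measurable borel" "b \<in> borel_measurable borel"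
    unfolding a_def b_def by measurable
  define C where "C = 1 + s + s\<^sup>2"
  have C: "1 \<le> C" "s \<le> C" "s\<^sup>2 \<le> C" using s by (auto simp: C_def)
  note R = radial_W22[OF m s, where C = C and p = p]
  have 1: "((\<lambda>r. exp (- s * r)) has_real_derivative r * a r) (at r)" if "r > 0" for r
    using that by (auto intro!: derivative_eq_intros simp: a_def)
  have 2: "(a has_real_derivative r * b r) (at r)" if "r > 0" for r
    unfolding a_def using that 
    by (auto intro!: derivative_eq_intros simp: b_def power2_eq_square power3_eq_cube field_simps)
  have 3: "\<bar>exp (- s * r)\<bar> \<le> C * exp (- s * r)" for r using C by simp
  have 4: "\<bar>a r\<bar> \<le> C * exp (- s * r) / r" if "r > 0" for r
    unfolding a_def using that s C by (simp add: abs_mult divide_right_mono)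
  have 5: "\<bar>b r\<bar> \<le> C * exp (- s * r) * (1 + 1 / r) / r\<^sup>2" if r: "r > 0" for r
  proof -
    have "s\<^sup>2 / r\<^sup>2 + s / r ^ 3 = (s\<^sup>2 + s * (1 / r)) / r\<^sup>2" 
      using r by (simp add: add_divide_distrib power2_eq_square power3_eq_cube)
    also have "\<dots> \<le> (C + C * (1 / r)) / r\<^sup>2"
      using r C by (intro divide_right_mono add_mono mult_right_mono) auto
    finally have "s\<^sup>2 / r\<^sup>2 + s / r ^ 3 \<le> C * (1 + 1 / r) / r\<^sup>2" by (simp add: distrib_left)
    from mult_left_mono[OF this, of "exp (- s * r)"]
    have "b r \<le> C * exp (- s * r) * (1 + 1 / r) / r\<^sup>2" by (simp add: b_def mult_ac)
    moreover have "b r \<ge> 0" using r s by (simp add: b_def)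
    ultimately show ?thesis by simp
  qed
  show "(\<lambda>x. of_real (exp (- s * dist x p))) \<in> W2 2" by (rule R(1)[OF 1 2 3 4 5])
  have e: "3 * a r + b r * r\<^sup>2 = s\<^sup>2 * exp (- s * r) - 2 * s * (exp (- s * r) / r)" if "r \<noteq> 0" for r
    using that by (simp add: a_def b_def field_simps power2_eq_square power3_eq_cube)
  have "has_laplacian (\<lambda>x. of_real (exp (- s * dist x p))) 
      (\<lambda>x. of_real (3 * a (dist x p) + b (dist x p) * (dist x p)\<^sup>2))"
    by (rule R(2)[OF 1 2 3 4 5])
  then show "has_laplacian (\<lambda>x. of_real (exp (- s * dist x p))) 
      (\<lambda>x. of_real (s\<^sup>2 * exp (- s * dist x p) - 2 * s * yukawa s p x))"
  proof (rule has_laplacian_AE_cong)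
    show "AE x in lborel. complex_of_real (s\<^sup>2 * exp (- s * dist x p) - 2 * s * yukawa s p x)
        = of_real (3 * a (dist x p) + b (dist x p) * (dist x p)\<^sup>2)"
      using AE_lborel_singleton[of p] by eventually_elim (simp add: e yukawa_def del: of_real_diff of_real_add of_real_mult)
  qed
qed

lemma real_mvt_bound:
  fixes F D :: "real \<Rightarrow> real"
  assumes "\<And>\<tau>. \<kappa> \<le> \<tau> \<Longrightarrow> \<tau> \<le> M \<Longrightarrow> (F has_real_derivative D \<tau>) (at \<tau>)"
    and "\<And>\<tau>. \<kappa> \<le> \<tau> \<Longrightarrow> \<tau> \<le> M \<Longrightarrow> \<bar>D \<tau>\<bar> \<le> B"
    and "\<kappa> \<le> s" "s \<le> M" "\<kappa> \<le> t" "t \<le> M"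
  shows "\<bar>F s - F t\<bar> \<le> \<bar>s - t\<bar> * B"
proof -
  have "norm (F s - F t) \<le> B * norm (s - t)"
    by (rule field_differentiable_bound[where S = "{\<kappa>..M}" and f' = D])
      (use assms in \<open>auto intro: has_field_derivative_at_within\<close>)
  then show ?thesis by (simp add: mult.commute)
qed

text \<open>The value at \<open>p\<close> is the limit there, which makes the function continuous.\<close>

definition yukawa_diff :: "real \<Rightarrow> real \<Rightarrow> real^3 \<Rightarrow> real^3 \<Rightarrow> real" where
  "yukawa_diff s t p x = (if x = p then t - s else yukawa s p x - yukawa t p x)"

text \<open>The poles of two Yukawa potentials cancel. The estimates near the pole are mean value estimates
  in the decay rate: differentiating \<open>exp(-\<tau> r)/r\<close> with respect to \<open>\<tau>\<close> removes the pole.\<close>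

lemma yukawa_diff_W22:
  assumes s: "s > 0" and t: "t > 0"
  shows "(\<lambda>x. of_real (yukawa_diff s t p x)) \<in> W2 2"
    and "has_laplacian (\<lambda>x. of_real (yukawa_diff s t p x)) 
      (\<lambda>x. of_real (s\<^sup>2 * yukawa s p x - t\<^sup>2 * yukawa t p x))"
proof -
  let ?J = yuk_prof and ?A = yuk_grad and ?B = yuk_hess
  define \<psi> where "\<psi> r = (if r = 0 then t - s else ?J s r - ?J t r)" for r
  define a where "a r = ?A s r - ?A t r" for r
  define b where "b r = ?B s r - ?B t r" for r
  define \<kappa> where "\<kappa> = min s t"
  define M where "M = max s t"
  have k: "\<kappa> > 0" "\<kappa> \<le> s" "\<kappa> \<le> t" "s \<le> M" "t \<le> M" "M > 0" using s t by (auto simp: \<kappa>_def M_def)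
  define C where "C = \<bar>s - t\<bar> * (1 + M + M\<^sup>2)"
  have CM: "1 \<le> 1 + M + M\<^sup>2" "M \<le> 1 + M + M\<^sup>2" "M\<^sup>2 \<le> 1 + M + M\<^sup>2" using k by auto
  have m: "\<psi> \<in> borel_measurable borel" "a \<in> borel_measurable borel" "b \<in> borel_measurable borel"
    unfolding \<psi>_def a_def b_def yuk_grad_def yuk_hess_def yuk_prof_def by measurable
  have ek: "exp (- \<tau> * r) \<le> exp (- \<kappa> * r)" if "\<kappa> \<le> \<tau>" "r \<ge> 0" for \<tau> r
    using that by (simp add: mult_right_mono)
  have 1: "(\<psi> has_real_derivative r * a r) (at r)" if r: "r > 0" for r
  proof (rule has_field_derivative_transform_within_open[where S = "{0<..}" and f = "\<lambda>r. ?J s r - ?J t r"])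
    show "((\<lambda>r. ?J s r - ?J t r) has_real_derivative r * a r) (at r)"
      by (rule DERIV_cong[OF DERIV_diff[OF yuk_prof_DERIV[OF r] yuk_prof_DERIV[OF r]]]) (simp add: a_def algebra_simps)
  qed (use r in \<open>auto simp: \<psi>_def\<close>)
  have 2: "(a has_real_derivative r * b r) (at r)" if r: "r > 0" for r
    unfolding a_def by (rule DERIV_cong[OF DERIV_diff[OF yuk_grad_DERIV[OF r] yuk_grad_DERIV[OF r]]]) (simp add: b_def algebra_simps)
  have 3: "\<bar>\<psi> r\<bar> \<le> C * exp (- \<kappa> * r)" if r: "r \<ge> 0" for r
  proof -
    have "\<bar>\<psi> r\<bar> \<le> \<bar>s - t\<bar> * exp (- \<kappa> * r)"
    proof (cases "r = 0")
      case False
      have "\<bar>?J s r - ?J t r\<bar> \<le> \<bar>s - t\<bar> * exp (- \<kappa> * r)"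
      proof (rule real_mvt_bound[where \<kappa> = \<kappa> and M = M and D = "\<lambda>\<tau>. - exp (- \<tau> * r)"])
        show "((\<lambda>\<tau>. ?J \<tau> r) has_real_derivative - exp (- \<tau> * r)) (at \<tau>)" for \<tau>
          unfolding yuk_prof_def using False by (auto intro!: derivative_eq_intros)
        show "\<bar>- exp (- \<tau> * r)\<bar> \<le> exp (- \<kappa> * r)" if "\<kappa> \<le> \<tau>" for \<tau> using ek[OF that r] by simp
      qed (use k in auto)
      then show ?thesis using False by (simp add: \<psi>_def)
    qed (simp add: \<psi>_def)
    also have "\<dots> \<le> C * exp (- \<kappa> * r)"
      unfolding C_def using mult_left_mono[OF CM(1), of "\<bar>s - t\<bar>"] by (intro mult_right_mono) auto
    finally show ?thesis .
  qed
  have 4: "\<bar>a r\<bar> \<le> C * exp (- \<kappa> * r) / r" if r: "r > 0" for r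
  proof -
    have "\<bar>?A s r - ?A t r\<bar> \<le> \<bar>s - t\<bar> * (M * exp (- \<kappa> * r) / r)"
    proof (rule real_mvt_bound[where \<kappa> = \<kappa> and M = M and D = "\<lambda>\<tau>. \<tau> * exp (- \<tau> * r) / r"])
      show "((\<lambda>\<tau>. ?A \<tau> r) has_real_derivative \<tau> * exp (- \<tau> * r) / r) (at \<tau>)" for \<tau>
        unfolding yuk_grad_def using r by (auto intro!: derivative_eq_intros simp: field_simps power2_eq_square power3_eq_cube)
      show "\<bar>\<tau> * exp (- \<tau> * r) / r\<bar> \<le> M * exp (- \<kappa> * r) / r" if "\<kappa> \<le> \<tau>" "\<tau> \<le> M" for \<tau> 
      proof -
        have "\<tau> * exp (- \<tau> * r) \<le> M * exp (- \<kappa> * r)"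
          using that k r by (intro mult_mono ek) auto
        moreover have "\<tau> \<ge> 0" using that k by linarith
        ultimately show ?thesis using r by (simp add: abs_mult divide_right_mono)
      qed
    qed (use k in auto)
    also have "\<dots> = (\<bar>s - t\<bar> * M) * (exp (- \<kappa> * r) / r)" by simp
    also have "\<dots> \<le> C * (exp (- \<kappa> * r) / r)"
      unfolding C_def using mult_left_mono[OF CM(2), of "\<bar>s - t\<bar>"] r by (intro mult_right_mono) auto
    finally show ?thesis by (simp add: a_def)
  qed
  have 5: "\<bar>b r\<bar> \<le> C * exp (- \<kappa> * r) * (1 + 1 / r) / r\<^sup>2" if r: "r > 0" for r
  proof -
    have "\<bar>?B s r - ?B t r\<bar> \<le> \<bar>s - t\<bar> * ((1 + M + M\<^sup>2) * (exp (- \<kappa> * r) * (1 + 1 / r) / r\<^sup>2))"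
    proof (rule real_mvt_bound[where \<kappa> = \<kappa> and M = M and D = "\<lambda>\<tau>. - (exp (- \<tau> * r) * ((\<tau>\<^sup>2 + \<tau> / r) / r\<^sup>2))"])
      show "((\<lambda>\<tau>. ?B \<tau> r) has_real_derivative - (exp (- \<tau> * r) * ((\<tau>\<^sup>2 + \<tau> / r) / r\<^sup>2))) (at \<tau>)" for \<tau>
        unfolding yuk_hess_def using r by (auto intro!: derivative_eq_intros simp: field_simps eval_nat_numeral)
      show "\<bar>- (exp (- \<tau> * r) * ((\<tau>\<^sup>2 + \<tau> / r) / r\<^sup>2))\<bar> \<le> (1 + M + M\<^sup>2) * (exp (- \<kappa> * r) * (1 + 1 / r) / r\<^sup>2)" 
        if "\<kappa> \<le> \<tau>" "\<tau> \<le> M" for \<tau> 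
      proof -
        have \<tau>: "\<tau> \<ge> 0" using that k by linarith
        have "\<tau>\<^sup>2 + \<tau> / r \<le> M\<^sup>2 + M / r"
          using that \<tau> r by (intro add_mono power_mono divide_right_mono) auto
        also have "\<dots> \<le> (1 + M + M\<^sup>2) * 1 + (1 + M + M\<^sup>2) / r"
          using CM r by (intro add_mono divide_right_mono) auto
        finally have "(\<tau>\<^sup>2 + \<tau> / r) / r\<^sup>2 \<le> ((1 + M + M\<^sup>2) * (1 + 1 / r)) / r\<^sup>2"
          using r by (intro divide_right_mono) (auto simp: distrib_left)
        then have "exp (- \<tau> * r) * ((\<tau>\<^sup>2 + \<tau> / r) / r\<^sup>2) \<le> exp (- \<kappa> * r) * (((1 + M + M\<^sup>2) * (1 + 1 / r)) / r\<^sup>2)"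
          using that r \<tau> by (intro mult_mono[OF ek]) auto
        moreover have "exp (- \<tau> * r) * ((\<tau>\<^sup>2 + \<tau> / r) / r\<^sup>2) \<ge> 0" using r \<tau> by auto
        ultimately show ?thesis by (simp add: mult_ac)
      qed
    qed (use k in auto)
    then show ?thesis by (simp add: b_def C_def mult_ac)
  qed
  have f: "\<psi> (dist x p) = yukawa_diff s t p x" for x by (simp add: \<psi>_def yukawa_diff_def yukawa_def yuk_prof_def)
  note R = radial_W22[OF m k(1) 1 2 3 4 5, of p, unfolded f]
  show "(\<lambda>x. of_real (yukawa_diff s t p x)) \<in> W2 2" by (rule R(1))
  have ab: "3 * a r + b r * r\<^sup>2 = s\<^sup>2 * yuk_prof s r - t\<^sup>2 * yuk_prof t r" if "r \<noteq> 0" for r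
    using yuk_prof_laplacian[OF that, of s] yuk_prof_laplacian[OF that, of t] by (simp add: a_def b_def algebra_simps)
  show "has_laplacian (\<lambda>x. of_real (yukawa_diff s t p x)) 
      (\<lambda>x. of_real (s\<^sup>2 * yukawa s p x - t\<^sup>2 * yukawa t p x))"
  proof (rule has_laplacian_AE_cong[OF R(2)])
    show "AE x in lborel. complex_of_real (s\<^sup>2 * yukawa s p x - t\<^sup>2 * yukawa t p x)
        = of_real (3 * a (dist x p) + b (dist x p) * (dist x p)\<^sup>2)"
      using AE_lborel_singleton[of p]
    proof eventually_elim
      case (elim x)
      then have "dist x p \<noteq> 0" by simp
      from ab[OF this] show ?case by (simp only: yukawa_eq)
    qed
  qed
qed

lemma continuous_yukawa: 
  assumes "x \<noteq> p" shows "isCont (yukawa s p) x"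
  unfolding yukawa_def using assms
  by (intro continuous_intros) auto

lemma continuous_yukawa_diff: "continuous_on UNIV (yukawa_diff s t p)"
proof -
  have "isCont (yukawa_diff s t p) x" for x
  proof (cases "x = p")
    case False
    have "isCont (\<lambda>x. yukawa s p x - yukawa t p x) x" using False by (intro continuous_diff continuous_yukawa)
    then have "((\<lambda>x. yukawa s p x - yukawa t p x) \<longlongrightarrow> yukawa_diff s t p x) (at x)"
      using False by (simp add: isCont_def yukawa_diff_def)
    then have "(yukawa_diff s t p \<longlongrightarrow> yukawa_diff s t p x) (at x)"
      by (rule Lim_transform_within_open[where s = "- {p}"]) (use False in \<open>auto simp: yukawa_diff_def\<close>)
    then show ?thesis by (simp add: isCont_def)
  next
    case True
    have "((\<lambda>r::real. (exp (- s * r) - exp (- t * r)) / r) \<longlongrightarrow> t - s) (at_right 0)"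
      by real_asymp
    moreover have "filterlim (\<lambda>x. dist x p) (at_right 0) (at p)"
    proof -
      have "((\<lambda>x. dist x p) \<longlongrightarrow> dist p p) (at p)" by (intro tendsto_intros)
      then show ?thesis by (auto simp: filterlim_at eventually_at_filter)
    qed
    ultimately have "((\<lambda>x. (exp (- s * dist x p) - exp (- t * dist x p)) / dist x p) \<longlongrightarrow> t - s) (at p)"
      by (rule filterlim_compose)
    then have "(yukawa_diff s t p \<longlongrightarrow> t - s) (at p)"
      by (rule Lim_transform_eventually)
        (auto simp: eventually_at_filter yukawa_diff_def yukawa_def diff_divide_distrib)
    then show ?thesis using True by (simp add: isCont_def yukawa_diff_def)
  qed
  then show ?thesis by (simp add: continuous_at_imp_continuous_on)
qed

section \<open>Green's representation formula\<close>

lemma has_laplacian_L2_test: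
  assumes l: "has_laplacian u v" and v: "v \<in> L2" and s: "smooth g"
    and L: "(\<lambda>x. of_real (g x)) \<in> L2" "\<And>i. (\<lambda>x. of_real (partial i g x)) \<in> L2"
       "\<And>i. (\<lambda>x. of_real (partial i (partial i g) x)) \<in> L2"
  shows "(\<integral>x. of_real (laplacian g x) * u x \<partial>lborel) = (\<integral>x. of_real (g x) * v x \<partial>lborel)"
proof -
  obtain p q where pq: "\<And>i. weak_partial i u (p i)" "\<And>i. weak_partial i (p i) (q i)" 
    and vq: "AE x in lborel. v x = (\<Sum>i\<in>UNIV. q i x)"
    using l unfolding has_laplacian_def by blast
  have u: "u \<in> L2" using pq(1) by (simp add: weak_partial_def)
  have q: "q i \<in> L2" for i using weak_partial_L2[OF pq(2)] .
  have e: "(\<integral>x. of_real (partial i (partial i g) x) * u x \<partial>lborel) = (\<integral>x. of_real (g x) * q i x \<partial>lborel)" for i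
    using weak_partial_L2_test[OF pq(1) smooth_partial[OF s] L(2) L(3)]
      weak_partial_L2_test[OF pq(2) s L(1) L(2)] by simp
  have "(\<integral>x. of_real (laplacian g x) * u x \<partial>lborel) 
      = (\<integral>x. (\<Sum>i\<in>UNIV. of_real (partial i (partial i g) x) * u x) \<partial>lborel)"
    by (simp add: laplacian_def sum_distrib_right)
  also have "\<dots> = (\<Sum>i\<in>UNIV. \<integral>x. of_real (partial i (partial i g) x) * u x \<partial>lborel)"
    by (intro Bochner_Integration.integral_sum L2_mult_integrable L u)
  also have "\<dots> = (\<Sum>i\<in>UNIV. \<integral>x. of_real (g x) * q i x \<partial>lborel)" by (simp add: e)
  also have "\<dots> = (\<integral>x. (\<Sum>i\<in>UNIV. of_real (g x) * q i x) \<partial>lborel)"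
    by (intro Bochner_Integration.integral_sum[symmetric] L2_mult_integrable L q)
  also have "\<dots> = (\<integral>x. of_real (g x) * v x \<partial>lborel)"
  proof (rule integral_cong_AE)
    have [measurable]: "v \<in> borel_measurable borel" "g \<in> borel_measurable borel" "\<And>i. q i \<in> borel_measurable borel"
      using v q L2_measurable smooth_measurable[OF s] by auto
    show "(\<lambda>x. \<Sum>i\<in>UNIV. of_real (g x) * q i x) \<in> borel_measurable lborel"
      "(\<lambda>x. of_real (g x) * v x) \<in> borel_measurable lborel" by measurable
    show "AE x in lborel. (\<Sum>i\<in>UNIV. of_real (g x) * q i x) = of_real (g x) * v x"
      using vq by eventually_elim (simp add: sum_distrib_left)
  qed
  finally show ?thesis .
qed

subsection \<open>The regularised Yukawa potential\<close>

text \<open>Replacing \<open>r\<close> by \<open>sqrt(r\<^sup>2 + \<epsilon>\<^sup>2)\<close> makes the potential smooth, keeps it below the original one, and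
  leaves \<open>(s\<^sup>2 - \<Delta>)\<close> of it explicit.\<close>

definition reg_dist :: "real \<Rightarrow> real^3 \<Rightarrow> real^3 \<Rightarrow> real" where
  "reg_dist \<epsilon> p x = sqrt ((norm (x - p))\<^sup>2 + \<epsilon>\<^sup>2)"

definition reg_yukawa :: "real \<Rightarrow> real \<Rightarrow> real^3 \<Rightarrow> real^3 \<Rightarrow> real" where
  "reg_yukawa \<epsilon> s p x = yuk_prof s (reg_dist \<epsilon> p x)"

lemma measurable_reg_dist [measurable]: "reg_dist \<epsilon> p \<in> borel_measurable borel"
  unfolding reg_dist_def by (intro borel_measurable_continuous_onI continuous_intros)

lemma reg_dist_bounds: 
  assumes "\<epsilon> > 0" 
  shows "reg_dist \<epsilon> p x > 0" "\<epsilon> \<le> reg_dist \<epsilon> p x" "dist x p \<le> reg_dist \<epsilon> p x"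
proof -
  show e: "\<epsilon> \<le> reg_dist \<epsilon> p x" unfolding reg_dist_def
    using assms by (intro real_le_rsqrt) simp
  then show "reg_dist \<epsilon> p x > 0" using assms by linarith
  show "dist x p \<le> reg_dist \<epsilon> p x" unfolding reg_dist_def dist_norm
    by (intro real_le_rsqrt) simp
qed

lemma reg_dist_sq: "(reg_dist \<epsilon> p x)\<^sup>2 = (dist x p)\<^sup>2 + \<epsilon>\<^sup>2"
  by (simp add: reg_dist_def dist_norm)

lemma smooth_reg_arg: "smooth (\<lambda>x. (norm (x - p))\<^sup>2 + \<epsilon>\<^sup>2)"
  by (intro smooth_add smooth_norm_sq smooth_const)

lemma smooth_reg_yukawa: 
  assumes e: "\<epsilon> > 0" shows "smooth (reg_yukawa \<epsilon> s p)"
proof -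
  let ?N = "\<lambda>x. (norm (x - p))\<^sup>2 + \<epsilon>\<^sup>2"
  have N: "?N x > 0" for x using e by (intro add_nonneg_pos) auto
  have "smooth (\<lambda>x. exp ((- s) * ?N x powr (1/2)) * ?N x powr (- 1/2))"
    by (intro smooth_mult smooth_exp smooth_const smooth_powr smooth_reg_arg N)
  moreover have "exp ((- s) * ?N x powr (1/2)) * ?N x powr (- 1/2) = reg_yukawa \<epsilon> s p x" for x
    using N[of x] by (simp add: reg_yukawa_def yuk_prof_def reg_dist_def powr_half_sqrt powr_minus_divide)
  ultimately show ?thesis by simp
qed

text \<open>Since \<open>\<rho>\<^sup>2 = r\<^sup>2 + \<epsilon>\<^sup>2\<close>, the gradient of \<open>\<rho>\<close> is \<open>(x - p)/\<rho>\<close>, as for \<open>r\<close> itself.\<close>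

lemma partial_radial_reg:
  assumes e: "\<epsilon> > 0" and d: "\<And>r. r > 0 \<Longrightarrow> (h has_real_derivative r * h' r) (at r)"
  shows "(\<lambda>x. h (reg_dist \<epsilon> p x)) differentiable (at x)"
    and "partial i (\<lambda>x. h (reg_dist \<epsilon> p x)) x = h' (reg_dist \<epsilon> p x) * (x - p) $ i"
proof -
  let ?N = "\<lambda>x. (norm (x - p))\<^sup>2 + \<epsilon>\<^sup>2"
  let ?\<rho> = "reg_dist \<epsilon> p x"
  have N: "?N x > 0" using e by (intro add_nonneg_pos) auto
  have \<rho>: "?\<rho> > 0" using reg_dist_bounds[OF e] by blast
  have Nd: "?N differentiable (at x)" using smooth_reg_arg smooth_differentiable by blast
  have "(h has_real_derivative ?\<rho> * h' ?\<rho>) (at (sqrt (?N x)))"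
    using d[OF \<rho>] by (simp add: reg_dist_def)
  note c = DERIV_chain2[OF this DERIV_real_sqrt[OF N]]
  have sq: "sqrt (?N x) = ?\<rho>" by (simp add: reg_dist_def)
  have hd: "((\<lambda>t. h (sqrt t)) has_real_derivative h' ?\<rho> / 2) (at (?N x))"
    by (rule DERIV_cong[OF c]) (use \<rho> in \<open>simp add: sq\<close>)
  then have "(\<lambda>t. h (sqrt t)) differentiable (at (?N x))" by (auto simp: real_differentiable_def)
  from differentiable_chain_at[OF Nd this]
  show "(\<lambda>x. h (reg_dist \<epsilon> p x)) differentiable (at x)" by (simp add: o_def reg_dist_def)
  have pN: "partial i ?N x = 2 * (x - p) $ i"
    using partial_add[OF smooth_differentiable[OF smooth_norm_sq] smooth_differentiable[OF smooth_const]]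
    by (simp add: partial_norm_sq partial_eqI[OF has_derivative_const])
  have "partial i (\<lambda>x. h (reg_dist \<epsilon> p x)) x = h' ?\<rho> / 2 * partial i ?N x"
    using partial_compose[OF hd Nd] unfolding reg_dist_def .
  then show "partial i (\<lambda>x. h (reg_dist \<epsilon> p x)) x = h' (reg_dist \<epsilon> p x) * (x - p) $ i"
    unfolding pN by (simp del: vector_minus_component)
qed

lemma partial_reg_yukawa:
  assumes e: "\<epsilon> > 0"
  shows "partial i (reg_yukawa \<epsilon> s p) x = yuk_grad s (reg_dist \<epsilon> p x) * (x - p) $ i"
    and "partial i (partial i (reg_yukawa \<epsilon> s p)) x = 
      yuk_grad s (reg_dist \<epsilon> p x) + yuk_hess s (reg_dist \<epsilon> p x) * ((x - p) $ i)\<^sup>2"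
proof -
  have 1: "partial i (reg_yukawa \<epsilon> s p) x = yuk_grad s (reg_dist \<epsilon> p x) * (x - p) $ i" for x
    unfolding reg_yukawa_def[abs_def] by (intro partial_radial_reg(2) e yuk_prof_DERIV)
  then show "partial i (reg_yukawa \<epsilon> s p) x = yuk_grad s (reg_dist \<epsilon> p x) * (x - p) $ i" .
  have cd: "((\<lambda>x. (x - p) $ i) has_derivative (\<lambda>v. v $ i)) (at x)"
    unfolding vector_minus_component
    by (auto intro!: derivative_eq_intros bounded_linear_imp_has_derivative bounded_linear_vec_nth)
  have "partial i (\<lambda>x. yuk_grad s (reg_dist \<epsilon> p x) * (x - p) $ i) x = 
      yuk_grad s (reg_dist \<epsilon> p x) * partial i (\<lambda>x. (x - p) $ i) x 
      + partial i (\<lambda>x. yuk_grad s (reg_dist \<epsilon> p x)) x * (x - p) $ i"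
    by (intro partial_mult partial_radial_reg(1)[OF e yuk_grad_DERIV] differentiableI[OF cd])
  also have "partial i (\<lambda>x. (x - p) $ i) x = 1" using partial_eqI[OF cd] by (simp add: axis_def)
  also have "partial i (\<lambda>x. yuk_grad s (reg_dist \<epsilon> p x)) x = yuk_hess s (reg_dist \<epsilon> p x) * (x - p) $ i"
    by (intro partial_radial_reg(2)[OF e yuk_grad_DERIV])
  finally show "partial i (partial i (reg_yukawa \<epsilon> s p)) x = 
      yuk_grad s (reg_dist \<epsilon> p x) + yuk_hess s (reg_dist \<epsilon> p x) * ((x - p) $ i)\<^sup>2"
    by (simp add: 1[abs_def] power2_eq_square mult.assoc)
qed

text \<open>The profile solves \<open>s\<^sup>2\<psi> - \<Delta>\<psi> = 0\<close> off the pole, so only the defect \<open>\<epsilon>\<^sup>2 = \<rho>\<^sup>2 - r\<^sup>2\<close> in the Hessian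
  term remains.\<close>

lemma laplacian_reg_yukawa:
  assumes e: "\<epsilon> > 0"
  shows "s\<^sup>2 * reg_yukawa \<epsilon> s p x - laplacian (reg_yukawa \<epsilon> s p) x = \<epsilon>\<^sup>2 * yuk_hess s (reg_dist \<epsilon> p x)"
proof -
  let ?\<rho> = "reg_dist \<epsilon> p x"
  have "laplacian (reg_yukawa \<epsilon> s p) x = 3 * yuk_grad s ?\<rho> + yuk_hess s ?\<rho> * (norm (x - p))\<^sup>2"
    unfolding laplacian_def partial_reg_yukawa(2)[OF e] norm3_sq by (simp add: sum.distrib sum_distrib_left)
  moreover have "(norm (x - p))\<^sup>2 = ?\<rho>\<^sup>2 - \<epsilon>\<^sup>2" by (simp add: reg_dist_sq dist_norm)
  moreover have "?\<rho> \<noteq> 0" using reg_dist_bounds(1)[OF e, of p x] by simp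
  ultimately show ?thesis 
    using yuk_prof_laplacian[of ?\<rho> s] by (simp add: reg_yukawa_def algebra_simps)
qed

text \<open>For fixed \<open>\<epsilon>\<close> everything is bounded and decays exponentially, whence square integrable; for
  \<open>\<epsilon> = 1\<close> the bounds control the approximate identity away from its centre.\<close>

lemma yuk_decay:
  assumes s: "s > 0" and e: "\<epsilon> > 0" and "r \<ge> 0" "\<epsilon> \<le> \<rho>" "r \<le> \<rho>"
  shows "\<bar>yuk_prof s \<rho>\<bar> \<le> (1 / \<epsilon>) * exp (- s * r)"
    and "\<bar>yuk_grad s \<rho>\<bar> \<le> (s / \<epsilon>\<^sup>2 + 1 / \<epsilon> ^ 3) * exp (- s * r)"
    and "\<bar>yuk_grad s \<rho>\<bar> * \<rho> \<le> (s / \<epsilon> + 1 / \<epsilon> ^ 2) * exp (- s * r)"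
    and "\<bar>yuk_hess s \<rho>\<bar> \<le> (s\<^sup>2 / \<epsilon> ^ 3 + 3 * s / \<epsilon> ^ 4 + 3 / \<epsilon> ^ 5) * exp (- s * r)"
    and "\<bar>yuk_hess s \<rho>\<bar> * \<rho>\<^sup>2 \<le> (s\<^sup>2 / \<epsilon> + 3 * s / \<epsilon> ^ 2 + 3 / \<epsilon> ^ 3) * exp (- s * r)"
proof -
  have \<rho>: "\<rho> > 0" using assms by linarith
  have E: "exp (- s * \<rho>) \<le> exp (- s * r)" using assms by simp
  have d: "c / \<rho> ^ n \<le> c / \<epsilon> ^ n" if "c \<ge> 0" for c n
    using that e \<rho> assms by (intro divide_left_mono power_mono mult_pos_pos zero_less_power) auto
  have mm: "exp (- s * \<rho>) * x \<le> y * exp (- s * r)" if "0 \<le> x" "x \<le> y" for x y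
    using mult_mono[OF E that(2)] that by (simp add: mult.commute)
  have "exp (- s * \<rho>) * (1 / \<rho> ^ 1) \<le> (1 / \<epsilon> ^ 1) * exp (- s * r)"
    using \<rho> by (intro mm d) auto
  then show "\<bar>yuk_prof s \<rho>\<bar> \<le> (1 / \<epsilon>) * exp (- s * r)" using \<rho> by (simp add: yuk_prof_def)
  have g: "\<bar>yuk_grad s \<rho>\<bar> = exp (- s * \<rho>) * (s / \<rho>\<^sup>2 + 1 / \<rho> ^ 3)"
    using \<rho> s by (simp add: yuk_grad_def abs_mult)
  show "\<bar>yuk_grad s \<rho>\<bar> \<le> (s / \<epsilon>\<^sup>2 + 1 / \<epsilon> ^ 3) * exp (- s * r)"
    unfolding g using \<rho> s by (intro mm add_mono d) auto
  have "(s / \<rho>\<^sup>2 + 1 / \<rho> ^ 3) * \<rho> = s / \<rho> ^ 1 + 1 / \<rho> ^ 2"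
    using \<rho> by (simp add: field_simps eval_nat_numeral)
  then have "\<bar>yuk_grad s \<rho>\<bar> * \<rho> = exp (- s * \<rho>) * (s / \<rho> ^ 1 + 1 / \<rho> ^ 2)" by (simp add: g mult.assoc)
  also have "\<dots> \<le> (s / \<epsilon> ^ 1 + 1 / \<epsilon> ^ 2) * exp (- s * r)"
    using \<rho> s by (intro mm add_mono d) auto
  finally show "\<bar>yuk_grad s \<rho>\<bar> * \<rho> \<le> (s / \<epsilon> + 1 / \<epsilon> ^ 2) * exp (- s * r)" by simp
  have h: "\<bar>yuk_hess s \<rho>\<bar> = exp (- s * \<rho>) * (s\<^sup>2 / \<rho> ^ 3 + 3 * s / \<rho> ^ 4 + 3 / \<rho> ^ 5)"
    using \<rho> s by (simp add: yuk_hess_def abs_mult)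
  show "\<bar>yuk_hess s \<rho>\<bar> \<le> (s\<^sup>2 / \<epsilon> ^ 3 + 3 * s / \<epsilon> ^ 4 + 3 / \<epsilon> ^ 5) * exp (- s * r)"
    unfolding h using \<rho> s by (intro mm add_mono d) auto
  have "(s\<^sup>2 / \<rho> ^ 3 + 3 * s / \<rho> ^ 4 + 3 / \<rho> ^ 5) * \<rho>\<^sup>2 = s\<^sup>2 / \<rho> ^ 1 + 3 * s / \<rho> ^ 2 + 3 / \<rho> ^ 3"
    using \<rho> by (simp add: field_simps eval_nat_numeral)
  then have "\<bar>yuk_hess s \<rho>\<bar> * \<rho>\<^sup>2 = exp (- s * \<rho>) * (s\<^sup>2 / \<rho> ^ 1 + 3 * s / \<rho> ^ 2 + 3 / \<rho> ^ 3)" by (simp add: h mult.assoc)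
  also have "\<dots> \<le> (s\<^sup>2 / \<epsilon> ^ 1 + 3 * s / \<epsilon> ^ 2 + 3 / \<epsilon> ^ 3) * exp (- s * r)"
    using \<rho> s by (intro mm add_mono d) auto
  finally show "\<bar>yuk_hess s \<rho>\<bar> * \<rho>\<^sup>2 \<le> (s\<^sup>2 / \<epsilon> + 3 * s / \<epsilon> ^ 2 + 3 / \<epsilon> ^ 3) * exp (- s * r)" by simp
qed

lemma reg_yukawa_tendsto:
  assumes "x \<noteq> p" and e: "\<epsilon> \<longlonglongrightarrow> 0"
  shows "(\<lambda>n. reg_yukawa (\<epsilon> n) s p x) \<longlonglongrightarrow> yukawa s p x"
proof -
  have r: "dist x p > 0" using assms by simp
  have "(\<lambda>n. reg_dist (\<epsilon> n) p x) \<longlonglongrightarrow> sqrt ((norm (x - p))\<^sup>2 + 0\<^sup>2)"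
    unfolding reg_dist_def by (intro tendsto_intros e)
  then have 1: "(\<lambda>n. reg_dist (\<epsilon> n) p x) \<longlonglongrightarrow> dist x p" by (simp add: dist_norm)
  have "isCont (yuk_prof s) (dist x p)" using yuk_prof_DERIV[OF r] DERIV_isCont by blast
  from isCont_tendsto_compose[OF this 1] show ?thesis by (simp add: reg_yukawa_def yukawa_eq)
qed

lemma reg_yukawa_le:
  assumes s: "s > 0" and e: "\<epsilon> > 0" and "x \<noteq> p"
  shows "\<bar>reg_yukawa \<epsilon> s p x\<bar> \<le> \<bar>yukawa s p x\<bar>"
proof -
  have r: "dist x p > 0" using assms by simp
  have \<rho>: "dist x p \<le> reg_dist \<epsilon> p x" by (rule reg_dist_bounds(3)[OF e])
  show ?thesis
    using yuk_decay(1)[OF s r less_imp_le[OF r] \<rho> \<rho>] r by (simp add: reg_yukawa_def yukawa_def)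
qed

lemma L2_by_exp_bound:
  assumes "f \<in> borel_measurable borel" and s: "s > 0"
    and b: "\<And>x. \<bar>f x\<bar> \<le> C * exp (- s * dist x p)"
  shows "(\<lambda>x. complex_of_real (f x)) \<in> L2"
proof (rule L2_by_majorant[where a = s and p = p and C = C])
  fix x
  have "C \<ge> 0" using b[of p] by simp
  then have "C * exp (- s * dist x p) \<le> C * majorant s (dist x p)" 
    by (intro mult_left_mono) (auto simp: majorant_def distrib_left)
  then show "cmod (complex_of_real (f x)) \<le> C * majorant s (dist x p)" using b[of x] by simp
qed (use assms in auto)

lemma reg_yukawa_L2:
  assumes s: "s > 0" and e: "\<epsilon> > 0"
  shows "(\<lambda>x. of_real (reg_yukawa \<epsilon> s p x)) \<in> L2"
    "(\<lambda>x. of_real (partial i (reg_yukawa \<epsilon> s p) x)) \<in> L2"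
    "(\<lambda>x. of_real (partial i (partial i (reg_yukawa \<epsilon> s p)) x)) \<in> L2"
    "(\<lambda>x. of_real (laplacian (reg_yukawa \<epsilon> s p) x)) \<in> L2"
    "(\<lambda>x. of_real (yuk_hess s (reg_dist \<epsilon> p x))) \<in> L2"
proof -
  have m: "reg_yukawa \<epsilon> s p \<in> borel_measurable borel" "partial i (reg_yukawa \<epsilon> s p) \<in> borel_measurable borel"
      "partial i (partial i (reg_yukawa \<epsilon> s p)) \<in> borel_measurable borel" for i
    using smooth_reg_yukawa[OF e] smooth_partial smooth_measurable by blast+
  note B = yuk_decay[OF s e zero_le_dist reg_dist_bounds(2)[OF e] reg_dist_bounds(3)[OF e], of p]
  have c: "\<bar>(x - p) $ i\<bar> \<le> reg_dist \<epsilon> p x" for x i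
    using component_le_norm_cart[of "x - p" i] reg_dist_bounds(3)[OF e, of x p] by (simp add: dist_norm)
  show "(\<lambda>x. of_real (reg_yukawa \<epsilon> s p x)) \<in> L2"
    by (rule L2_by_exp_bound[OF m(1) s, where C = "1 / \<epsilon>" and p = p]) (use B(1) in \<open>simp add: reg_yukawa_def\<close>)
  show "(\<lambda>x. of_real (partial i (reg_yukawa \<epsilon> s p) x)) \<in> L2" for i
  proof (rule L2_by_exp_bound[OF m(2) s])
    fix x
    have "\<bar>yuk_grad s (reg_dist \<epsilon> p x)\<bar> * \<bar>(x - p) $ i\<bar> \<le> \<bar>yuk_grad s (reg_dist \<epsilon> p x)\<bar> * reg_dist \<epsilon> p x"
      by (intro mult_left_mono c) auto
    also note B(3)
    finally show "\<bar>partial i (reg_yukawa \<epsilon> s p) x\<bar> \<le> (s / \<epsilon> + 1 / \<epsilon> ^ 2) * exp (- s * dist x p)"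
      unfolding partial_reg_yukawa(1)[OF e] abs_mult .
  qed
  show L3: "(\<lambda>x. of_real (partial i (partial i (reg_yukawa \<epsilon> s p)) x)) \<in> L2" for i
  proof (rule L2_by_exp_bound[OF m(3) s])
    fix x
    let ?a = "yuk_grad s (reg_dist \<epsilon> p x)" and ?b = "yuk_hess s (reg_dist \<epsilon> p x)"
    have "((x - p) $ i)\<^sup>2 \<le> (reg_dist \<epsilon> p x)\<^sup>2"
      using power_mono[OF c[of x i], of 2] by simp
    then have "\<bar>?b\<bar> * ((x - p) $ i)\<^sup>2 \<le> \<bar>?b\<bar> * (reg_dist \<epsilon> p x)\<^sup>2"
      by (intro mult_left_mono) auto
    also note B(5)
    finally have "\<bar>?a\<bar> + \<bar>?b * ((x - p) $ i)\<^sup>2\<bar> \<le> (s / \<epsilon>\<^sup>2 + 1 / \<epsilon> ^ 3) * exp (- s * dist x p)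
        + (s\<^sup>2 / \<epsilon> + 3 * s / \<epsilon> ^ 2 + 3 / \<epsilon> ^ 3) * exp (- s * dist x p)"
      by (intro add_mono B(2)) (simp add: abs_mult)
    then show "\<bar>partial i (partial i (reg_yukawa \<epsilon> s p)) x\<bar> \<le> 
        ((s / \<epsilon>\<^sup>2 + 1 / \<epsilon> ^ 3) + (s\<^sup>2 / \<epsilon> + 3 * s / \<epsilon> ^ 2 + 3 / \<epsilon> ^ 3)) * exp (- s * dist x p)"
      unfolding partial_reg_yukawa(2)[OF e] distrib_right[of _ _ "exp (- s * dist x p)"]
      by (rule order_trans[OF abs_triangle_ineq])
  qed
  show "(\<lambda>x. of_real (laplacian (reg_yukawa \<epsilon> s p) x)) \<in> L2"
    unfolding laplacian_def of_real_sum by (intro L2_sum L3)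
  have "(\<lambda>x. yuk_hess s (reg_dist \<epsilon> p x)) \<in> borel_measurable borel"
    unfolding yuk_hess_def by measurable
  then show "(\<lambda>x. of_real (yuk_hess s (reg_dist \<epsilon> p x))) \<in> L2"
    by (rule L2_by_exp_bound[OF _ s]) (rule B(4))
qed

subsection \<open>The approximate identity\<close>

text \<open>Scaling \<open>x = p + \<epsilon>z\<close>, with Jacobian \<open>\<epsilon>\<^sup>3\<close>, turns \<open>\<epsilon>\<^sup>2 yuk_hess s \<rho>\<close> into \<open>yuk_hess (\<epsilon>s)\<close> at \<open>sqrt(|z|\<^sup>2 + 1)\<close>; this is its limit
  for \<open>\<epsilon> \<longrightarrow> 0\<close>. The integral has the value \<open>4\<pi>\<close>, and it is used through its positivity.\<close>

definition green_kernel :: "real^3 \<Rightarrow> real" where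
  "green_kernel z = 3 / (reg_dist 1 0 z) ^ 5"

definition green_const :: real where
  "green_const = (\<integral>z. green_kernel z \<partial>lborel)"

lemma green_kernel_measurable [measurable]: "green_kernel \<in> borel_measurable borel"
  unfolding green_kernel_def by measurable

lemma green_kernel_pos: "green_kernel z > 0"
  unfolding green_kernel_def using reg_dist_bounds(1)[of 1 0 z] by simp

text \<open>In polar coordinates the integrand is at most \<open>3/(1 + t\<^sup>2)\<close> up to a constant.\<close>

lemma integrable_green_kernel: "integrable lborel green_kernel"
proof -
  define h where "h t = 3 / (sqrt (t\<^sup>2 + 1)) ^ 5" for t :: real
  have [measurable]: "h \<in> borel_measurable borel" unfolding h_def by measurable
  have b: "t\<^sup>2 * h t \<le> 3 * inverse (1 + t\<^sup>2)" for t
  proof -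
    let ?q = "sqrt (t\<^sup>2 + 1)"
    have q: "?q\<^sup>2 = t\<^sup>2 + 1" "?q \<ge> 1" by auto
    have "t\<^sup>2 \<le> ?q\<^sup>2 * ?q" 
      using mult_left_mono[OF q(2) zero_le_power2[of ?q]] q(1) by linarith
    then have "t\<^sup>2 * h t \<le> (?q\<^sup>2 * ?q) * h t" by (intro mult_right_mono) (auto simp: h_def)
    moreover have "(q\<^sup>2 * q) * (3 / q ^ 5) = 3 * inverse (q\<^sup>2)" if "q > 0" for q :: real
      using that by (simp add: field_simps eval_nat_numeral)
    from this[OF less_le_trans[OF zero_less_one q(2)]]
    have "(?q\<^sup>2 * ?q) * h t = 3 * inverse (?q\<^sup>2)" unfolding h_def .
    ultimately show ?thesis using q by (simp add: add.commute)
  qed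
  have "(\<integral>\<^sup>+t. ennreal (inverse (1 + t\<^sup>2)) * indicator {0..} t \<partial>lborel) = ennreal (pi/2 - arctan 0)"
    by (intro nn_integral_FTC_atLeast tendsto_arctan_at_top)
      (auto intro!: DERIV_arctan add_nonneg_nonneg)
  then have "(\<integral>\<^sup>+t. ennreal (indicator {0..} t * inverse (1 + t\<^sup>2)) \<partial>lborel) < \<infinity>"
    by (simp add: ennreal_mult' ennreal_indicator mult.commute)
  then have "integrable lborel (\<lambda>t::real. indicator {0..} t * inverse (1 + t\<^sup>2))"
    by (intro integrableI_nonneg) (auto intro!: add_nonneg_nonneg)
  then have i: "integrable lborel (\<lambda>t::real. 3 * (indicator {0..} t * inverse (1 + t\<^sup>2)))" by simp
  have "set_integrable lborel {0..} (\<lambda>t. t\<^sup>2 * h t)"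
    unfolding set_integrable_def
  proof (rule Bochner_Integration.integrable_bound[OF i])
    show "AE t in lborel. norm (indicator {0..} t *\<^sub>R (t\<^sup>2 * h t)) \<le> norm (3 * (indicator {0..} t * inverse (1 + t\<^sup>2)))"
    proof (rule AE_I2)
      fix t :: real
      have "t\<^sup>2 * h t \<ge> 0" by (simp add: h_def)
      then show "norm (indicator {0..} t *\<^sub>R (t\<^sup>2 * h t)) \<le> norm (3 * (indicator {0..} t * inverse (1 + t\<^sup>2)))"
        using order_trans[OF b[of t] abs_ge_self] by (auto simp: indicator_def abs_mult)
    qed
  qed measurable
  then have "integrable lborel (\<lambda>z::real^3. h (dist z 0))" by (intro integrable_radial) auto
  moreover have "h (dist z 0) = green_kernel z" for z :: "real^3"
    by (simp add: h_def green_kernel_def reg_dist_def)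
  ultimately show ?thesis by simp
qed

lemma green_const_pos: "green_const > 0"
proof -
  have "green_const \<noteq> 0"
  proof
    assume "green_const = 0"
    then have "AE z in lborel. green_kernel z = 0"
      using integral_nonneg_eq_0_iff_AE[OF integrable_green_kernel] green_kernel_pos
      by (auto simp: green_const_def less_imp_le)
    then have "AE z in (lborel :: (real^3) measure). False"
      by eventually_elim (metis green_kernel_pos less_irrefl)
    then show False by (simp add: ae_filter_eq_bot_iff flip: trivial_limit_def)
  qed
  moreover have "green_const \<ge> 0" unfolding green_const_def
    by (intro Bochner_Integration.integral_nonneg) (use green_kernel_pos less_imp_le in blast)
  ultimately show ?thesis by simp
qed

lemma integral_affine3:
  fixes f :: "real^3 \<Rightarrow> complex"
  assumes [measurable]: "f \<in> borel_measurable borel" and e: "\<epsilon> > 0"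
  shows "(\<integral>x. f x \<partial>lborel) = (\<integral>z. of_real (\<epsilon> ^ 3) * f (p + \<epsilon> *\<^sub>R z) \<partial>lborel)"
proof -
  have "(\<integral>x. f x \<partial>lborel) = (\<integral>x. f x \<partial>density (distr lborel borel (\<lambda>z. p + \<epsilon> *\<^sub>R z)) (\<lambda>_. ennreal (\<epsilon> ^ 3)))"
    using lborel_affine[of \<epsilon> p] e by (simp flip: ennreal_power)
  also have "\<dots> = (\<integral>x. \<epsilon> ^ 3 *\<^sub>R f x \<partial>distr lborel borel (\<lambda>z. p + \<epsilon> *\<^sub>R z))"
    using e by (intro integral_density) auto
  also have "\<dots> = (\<integral>z. \<epsilon> ^ 3 *\<^sub>R f (p + \<epsilon> *\<^sub>R z) \<partial>lborel)"
    by (rule integral_distr) auto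
  finally show ?thesis by (simp add: scaleR_conv_of_real)
qed

lemma reg_dist_scale: assumes "\<epsilon> > 0" shows "reg_dist \<epsilon> p (p + \<epsilon> *\<^sub>R z) = \<epsilon> * reg_dist 1 0 z"
proof -
  have "(norm (\<epsilon> *\<^sub>R z))\<^sup>2 + \<epsilon>\<^sup>2 = \<epsilon>\<^sup>2 * ((norm z)\<^sup>2 + 1)" by (simp add: power_mult_distrib algebra_simps)
  then show ?thesis using assms by (simp add: reg_dist_def real_sqrt_mult)
qed

lemma yuk_hess_scale: 
  assumes "\<epsilon> > 0" "\<rho> > 0" shows "\<epsilon> ^ 3 * (\<epsilon>\<^sup>2 * yuk_hess s (\<epsilon> * \<rho>)) = yuk_hess (\<epsilon> * s) \<rho>"
  using assms by (simp add: yuk_hess_def field_simps eval_nat_numeral)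

lemma measurable_yuk_hess [measurable]: "yuk_hess s \<in> borel_measurable borel"
  unfolding yuk_hess_def by measurable

lemma yuk_hess_nonneg: "s \<ge> 0 \<Longrightarrow> \<rho> > 0 \<Longrightarrow> yuk_hess s \<rho> \<ge> 0"
  by (simp add: yuk_hess_def)

text \<open>In the unit ball \<open>\<epsilon>\<rho> \<le> 2\<close>, which allows to trade powers of \<open>\<epsilon>\<close> for powers of \<open>1/\<rho>\<close>.\<close>

lemma yuk_hess_dominated:
  assumes s: "s > 0" and e: "0 < \<epsilon>" "\<epsilon> \<le> 1" and z: "norm (\<epsilon> *\<^sub>R z) < 1"
  shows "yuk_hess (\<epsilon> * s) (reg_dist 1 0 z) \<le> (4 * s\<^sup>2 + 6 * s + 3) * green_kernel z"
proof -
  let ?\<rho> = "reg_dist 1 0 z"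
  have \<rho>: "?\<rho> > 0" using reg_dist_bounds(1)[of 1 0 z] by simp
  have "(\<epsilon> * ?\<rho>)\<^sup>2 = (norm (\<epsilon> *\<^sub>R z))\<^sup>2 + \<epsilon>\<^sup>2"
    by (simp add: power_mult_distrib reg_dist_sq algebra_simps)
  also have "\<dots> \<le> 1\<^sup>2 + 1\<^sup>2" using z e by (intro add_mono power_mono) auto
  also have "\<dots> \<le> (2::real)\<^sup>2" by simp
  finally have er: "\<epsilon> * ?\<rho> \<le> 2" by (rule power2_le_imp_le) simp
  let ?x = "\<epsilon> * ?\<rho>"
  have x0: "?x \<ge> 0" using e \<rho> by simp
  have "(\<epsilon> * s)\<^sup>2 / ?\<rho> ^ 3 + 3 * (\<epsilon> * s) / ?\<rho> ^ 4 + 3 / ?\<rho> ^ 5 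
      = (s\<^sup>2 * ?x\<^sup>2 + 3 * s * ?x + 3) / ?\<rho> ^ 5"
    using \<rho> by (simp add: field_simps eval_nat_numeral)
  also have "\<dots> \<le> (s\<^sup>2 * 2\<^sup>2 + 3 * s * 2 + 3) / ?\<rho> ^ 5"
    using er x0 \<rho> s by (intro divide_right_mono add_mono mult_left_mono power_mono) auto
  finally have b: "(\<epsilon> * s)\<^sup>2 / ?\<rho> ^ 3 + 3 * (\<epsilon> * s) / ?\<rho> ^ 4 + 3 / ?\<rho> ^ 5 \<le> (4 * s\<^sup>2 + 6 * s + 3) / ?\<rho> ^ 5"
    by (simp add: mult.commute)
  have "exp (- (\<epsilon> * s) * ?\<rho>) \<le> 1" using e s \<rho> by simp
  then have "yuk_hess (\<epsilon> * s) ?\<rho> \<le> 1 * ((4 * s\<^sup>2 + 6 * s + 3) / ?\<rho> ^ 5)"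
    unfolding yuk_hess_def using b e s \<rho> by (intro mult_mono) auto
  also have "\<dots> \<le> (4 * s\<^sup>2 + 6 * s + 3) * green_kernel z"
    using s \<rho> by (simp add: green_kernel_def divide_right_mono)
  finally show ?thesis .
qed

text \<open>Inside the unit ball around \<open>p\<close> rescale and use the continuity of \<open>F\<close>; outside, the kernels are of
  order \<open>\<epsilon>\<^sup>2\<close> times an exponentially decaying function.\<close>

lemma approximate_identity:
  fixes F :: "real^3 \<Rightarrow> complex"
  assumes s: "s > 0" and F: "continuous_on UNIV F" and L: "F \<in> L2"
  defines "\<epsilon> \<equiv> \<lambda>n. 1 / real (Suc n)"
  shows "(\<lambda>n. \<integral>x. of_real ((\<epsilon> n)\<^sup>2 * yuk_hess s (reg_dist (\<epsilon> n) p x)) * F x \<partial>lborel)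
     \<longlonglongrightarrow> of_real green_const * F p"
proof -
  have \<epsilon>: "\<epsilon> n > 0" "\<epsilon> n \<le> 1" for n by (auto simp: \<epsilon>_def)
  have \<epsilon>0: "\<epsilon> \<longlonglongrightarrow> 0" unfolding \<epsilon>_def by real_asymp
  have [measurable]: "F \<in> borel_measurable borel" using L2_measurable[OF L] .
  define U where "U = ball p 1"
  have [measurable]: "U \<in> sets borel" unfolding U_def by simp
  define k where "k n x = (\<epsilon> n)\<^sup>2 * yuk_hess s (reg_dist (\<epsilon> n) p x)" for n x
  have [measurable]: "k n \<in> borel_measurable borel" for n unfolding k_def by measurable
  have k_int: "integrable lborel (\<lambda>x. of_real (k n x) * F x)" for n
  proof -
    have "(\<lambda>x. of_real (k n x)) \<in> L2"
      using L2_cmult[OF reg_yukawa_L2(5)[OF s \<epsilon>(1)[of n]], of "of_real ((\<epsilon> n)\<^sup>2)" p] 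
      by (simp add: k_def)
    then show ?thesis using L by (rule L2_mult_integrable)
  qed
  let ?in = "\<lambda>n x. indicator U x *\<^sub>R (of_real (k n x) * F x)"
  let ?out = "\<lambda>n x. indicator (- U) x *\<^sub>R (of_real (k n x) * F x)"
  have int_in: "integrable lborel (?in n)" and int_out: "integrable lborel (?out n)" for n
    using k_int by (auto intro!: integrable_mult_indicator)
  have split: "(\<integral>x. of_real (k n x) * F x \<partial>lborel) = (\<integral>x. ?in n x \<partial>lborel) + (\<integral>x. ?out n x \<partial>lborel)" for n
    unfolding Bochner_Integration.integral_add[OF int_in int_out, symmetric]
    by (intro Bochner_Integration.integral_cong) (auto simp: indicator_def)
  have out: "(\<lambda>n. \<integral>x. ?out n x \<partial>lborel) \<longlonglongrightarrow> (\<integral>x. 0 \<partial>(lborel :: (real^3) measure))"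
  proof (rule integral_dominated_convergence)
    let ?w = "\<lambda>x. (s\<^sup>2 + 3 * s + 3) * cmod (of_real (exp (- s * dist x p)) * F x)"
    show "integrable lborel ?w"
      using L2_mult_integrable[OF W22_L2[OF exp_dist_W22(1)[OF s]] L] by simp
    have b: "\<bar>yuk_hess s (reg_dist (\<epsilon> n) p x)\<bar> \<le> (s\<^sup>2 + 3 * s + 3) * exp (- s * dist x p)" if "x \<in> - U" for n x
    proof -
      have "1 \<le> dist x p" using that by (auto simp: U_def dist_commute)
      then have "1 \<le> reg_dist (\<epsilon> n) p x" using reg_dist_bounds(3)[OF \<epsilon>(1), of x p n] by linarith
      from yuk_decay(4)[OF s zero_less_one zero_le_dist this reg_dist_bounds(3)[OF \<epsilon>(1)]]
      show ?thesis by simp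
    qed
    have kb: "\<bar>k n x\<bar> \<le> (\<epsilon> n)\<^sup>2 * ((s\<^sup>2 + 3 * s + 3) * exp (- s * dist x p))" if "x \<in> - U" for n x
      unfolding k_def abs_mult abs_power2 using b[OF that] by (intro mult_left_mono) auto
    have K0: "0 \<le> (s\<^sup>2 + 3 * s + 3) * exp (- s * dist x p)" for x using s by simp
    show "AE x in lborel. norm (?out n x) \<le> ?w x" for n
    proof (rule AE_I2)
      fix x
      show "norm (?out n x) \<le> ?w x"
      proof (cases "x \<in> U")
        case True
        then show ?thesis using s by (simp add: indicator_def)
      next
        case False
        have "(\<epsilon> n)\<^sup>2 \<le> 1" using \<epsilon>[of n] by (simp add: power_le_one)
        then have "\<bar>k n x\<bar> \<le> (s\<^sup>2 + 3 * s + 3) * exp (- s * dist x p)"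
          using kb[of x n] False mult_right_mono[OF _ K0[of x], of "(\<epsilon> n)\<^sup>2" 1] by simp
        from mult_right_mono[OF this norm_ge_zero[of "F x"]]
        show ?thesis using False by (simp add: norm_mult mult.assoc)
      qed
    qed
    show "AE x in lborel. (\<lambda>n. ?out n x) \<longlonglongrightarrow> 0"
    proof (rule AE_I2)
      fix x
      show "(\<lambda>n. ?out n x) \<longlonglongrightarrow> 0"
      proof (cases "x \<in> U")
        case False
        have "(\<lambda>n. (\<epsilon> n)\<^sup>2 * ((s\<^sup>2 + 3 * s + 3) * exp (- s * dist x p))) \<longlonglongrightarrow> 0\<^sup>2 * ((s\<^sup>2 + 3 * s + 3) * exp (- s * dist x p))"
          by (intro tendsto_intros \<epsilon>0)
        then have 0: "(\<lambda>n. (\<epsilon> n)\<^sup>2 * ((s\<^sup>2 + 3 * s + 3) * exp (- s * dist x p))) \<longlonglongrightarrow> 0" by simp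
        have "(\<lambda>n. k n x) \<longlonglongrightarrow> 0"
          by (rule tendsto_rabs_zero_cancel, rule tendsto_sandwich[OF _ _ tendsto_const 0])
            (use kb False in auto)
        then have "(\<lambda>n. of_real (k n x) * F x) \<longlonglongrightarrow> of_real 0 * F x" by (intro tendsto_intros)
        then show ?thesis using False by simp
      qed simp
    qed
  qed measurable
  have "compact (F ` cball p 1)" using F by (intro compact_continuous_image continuous_on_subset[OF F]) auto
  then obtain K where K: "\<And>x. x \<in> cball p 1 \<Longrightarrow> cmod (F x) \<le> K"
    using compact_imp_bounded bounded_iff by (metis imageI)
  have K0: "K \<ge> 0" using K[of p] norm_ge_zero order_trans by (metis centre_in_cball zero_le_one)
  have scale: "(\<integral>x. ?in n x \<partial>lborel) = (\<integral>z. indicator U (p + \<epsilon> n *\<^sub>R z) *\<^sub>R 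
      (of_real (yuk_hess (\<epsilon> n * s) (reg_dist 1 0 z)) * F (p + \<epsilon> n *\<^sub>R z)) \<partial>lborel)" for n
  proof -
    have "(\<integral>x. ?in n x \<partial>lborel) = (\<integral>z. of_real ((\<epsilon> n) ^ 3) * ?in n (p + \<epsilon> n *\<^sub>R z) \<partial>lborel)"
      by (rule integral_affine3) (use \<epsilon> in auto)
    also have "\<dots> = (\<integral>z. indicator U (p + \<epsilon> n *\<^sub>R z) *\<^sub>R 
      (of_real (yuk_hess (\<epsilon> n * s) (reg_dist 1 0 z)) * F (p + \<epsilon> n *\<^sub>R z)) \<partial>lborel)"
    proof (rule Bochner_Integration.integral_cong[OF refl])
      fix z
      have "(\<epsilon> n) ^ 3 * k n (p + \<epsilon> n *\<^sub>R z) = yuk_hess (\<epsilon> n * s) (reg_dist 1 0 z)"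
        unfolding k_def reg_dist_scale[OF \<epsilon>(1)]
        using reg_dist_bounds(1)[of 1 0 z] by (intro yuk_hess_scale \<epsilon>) auto
      then show "of_real ((\<epsilon> n) ^ 3) * ?in n (p + \<epsilon> n *\<^sub>R z) = indicator U (p + \<epsilon> n *\<^sub>R z) *\<^sub>R 
          (of_real (yuk_hess (\<epsilon> n * s) (reg_dist 1 0 z)) * F (p + \<epsilon> n *\<^sub>R z))"
        by (simp add: scaleR_conv_of_real mult_ac flip: of_real_mult of_real_power)
    qed
    finally show ?thesis .
  qed
  have lim_in: "(\<lambda>n. \<integral>x. ?in n x \<partial>lborel) \<longlonglongrightarrow> (\<integral>z. of_real (green_kernel z) * F p \<partial>lborel)"
    unfolding scale
  proof (rule integral_dominated_convergence[where w = "\<lambda>z. (4 * s\<^sup>2 + 6 * s + 3) * K * green_kernel z"])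
    show "integrable lborel (\<lambda>z. (4 * s\<^sup>2 + 6 * s + 3) * K * green_kernel z)"
      using integrable_green_kernel by simp
    show "AE z in lborel. (\<lambda>n. indicator U (p + \<epsilon> n *\<^sub>R z) *\<^sub>R 
      (of_real (yuk_hess (\<epsilon> n * s) (reg_dist 1 0 z)) * F (p + \<epsilon> n *\<^sub>R z))) \<longlonglongrightarrow> of_real (green_kernel z) * F p"
    proof (rule AE_I2)
      fix z
      have lim: "(\<lambda>n. p + \<epsilon> n *\<^sub>R z) \<longlonglongrightarrow> p + 0 *\<^sub>R z" by (intro tendsto_intros \<epsilon>0)
      then have lim': "(\<lambda>n. p + \<epsilon> n *\<^sub>R z) \<longlonglongrightarrow> p" by simp
      have ev: "\<forall>\<^sub>F n in sequentially. p + \<epsilon> n *\<^sub>R z \<in> U"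
        using lim' by (rule topological_tendstoD) (auto simp: U_def)
      have 1: "(\<lambda>n. F (p + \<epsilon> n *\<^sub>R z)) \<longlonglongrightarrow> F p"
        by (rule isCont_tendsto_compose[OF _ lim']) (use F in \<open>simp add: continuous_on_eq_continuous_at\<close>)
      let ?\<rho> = "reg_dist 1 0 z"
      have "(\<lambda>n. exp (- (\<epsilon> n * s) * ?\<rho>) * ((\<epsilon> n * s)\<^sup>2 / ?\<rho> ^ 3 + 3 * (\<epsilon> n * s) / ?\<rho> ^ 4 + 3 / ?\<rho> ^ 5))
        \<longlonglongrightarrow> exp (- (0 * s) * ?\<rho>) * ((0 * s)\<^sup>2 / ?\<rho> ^ 3 + 3 * (0 * s) / ?\<rho> ^ 4 + 3 / ?\<rho> ^ 5)"
        using reg_dist_bounds(1)[of 1 0 z] by (intro tendsto_intros \<epsilon>0) auto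
      then have 2: "(\<lambda>n. yuk_hess (\<epsilon> n * s) ?\<rho>) \<longlonglongrightarrow> green_kernel z"
        by (simp add: yuk_hess_def green_kernel_def)
      have "(\<lambda>n. of_real (yuk_hess (\<epsilon> n * s) ?\<rho>) * F (p + \<epsilon> n *\<^sub>R z)) \<longlonglongrightarrow> of_real (green_kernel z) * F p"
        by (intro tendsto_intros 1 2)
      then show "(\<lambda>n. indicator U (p + \<epsilon> n *\<^sub>R z) *\<^sub>R 
          (of_real (yuk_hess (\<epsilon> n * s) ?\<rho>) * F (p + \<epsilon> n *\<^sub>R z))) \<longlonglongrightarrow> of_real (green_kernel z) * F p"
        by (rule Lim_transform_eventually) (use ev in \<open>auto elim: eventually_mono\<close>)
    qed
    show "AE z in lborel. norm (indicator U (p + \<epsilon> n *\<^sub>R z) *\<^sub>R 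
      (of_real (yuk_hess (\<epsilon> n * s) (reg_dist 1 0 z)) * F (p + \<epsilon> n *\<^sub>R z))) \<le> (4 * s\<^sup>2 + 6 * s + 3) * K * green_kernel z" for n
    proof (rule AE_I2)
      fix z
      have g: "0 \<le> (4 * s\<^sup>2 + 6 * s + 3) * green_kernel z" using s green_kernel_pos[of z] by simp
      show "norm (indicator U (p + \<epsilon> n *\<^sub>R z) *\<^sub>R 
         (of_real (yuk_hess (\<epsilon> n * s) (reg_dist 1 0 z)) * F (p + \<epsilon> n *\<^sub>R z))) \<le> (4 * s\<^sup>2 + 6 * s + 3) * K * green_kernel z"
      proof (cases "p + \<epsilon> n *\<^sub>R z \<in> U")
        case True
        then have z: "norm (\<epsilon> n *\<^sub>R z) < 1" by (simp add: U_def dist_norm)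
        have "0 \<le> yuk_hess (\<epsilon> n * s) (reg_dist 1 0 z)"
          using reg_dist_bounds(1)[of 1 0 z] \<epsilon>(1)[of n] s by (intro yuk_hess_nonneg) auto
        then have "\<bar>yuk_hess (\<epsilon> n * s) (reg_dist 1 0 z)\<bar> \<le> (4 * s\<^sup>2 + 6 * s + 3) * green_kernel z"
          using yuk_hess_dominated[OF s \<epsilon> z] by simp
        moreover have "cmod (F (p + \<epsilon> n *\<^sub>R z)) \<le> K"
          using True by (intro K) (auto simp: U_def)
        ultimately have "\<bar>yuk_hess (\<epsilon> n * s) (reg_dist 1 0 z)\<bar> * cmod (F (p + \<epsilon> n *\<^sub>R z)) \<le> (4 * s\<^sup>2 + 6 * s + 3) * green_kernel z * K"
          using g by (intro mult_mono) auto
        then show ?thesis using True by (simp add: norm_mult mult_ac)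
      next
        case False
        then show ?thesis using g K0 by (simp add: mult_ac)
      qed
    qed
  qed measurable
  have e: "(\<integral>z. of_real (green_kernel z) * F p \<partial>lborel) + (\<integral>x. 0 \<partial>(lborel :: (real^3) measure)) = of_real green_const * F p"
    by (simp add: green_const_def)
  have "(\<lambda>n. \<integral>x. of_real (k n x) * F x \<partial>lborel) \<longlonglongrightarrow> of_real green_const * F p"
    unfolding split by (rule tendsto_eq_rhs[OF tendsto_add[OF lim_in out] e])
  then show ?thesis unfolding k_def .
qed

text \<open>Test the equation with the regularised potential and let \<open>\<epsilon>\<close> tend to zero: on the left the
  regularised potentials are dominated by the Yukawa potential, on the right they give an approximate
  identity.\<close>

lemma green_formula:
  fixes u v F :: "real^3 \<Rightarrow> complex"
  assumes s: "s > 0" and u: "u \<in> L2" and v: "v \<in> L2" and l: "has_laplacian u v"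
    and F: "continuous_on UNIV F" "AE x in lborel. F x = u x"
  shows "(\<integral>x. of_real (yukawa s p x) * (of_real (s\<^sup>2) * u x - v x) \<partial>lborel) = of_real green_const * F p"
proof -
  define \<epsilon> where "\<epsilon> n = 1 / real (Suc n)" for n
  have \<epsilon>: "\<epsilon> n > 0" for n by (auto simp: \<epsilon>_def)
  have \<epsilon>0: "\<epsilon> \<longlonglongrightarrow> 0" unfolding \<epsilon>_def by real_asymp
  have [measurable]: "u \<in> borel_measurable borel" "v \<in> borel_measurable borel" "F \<in> borel_measurable borel"
    using u v L2_measurable F(1) borel_measurable_continuous_onI by auto
  have FL: "F \<in> L2"
    by (rule L2_bound[OF u, where C = 1]) (use F(2) in \<open>auto elim: eventually_mono\<close>)
  define g where "g n = reg_yukawa (\<epsilon> n) s p" for n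
  have gs: "smooth (g n)" for n unfolding g_def by (rule smooth_reg_yukawa[OF \<epsilon>])
  have [measurable]: "g n \<in> borel_measurable borel" for n by (rule smooth_measurable[OF gs])
  have gL: "(\<lambda>x. of_real (g n x)) \<in> L2" "(\<lambda>x. of_real (partial i (g n) x)) \<in> L2"
    "(\<lambda>x. of_real (partial i (partial i (g n)) x)) \<in> L2"
    "(\<lambda>x. of_real (laplacian (g n) x)) \<in> L2" for n i
    unfolding g_def by (rule reg_yukawa_L2[OF s \<epsilon>])+
  define w where "w x = of_real (s\<^sup>2) * u x - v x" for x
  have wL: "w \<in> L2" unfolding w_def[abs_def] by (intro L2_diff L2_cmult u v)
  have [measurable]: "w \<in> borel_measurable borel" using L2_measurable[OF wL] .
  have eq: "(\<integral>x. of_real (g n x) * w x \<partial>lborel) = (\<integral>x. of_real ((\<epsilon> n)\<^sup>2 * yuk_hess s (reg_dist (\<epsilon> n) p x)) * F x \<partial>lborel)" for n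
  proof -
    note int = L2_mult_integrable[OF gL(1)[of n] u] L2_mult_integrable[OF gL(1)[of n] v] L2_mult_integrable[OF gL(4)[of n] u]
    have "(\<integral>x. of_real (g n x) * w x \<partial>lborel) = (\<integral>x. of_real (s\<^sup>2) * (of_real (g n x) * u x) - of_real (g n x) * v x \<partial>lborel)"
      by (simp add: w_def algebra_simps)
    also have "\<dots> = of_real (s\<^sup>2) * (\<integral>x. of_real (g n x) * u x \<partial>lborel) - (\<integral>x. of_real (g n x) * v x \<partial>lborel)"
      using int by simp
    also have "(\<integral>x. of_real (g n x) * v x \<partial>lborel) = (\<integral>x. of_real (laplacian (g n) x) * u x \<partial>lborel)"
      by (rule has_laplacian_L2_test[OF l v gs gL(1-3), symmetric])
    also have "of_real (s\<^sup>2) * (\<integral>x. of_real (g n x) * u x \<partial>lborel) - (\<integral>x. of_real (laplacian (g n) x) * u x \<partial>lborel)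
       = (\<integral>x. of_real (s\<^sup>2) * (of_real (g n x) * u x) - of_real (laplacian (g n) x) * u x \<partial>lborel)"
      using int by simp
    also have "\<dots> = (\<integral>x. of_real ((\<epsilon> n)\<^sup>2 * yuk_hess s (reg_dist (\<epsilon> n) p x)) * u x \<partial>lborel)"
      by (simp only: laplacian_reg_yukawa[OF \<epsilon>, symmetric] g_def of_real_diff of_real_mult left_diff_distrib mult.assoc)
    also have "\<dots> = (\<integral>x. of_real ((\<epsilon> n)\<^sup>2 * yuk_hess s (reg_dist (\<epsilon> n) p x)) * F x \<partial>lborel)"
    proof (rule integral_cong_AE)
      show "AE x in lborel. of_real ((\<epsilon> n)\<^sup>2 * yuk_hess s (reg_dist (\<epsilon> n) p x)) * u x
          = of_real ((\<epsilon> n)\<^sup>2 * yuk_hess s (reg_dist (\<epsilon> n) p x)) * F x"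
        using F(2) by eventually_elim simp
    qed measurable
    finally show ?thesis .
  qed
  have "(\<lambda>n. \<integral>x. of_real (g n x) * w x \<partial>lborel) \<longlonglongrightarrow> (\<integral>x. of_real (yukawa s p x) * w x \<partial>lborel)"
  proof (rule integral_dominated_convergence[where w = "\<lambda>x. cmod (of_real (yukawa s p x) * w x)"])
    show "integrable lborel (\<lambda>x. cmod (of_real (yukawa s p x) * w x))"
      using L2_mult_integrable[OF yukawa_L2[OF s] wL] by simp
    show "AE x in lborel. (\<lambda>n. of_real (g n x) * w x) \<longlonglongrightarrow> of_real (yukawa s p x) * w x"
      using AE_lborel_singleton[of p]
    proof eventually_elim
      case (elim x)
      have "(\<lambda>n. g n x) \<longlonglongrightarrow> yukawa s p x"
        unfolding g_def by (rule reg_yukawa_tendsto[OF elim \<epsilon>0])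
      then show ?case by (intro tendsto_intros)
    qed
    show "AE x in lborel. cmod (of_real (g n x) * w x) \<le> cmod (of_real (yukawa s p x) * w x)" for n
      using AE_lborel_singleton[of p]
    proof eventually_elim
      case (elim x)
      have "\<bar>g n x\<bar> \<le> \<bar>yukawa s p x\<bar>"
        unfolding g_def by (rule reg_yukawa_le[OF s \<epsilon> elim])
      then show ?case unfolding norm_mult norm_of_real by (intro mult_right_mono) auto
    qed
  qed measurable
  moreover have "(\<lambda>n. \<integral>x. of_real (g n x) * w x \<partial>lborel) \<longlonglongrightarrow> of_real green_const * F p"
    unfolding eq unfolding \<epsilon>_def by (rule approximate_identity[OF s F(1) FL])
  ultimately show ?thesis unfolding w_def by (rule LIMSEQ_unique)
qed

lemma green_test_function:
  assumes s: "s > 0" and \<phi>: "test_function \<phi>"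
  shows "(\<integral>x. of_real (yukawa s p x) * of_real (s\<^sup>2 * \<phi> x - laplacian \<phi> x) \<partial>lborel) = complex_of_real (green_const * \<phi> p)"
proof -
  have L: "(\<lambda>x. of_real (laplacian \<phi> x)) \<in> L2"
    unfolding laplacian_def of_real_sum by (intro L2_sum L2_test_function test_function_partial \<phi>)
  have "(\<integral>x. of_real (yukawa s p x) * (of_real (s\<^sup>2) * of_real (\<phi> x) - of_real (laplacian \<phi> x)) \<partial>lborel) = of_real green_const * complex_of_real (\<phi> p)"
    by (rule green_formula[OF s L2_test_function[OF \<phi>] L test_function_has_laplacian[OF \<phi>]])
      (auto intro!: continuous_on_of_real smooth_continuous test_function_smooth[OF \<phi>])
  then show ?thesis by simp
qed

text \<open>Green's formula for \<open>u = exp(-s|x - q|)\<close>, which satisfies \<open>s\<^sup>2 u - \<Delta>u = 2s exp(-s r)/r\<close>.\<close>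

lemma yukawa_gram:
  assumes s: "s > 0"
  shows "(\<integral>x. yukawa s p x * yukawa s q x \<partial>lborel) = green_const / (2 * s) * exp (- s * dist p q)"
proof -
  let ?v = "\<lambda>x. complex_of_real (s\<^sup>2 * exp (- s * dist x q) - 2 * s * yukawa s q x)"
  have "?v = (\<lambda>x. of_real (s\<^sup>2) * of_real (exp (- s * dist x q)) - of_real (2 * s) * of_real (yukawa s q x))"
    by auto
  then have v: "?v \<in> L2" using s by (simp only:) (intro L2_diff L2_cmult yukawa_L2 W22_L2 exp_dist_W22)
  have "(\<integral>x. of_real (yukawa s p x) * (of_real (s\<^sup>2) * of_real (exp (- s * dist x q)) - ?v x) \<partial>lborel) 
     = of_real green_const * complex_of_real (exp (- s * dist p q))"
    by (rule green_formula[OF s W22_L2[OF exp_dist_W22(1)[OF s]] v exp_dist_W22(2)[OF s]])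
      (auto intro!: continuous_on_of_real continuous_intros)
  moreover have "of_real (yukawa s p x) * (of_real (s\<^sup>2) * of_real (exp (- s * dist x q)) - ?v x)
     = complex_of_real (2 * s * (yukawa s p x * yukawa s q x))" for x
    by simp
  ultimately have "(\<integral>x. complex_of_real (2 * s * (yukawa s p x * yukawa s q x)) \<partial>lborel) = of_real (green_const * exp (- s * dist p q))"
    by (simp only: of_real_mult)
  then have "(\<integral>x. 2 * s * (yukawa s p x * yukawa s q x) \<partial>lborel) = green_const * exp (- s * dist p q)"
    unfolding integral_complex_of_real of_real_eq_iff .
  then have "2 * s * (\<integral>x. yukawa s p x * yukawa s q x \<partial>lborel) = green_const * exp (- s * dist p q)"
    by simp
  then show ?thesis using s by (simp add: field_simps)
qed

section \<open>The negative eigenfunctions\<close>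

definition yukawa_sum :: "real \<Rightarrow> ('m::finite \<Rightarrow> real^3) \<Rightarrow> complex^'m \<Rightarrow> real^3 \<Rightarrow> complex" where
  "yukawa_sum s X c x = (\<Sum>j\<in>UNIV. c $ j * of_real (yukawa s (X j) x))"

text \<open>Up to a factor \<open>4\<pi>\<close> this is \<open>B\<^sub>\<alpha>\<close> minus the Weyl function of \<open>(\<Gamma>\<^sub>0, \<Gamma>\<^sub>1)\<close> at \<open>-s\<^sup>2\<close>. The term \<open>s\<close> on the
  diagonal is minus the regular part of \<open>exp(-s r)/r\<close> at its pole.\<close>

definition krein_mat :: "('m::finite \<Rightarrow> real) \<Rightarrow> ('m \<Rightarrow> real^3) \<Rightarrow> real \<Rightarrow> complex^'m^'m" where
  "krein_mat \<alpha> X s = (\<chi> i j. of_real (if i = j then 4 * pi * \<alpha> i + s else - yukawa s (X j) (X i)))"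

lemma krein_mat_mult:
  "(krein_mat \<alpha> X s *v c) $ k = of_real (4 * pi * \<alpha> k + s) * c $ k 
     - (\<Sum>j\<in>UNIV - {k}. c $ j * of_real (yukawa s (X j) (X k)))"
proof -
  have "(krein_mat \<alpha> X s *v c) $ k = (\<Sum>j\<in>UNIV. krein_mat \<alpha> X s $ k $ j * c $ j)"
    by (simp add: matrix_vector_mult_def)
  also have "\<dots> = krein_mat \<alpha> X s $ k $ k * c $ k + (\<Sum>j\<in>UNIV - {k}. krein_mat \<alpha> X s $ k $ j * c $ j)"
    by (rule sum.remove) auto
  also have "(\<Sum>j\<in>UNIV - {k}. krein_mat \<alpha> X s $ k $ j * c $ j) = (\<Sum>j\<in>UNIV - {k}. - (c $ j * of_real (yukawa s (X j) (X k))))"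
    by (intro sum.cong) (auto simp: krein_mat_def)
  finally show ?thesis by (simp add: krein_mat_def sum_negf)
qed

lemma yukawa_sum_L2: "s > 0 \<Longrightarrow> yukawa_sum s X c \<in> L2"
  unfolding yukawa_sum_def[abs_def] by (intro L2_sum L2_cmult yukawa_L2)

lemma dist_at_right: "filterlim (\<lambda>x. dist x p) (at_right 0) (at (p::real^3))"
proof -
  have "((\<lambda>x. dist x p) \<longlongrightarrow> dist p p) (at p)" by (intro tendsto_intros)
  then show ?thesis by (auto simp: filterlim_at eventually_at_filter)
qed

lemma yukawa_pole: "((\<lambda>x. yukawa s p x - 1 / dist x p) \<longlongrightarrow> - s) (at p)"
proof -
  have "((\<lambda>r::real. exp (- s * r) / r - 1 / r) \<longlongrightarrow> - s) (at_right 0)" by real_asymp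
  from filterlim_compose[OF this dist_at_right] show ?thesis by (simp add: yukawa_def)
qed

text \<open>The pole of \<open>G\<^sub>k\<close> leaves \<open>-s\<close>, the other potentials are continuous at \<open>x\<^sub>k\<close>. With \<open>\<Gamma>\<^sub>0 = 4\<pi>c\<close> the limit says
  that the boundary condition holds exactly for kernel vectors.\<close>

lemma yukawa_sum_boundary:
  assumes X: "inj X"
  shows "((\<lambda>x. yukawa_sum s X c x - c $ k / of_real (dist x (X k))) \<longlongrightarrow> 
     of_real (4 * pi * \<alpha> k) * c $ k - (krein_mat \<alpha> X s *v c) $ k) (at (X k))"
proof -
  have "((\<lambda>x. c $ k * of_real (yukawa s (X k) x - 1 / dist x (X k)) + (\<Sum>j\<in>UNIV - {k}. c $ j * of_real (yukawa s (X j) x)))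
     \<longlongrightarrow> c $ k * of_real (- s) + (\<Sum>j\<in>UNIV - {k}. c $ j * of_real (yukawa s (X j) (X k)))) (at (X k))"
  proof (intro tendsto_intros yukawa_pole)
    fix j assume "j \<in> UNIV - {k}"
    then have "X k \<noteq> X j" using X by (auto dest: injD)
    then show "(yukawa s (X j) \<longlongrightarrow> yukawa s (X j) (X k)) (at (X k))"
      using continuous_yukawa isCont_def by blast
  qed
  moreover have "c $ k * of_real (- s) + (\<Sum>j\<in>UNIV - {k}. c $ j * of_real (yukawa s (X j) (X k)))
     = of_real (4 * pi * \<alpha> k) * c $ k - (krein_mat \<alpha> X s *v c) $ k"
    unfolding krein_mat_mult by (simp add: algebra_simps)
  moreover have "c $ k * of_real (yukawa s (X k) x - 1 / dist x (X k)) + (\<Sum>j\<in>UNIV - {k}. c $ j * of_real (yukawa s (X j) x))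
     = yukawa_sum s X c x - c $ k / of_real (dist x (X k))" for x
    unfolding yukawa_sum_def by (subst (2) sum.remove[of _ k]) (auto simp: algebra_simps)
  ultimately show ?thesis by simp
qed

lemma continuous_AE_zero:
  fixes f :: "real^3 \<Rightarrow> 'a::real_normed_vector"
  assumes S: "open S" and c: "continuous_on S f" and z: "AE x in lborel. f x = 0" and x: "x \<in> S"
  shows "f x = 0"
proof (rule ccontr)
  assume nz: "f x \<noteq> 0"
  let ?U = "S \<inter> f -` (- {0})"
  have "open (- {0 :: 'a})" by (intro open_Compl closed_singleton)
  then have U: "open ?U" by (rule continuous_open_preimage[OF c S])
  from z obtain N where N: "N \<in> null_sets lborel" "{x \<in> space lborel. f x \<noteq> 0} \<subseteq> N"
    by (auto simp: eventually_ae_filter)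
  then have "negligible N" 
    using null_sets_completionI negligible_iff_null_sets by blast
  then have "negligible ?U" by (rule negligible_subset) (use N(2) in auto)
  then show False using open_not_negligible[OF U] nz x by blast
qed

lemma closed_range_finite: "closed (range (X :: 'm::finite \<Rightarrow> real^3))"
  by (intro finite_imp_closed) simp

lemma eventually_not_in_range:
  assumes X: "inj (X :: 'm::finite \<Rightarrow> real^3)"
  shows "eventually (\<lambda>x. x \<notin> range X) (at (X k))"
proof -
  have "closed (X ` (UNIV - {k}))" by (intro finite_imp_closed) simp
  then have "open (- X ` (UNIV - {k}))" by auto
  moreover have "X k \<in> - X ` (UNIV - {k})" using X by (auto dest: injD)
  ultimately have "eventually (\<lambda>x. x \<in> - X ` (UNIV - {k})) (at (X k))"
    by (rule eventually_at_in_open')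
  moreover have "eventually (\<lambda>x. x \<noteq> X k) (at (X k))" by (simp add: eventually_at_filter)
  ultimately show ?thesis by eventually_elim auto
qed

lemma AE_not_in_range: "AE x in lborel. x \<notin> range (X :: 'm::finite \<Rightarrow> real^3)"
  by (intro AE_not_in) (auto intro: finite_imp_null_set_lborel)

lemma continuous_yukawa_sum: "continuous_on (- range X) (yukawa_sum s X c)"
proof -
  have "isCont (yukawa_sum s X c) x" if "x \<in> - range X" for x
    unfolding yukawa_sum_def using that by (intro continuous_intros continuous_yukawa) auto
  then show ?thesis by (simp add: continuous_at_imp_continuous_on)
qed

text \<open>Multiplying by the distance to \<open>x\<^sub>k\<close> and approaching \<open>x\<^sub>k\<close> isolates \<open>c\<^sub>k\<close>.\<close>

lemma yukawa_sum_independent: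
  assumes X: "inj X" and z: "AE x in lborel. yukawa_sum s X c x = 0"
  shows "c = 0"
proof -
  have zero: "yukawa_sum s X c x = 0" if "x \<notin> range X" for x
    using continuous_AE_zero[OF _ continuous_yukawa_sum z] that closed_range_finite by blast
  have "c $ k = 0" for k
  proof -
    let ?L = "of_real (4 * pi * (\<lambda>_. 0) k) * c $ k - (krein_mat (\<lambda>_. 0) X s *v c) $ k"
    have "((\<lambda>x. of_real (dist x (X k)) * (yukawa_sum s X c x - c $ k / of_real (dist x (X k)))) \<longlongrightarrow> of_real (dist (X k) (X k)) * ?L) (at (X k))"
      by (intro tendsto_mult yukawa_sum_boundary[OF X] tendsto_intros)
    then have 1: "((\<lambda>x. of_real (dist x (X k)) * (yukawa_sum s X c x - c $ k / of_real (dist x (X k)))) \<longlongrightarrow> 0) (at (X k))"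
      by simp
    have "eventually (\<lambda>x. of_real (dist x (X k)) * (yukawa_sum s X c x - c $ k / of_real (dist x (X k))) = - c $ k) (at (X k))"
      using eventually_not_in_range[OF X, of k]
    proof eventually_elim
      case (elim x)
      then have "x \<noteq> X k" by auto
      then show ?case using zero[OF elim] by simp
    qed
    then have "((\<lambda>x. - c $ k) \<longlongrightarrow> 0) (at (X k))"
      by (rule Lim_transform_eventually[OF 1])
    then show ?thesis by (simp add: tendsto_const_iff)
  qed
  then show ?thesis by (simp add: vec_eq_iff)
qed

text \<open>Up to a positive factor the sum is the squared \<open>L\<^sup>2\<close> norm of \<open>\<Sum>\<^sub>j c\<^sub>j G\<^sub>j\<close>.\<close>

lemma exp_dist_posdef:
  fixes X :: "'m::finite \<Rightarrow> real^3" and c :: "complex^'m"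
  assumes X: "inj X" and s: "s > 0" and c: "c \<noteq> 0"
  shows "Re (\<Sum>i\<in>UNIV. \<Sum>j\<in>UNIV. c $ i * cnj (c $ j) * of_real (exp (- s * dist (X i) (X j)))) > 0"
proof -
  let ?u = "yukawa_sum s X c"
  have L: "?u \<in> L2" by (rule yukawa_sum_L2[OF s])
  have i2: "integrable lborel (\<lambda>x. (cmod (?u x))\<^sup>2)" by (rule L2_sq_integrable[OF L])
  have int: "integrable lborel (\<lambda>x. complex_of_real (yukawa s (X i) x) * of_real (yukawa s (X j) x))" for i j
    by (intro L2_mult_integrable yukawa_L2 s)
  have eq: "complex_of_real ((cmod (?u x))\<^sup>2) = 
    (\<Sum>i\<in>UNIV. \<Sum>j\<in>UNIV. c $ i * cnj (c $ j) * (of_real (yukawa s (X i) x) * of_real (yukawa s (X j) x)))" for x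
  proof -
    have "complex_of_real ((cmod (?u x))\<^sup>2) = ?u x * cnj (?u x)" by (rule complex_norm_square)
    also have "cnj (?u x) = (\<Sum>j\<in>UNIV. cnj (c $ j) * of_real (yukawa s (X j) x))"
      by (simp add: yukawa_sum_def)
    finally show ?thesis unfolding yukawa_sum_def sum_product by (simp add: mult_ac)
  qed
  have "complex_of_real (\<integral>x. (cmod (?u x))\<^sup>2 \<partial>lborel) = (\<integral>x. complex_of_real ((cmod (?u x))\<^sup>2) \<partial>lborel)"
    by (rule integral_complex_of_real[symmetric])
  also have "\<dots> = (\<Sum>i\<in>UNIV. \<Sum>j\<in>UNIV. c $ i * cnj (c $ j) * (\<integral>x. of_real (yukawa s (X i) x) * of_real (yukawa s (X j) x) \<partial>lborel))"
    unfolding eq using int by simp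
  also have "\<dots> = (\<Sum>i\<in>UNIV. \<Sum>j\<in>UNIV. c $ i * cnj (c $ j) * of_real (green_const / (2 * s) * exp (- s * dist (X i) (X j))))"
    by (simp only: yukawa_gram[OF s, symmetric] integral_complex_of_real[symmetric] of_real_mult)
  also have "\<dots> = of_real (green_const / (2 * s)) * (\<Sum>i\<in>UNIV. \<Sum>j\<in>UNIV. c $ i * cnj (c $ j) * of_real (exp (- s * dist (X i) (X j))))"
    by (simp only: sum_distrib_left of_real_mult mult_ac)
  finally have z: "complex_of_real (\<integral>x. (cmod (?u x))\<^sup>2 \<partial>lborel) = of_real (green_const / (2 * s)) * 
     (\<Sum>i\<in>UNIV. \<Sum>j\<in>UNIV. c $ i * cnj (c $ j) * of_real (exp (- s * dist (X i) (X j))))" .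
  have Re_mult: "Re (complex_of_real a * y) = a * Re y" for a y by simp
  have e: "(\<integral>x. (cmod (?u x))\<^sup>2 \<partial>lborel) = green_const / (2 * s) * 
     Re (\<Sum>i\<in>UNIV. \<Sum>j\<in>UNIV. c $ i * cnj (c $ j) * of_real (exp (- s * dist (X i) (X j))))"
    using arg_cong[OF z, of Re] unfolding Re_complex_of_real Re_mult .
  have "(\<integral>x. (cmod (?u x))\<^sup>2 \<partial>lborel) \<noteq> 0"
  proof
    assume "(\<integral>x. (cmod (?u x))\<^sup>2 \<partial>lborel) = 0"
    then have "AE x in lborel. (cmod (?u x))\<^sup>2 = 0"
      using integral_nonneg_eq_0_iff_AE[OF i2] by simp
    then have "AE x in lborel. ?u x = 0" by simp
    then show False using yukawa_sum_independent[OF X] c by blast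
  qed
  moreover have "(\<integral>x. (cmod (?u x))\<^sup>2 \<partial>lborel) \<ge> 0" by (intro Bochner_Integration.integral_nonneg) simp
  ultimately have "0 < green_const / (2 * s) * 
     Re (\<Sum>i\<in>UNIV. \<Sum>j\<in>UNIV. c $ i * cnj (c $ j) * of_real (exp (- s * dist (X i) (X j))))"
    unfolding e by linarith
  moreover have "0 < green_const / (2 * s)" using green_const_pos s by simp
  ultimately show ?thesis by (simp only: zero_less_mult_pos)
qed

text \<open>The functions \<open>exp(-r\<^sub>j)\<close> in the decomposition of \<open>dom(H\<^sup>*)\<close> can take any values at the points, because
  their matrix is positive definite.\<close>

lemma exp_dist_interpolation:
  fixes X :: "'m::finite \<Rightarrow> real^3" and b :: "complex^'m"
  assumes X: "inj X"
  obtains \<xi> where "\<And>k. (\<Sum>j\<in>UNIV. \<xi> $ j * of_real (exp (- dist (X k) (X j)))) = b $ k"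
proof -
  define E :: "complex^'m^'m" where "E = (\<chi> i j. of_real (exp (- dist (X i) (X j))))"
  have E: "(E *v c) $ k = (\<Sum>j\<in>UNIV. c $ j * of_real (exp (- dist (X k) (X j))))" for c k
    by (simp add: E_def matrix_vector_mult_def mult.commute)
  have "c = 0" if c: "E *v c = 0" for c
  proof (rule ccontr)
    assume "c \<noteq> 0"
    from exp_dist_posdef[OF X zero_less_one this]
    have "0 < Re (\<Sum>i\<in>UNIV. \<Sum>j\<in>UNIV. c $ i * cnj (c $ j) * of_real (exp (- dist (X i) (X j))))" by simp
    also have "(\<Sum>i\<in>UNIV. \<Sum>j\<in>UNIV. c $ i * cnj (c $ j) * of_real (exp (- dist (X i) (X j))))
       = (\<Sum>j\<in>UNIV. cnj (c $ j) * (E *v c) $ j)"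
      unfolding E sum_distrib_left by (subst sum.swap) (simp add: mult_ac dist_commute)
    finally show False using c by simp
  qed
  then have "inj ((*v) E)" by (simp add: vec.linear_inj_iff_eq_0[OF matrix_vector_mul_linear_gen])
  then have "surj ((*v) E)" by (rule vec.linear_inj_imp_surj[OF matrix_vector_mul_linear_gen])
  then obtain \<xi> where "E *v \<xi> = b" by (metis surjD)
  then show ?thesis using that[of \<xi>] E by metis
qed

lemma decomp_yukawa:
  "decomp X \<xi>0 \<xi>1 fH x = (\<Sum>j\<in>UNIV. \<xi>0 $ j * of_real (yukawa 1 (X j) x) + \<xi>1 $ j * of_real (exp (- dist x (X j)))) + fH x"
  by (simp add: decomp_def yukawa_def)

lemma B_mat_mult: "(B_mat \<alpha> *v g) $ k = of_real (\<alpha> k) * g $ k"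
proof -
  have "(B_mat \<alpha> *v g) $ k = (\<Sum>j\<in>UNIV. B_mat \<alpha> $ k $ j * g $ j)"
    by (simp add: matrix_vector_mult_def)
  also have "\<dots> = (\<Sum>j\<in>UNIV. if k = j then of_real (\<alpha> k) * g $ j else 0)"
    by (intro sum.cong) (auto simp: B_mat_def)
  finally show ?thesis by simp
qed

lemma exp_dist1_W22: "(\<lambda>x. of_real (exp (- dist x p))) \<in> W2 2"
  using exp_dist_W22(1)[of 1 p] by simp

text \<open>By Green's formula \<open>\<Sum>\<^sub>j c\<^sub>j G\<^sub>j\<close> is orthogonal to \<open>(s\<^sup>2 - \<Delta>)f\<close> for all \<open>f\<close> vanishing at the points, so it
  belongs to the domain of the adjoint. Its decomposition has \<open>\<xi>\<^sub>0 = c\<close>: replacing \<open>exp(-s r)/r\<close> by \<open>exp(-r)/r\<close>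
  costs a function in \<open>W\<^sub>2\<^sup>2\<close>, whose values at the points are removed by interpolation.\<close>

lemma kernel_imp_eigenfunction:
  fixes X :: "'m::finite \<Rightarrow> real^3"
  assumes X: "inj X" and s: "s > 0" and c: "krein_mat \<alpha> X s *v c = 0"
  shows "yukawa_sum s X c \<in> eigenspace (H3 \<alpha> X) (- s\<^sup>2)"
proof -
  let ?u = "yukawa_sum s X c"
  have uL: "?u \<in> L2" by (rule yukawa_sum_L2[OF s])
  have vL: "(\<lambda>x. of_real (- s\<^sup>2) * ?u x) \<in> L2" by (rule L2_cmult[OF uL])
  have "L2_inner g ?u = L2_inner f (\<lambda>x. of_real (- s\<^sup>2) * ?u x)" if "(f, g) \<in> op_H X" for f g
  proof -
    from that obtain F where f: "f \<in> W2 2" and g: "g \<in> L2" and l: "has_laplacian f (\<lambda>x. - g x)"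
      and F: "continuous_on UNIV F" "AE x in lborel. F x = f x" "\<And>j. F (X j) = 0"
      by (auto simp: op_H_def dom_H_def)
    have fL: "f \<in> L2" by (rule W22_L2[OF f])
    let ?w = "\<lambda>x. of_real (s\<^sup>2) * f x + g x"
    have wL: "?w \<in> L2" by (intro L2_add L2_cmult fL g)
    have 0: "(\<integral>x. of_real (yukawa s (X j) x) * ?w x \<partial>lborel) = 0" for j
      using green_formula[OF s fL L2_uminus[OF g] l F(1,2), of "X j"] F(3) by simp
    have int: "integrable lborel (\<lambda>x. of_real (yukawa s (X j) x) * ?w x)" for j
      by (intro L2_mult_integrable yukawa_L2 s wL)
    have "(\<integral>x. ?w x * cnj (?u x) \<partial>lborel) = (\<integral>x. (\<Sum>j\<in>UNIV. cnj (c $ j) * (of_real (yukawa s (X j) x) * ?w x)) \<partial>lborel)"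
      by (simp add: yukawa_sum_def sum_distrib_left mult_ac)
    also have "\<dots> = 0" using int 0 by simp
    finally have "(\<integral>x. of_real (s\<^sup>2) * (f x * cnj (?u x)) + g x * cnj (?u x) \<partial>lborel) = 0"
      by (simp add: distrib_right mult.assoc)
    then have "of_real (s\<^sup>2) * (\<integral>x. f x * cnj (?u x) \<partial>lborel) + (\<integral>x. g x * cnj (?u x) \<partial>lborel) = 0"
      using L2_mult_integrable[OF fL L2_cnj[OF uL]] L2_mult_integrable[OF g L2_cnj[OF uL]] by simp
    then have "(\<integral>x. g x * cnj (?u x) \<partial>lborel) = - of_real (s\<^sup>2) * (\<integral>x. f x * cnj (?u x) \<partial>lborel)"
      by (simp add: add_eq_0_iff)
    also have "\<dots> = (\<integral>x. - of_real (s\<^sup>2) * (f x * cnj (?u x)) \<partial>lborel)"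
      by (rule integral_mult_right_zero[symmetric])
    also have "\<dots> = (\<integral>x. f x * cnj (of_real (- s\<^sup>2) * ?u x) \<partial>lborel)"
      by (intro Bochner_Integration.integral_cong) auto
    finally show ?thesis unfolding L2_inner_def .
  qed
  then have adj: "(?u, \<lambda>x. of_real (- s\<^sup>2) * ?u x) \<in> adjoint_op (op_H X)"
    using uL vL by (auto simp: adjoint_op_def)
  define w where "w x = (\<Sum>j\<in>UNIV. c $ j * of_real (yukawa_diff s 1 (X j) x))" for x
  obtain \<xi> where \<xi>: "\<And>k. (\<Sum>j\<in>UNIV. \<xi> $ j * of_real (exp (- dist (X k) (X j)))) = (\<chi> k. w (X k)) $ k"
    using exp_dist_interpolation[OF X] by blast
  define fH where "fH x = w x - (\<Sum>j\<in>UNIV. \<xi> $ j * of_real (exp (- dist x (X j))))" for x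
  have "fH = (\<lambda>x. w x + (\<Sum>j\<in>UNIV. (- \<xi> $ j) * of_real (exp (- dist x (X j)))))"
    by (simp add: fH_def sum_negf fun_eq_iff)
  then have fW: "fH \<in> W2 2" unfolding w_def
    by (simp only:) (intro W22_add W22_sum W22_cmult yukawa_diff_W22 exp_dist1_W22 s zero_less_one)
  have fc: "continuous_on UNIV fH" unfolding fH_def w_def
    by (intro continuous_intros continuous_on_of_real continuous_yukawa_diff)
  have "fH (X k) = 0" for k by (simp add: fH_def \<xi>)
  then have fH: "fH \<in> dom_H X" unfolding dom_H_def using fW fc by auto
  have dec: "decomp X c \<xi> fH x = ?u x" if "x \<notin> range X" for x
  proof -
    have "x \<noteq> X j" for j using that by auto
    then show ?thesis 
      by (simp add: decomp_yukawa fH_def w_def yukawa_diff_def yukawa_sum_def sum.distrib sum_subtractf algebra_simps)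
  qed
  define g0 where "g0 = (\<chi> j. of_real (4 * pi) * c $ j)"
  have ae: "AE x in lborel. ?u x = decomp X c \<xi> fH x"
    using AE_not_in_range[of X] by eventually_elim (simp add: dec)
  have lim: "((\<lambda>x. decomp X c \<xi> fH x - c $ k / of_real (dist x (X k))) \<longlongrightarrow> (B_mat \<alpha> *v g0) $ k) (at (X k))" for k
  proof -
    have "((\<lambda>x. ?u x - c $ k / of_real (dist x (X k))) \<longlongrightarrow> of_real (4 * pi * \<alpha> k) * c $ k - (krein_mat \<alpha> X s *v c) $ k) (at (X k))"
      by (rule yukawa_sum_boundary[OF X])
    moreover have "of_real (4 * pi * \<alpha> k) * c $ k - (krein_mat \<alpha> X s *v c) $ k = (B_mat \<alpha> *v g0) $ k"
      by (simp add: c B_mat_mult g0_def)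
    ultimately have "((\<lambda>x. ?u x - c $ k / of_real (dist x (X k))) \<longlongrightarrow> (B_mat \<alpha> *v g0) $ k) (at (X k))"
      by simp
    then show ?thesis
      by (rule Lim_transform_eventually)
        (use eventually_not_in_range[OF X, of k] in \<open>auto elim!: eventually_mono simp: dec\<close>)
  qed
  have "boundary_values X ?u g0 (B_mat \<alpha> *v g0)"
    unfolding boundary_values_def using fH fc ae g0_def lim by blast
  then show ?thesis using adj unfolding eigenspace_def H3_def by auto
qed

text \<open>Multiply the cut off regularised potential by \<open>\<Prod>\<^sub>j r\<^sub>j\<^sup>2/(r\<^sub>j\<^sup>2 + \<epsilon>\<^sup>2)\<close>; the bound by the limit makes dominated
  convergence applicable.\<close>

lemma yukawa_approximation:
  fixes X :: "'m::finite \<Rightarrow> real^3"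
  assumes s: "s > 0"
  obtains h where "\<And>n. test_function (h n)" "\<And>n j. h n (X j) = 0"
    "\<And>x. x \<noteq> p \<Longrightarrow> x \<notin> range X \<Longrightarrow> (\<lambda>n. h n x) \<longlonglongrightarrow> yukawa s p x"
    "\<And>n x. x \<noteq> p \<Longrightarrow> \<bar>h n x\<bar> \<le> \<bar>yukawa s p x\<bar>"
proof -
  define \<epsilon> where "\<epsilon> n = 1 / real (Suc n)" for n
  have \<epsilon>: "\<epsilon> n > 0" for n by (auto simp: \<epsilon>_def)
  have \<epsilon>0: "\<epsilon> \<longlonglongrightarrow> 0" unfolding \<epsilon>_def by real_asymp
  define w where "w n j x = (norm (x - X j))\<^sup>2 * ((norm (x - X j))\<^sup>2 + (\<epsilon> n)\<^sup>2) powr (- 1)" for n j x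
  have pos: "(norm (x - X j))\<^sup>2 + (\<epsilon> n)\<^sup>2 > 0" for n j x using \<epsilon>[of n] by (intro add_nonneg_pos) auto
  have ws: "smooth (w n j)" for n j unfolding w_def[abs_def]
    by (intro smooth_mult smooth_norm_sq smooth_powr smooth_reg_arg pos)
  have w: "w n j x = (norm (x - X j))\<^sup>2 / ((norm (x - X j))\<^sup>2 + (\<epsilon> n)\<^sup>2)" for n j x
    using pos[of x j n] by (simp add: w_def powr_minus_divide)
  have wb: "0 \<le> w n j x" "w n j x \<le> 1" for n j x using pos[of x j n] by (auto simp: w divide_le_eq_1)
  have wlim: "(\<lambda>n. w n j x) \<longlonglongrightarrow> 1" if "x \<noteq> X j" for j x
  proof -
    have nz: "(norm (x - X j))\<^sup>2 + 0\<^sup>2 \<noteq> 0" using that by simp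
    have "(\<lambda>n. w n j x) \<longlonglongrightarrow> (norm (x - X j))\<^sup>2 / ((norm (x - X j))\<^sup>2 + 0\<^sup>2)"
      unfolding w by (intro tendsto_intros \<epsilon>0 nz)
    then show ?thesis using that by simp
  qed
  define h where "h n x = cutoff n x * (reg_yukawa (\<epsilon> n) s p x * (\<Prod>j\<in>UNIV. w n j x))" for n x
  have 1: "test_function (h n)" for n unfolding h_def[abs_def]
    by (intro test_function_mult test_function_cutoff smooth_mult smooth_reg_yukawa \<epsilon> smooth_prod ws)
  have "w n j (X j) = 0" for n j by (simp add: w_def)
  then have "(\<Prod>i\<in>UNIV. w n i (X j)) = 0" for n j by (auto intro!: prod_zero)
  then have 2: "h n (X j) = 0" for n j by (simp add: h_def)
  have 3: "(\<lambda>n. h n x) \<longlonglongrightarrow> yukawa s p x" if "x \<noteq> p" "x \<notin> range X" for x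
  proof -
    have "(\<lambda>n. \<Prod>j\<in>UNIV. w n j x) \<longlonglongrightarrow> (\<Prod>j\<in>(UNIV :: 'm set). 1)"
      using that by (intro tendsto_prod wlim) auto
    moreover have "(\<lambda>n. reg_yukawa (\<epsilon> n) s p x) \<longlonglongrightarrow> yukawa s p x"
      by (rule reg_yukawa_tendsto[OF that(1) \<epsilon>0])
    ultimately have "(\<lambda>n. h n x) \<longlonglongrightarrow> 1 * (yukawa s p x * (\<Prod>j\<in>(UNIV :: 'm set). 1))"
      unfolding h_def by (intro tendsto_mult cutoff_tendsto_1)
    then show ?thesis by simp
  qed
  have 4: "\<bar>h n x\<bar> \<le> \<bar>yukawa s p x\<bar>" if "x \<noteq> p" for n x
  proof -
    have "0 \<le> (\<Prod>j\<in>UNIV. w n j x)" "(\<Prod>j\<in>UNIV. w n j x) \<le> 1"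
      using wb by (auto intro: prod_nonneg prod_le_1)
    then have "\<bar>cutoff n x\<bar> * (\<bar>reg_yukawa (\<epsilon> n) s p x\<bar> * \<bar>\<Prod>j\<in>UNIV. w n j x\<bar>) \<le> 1 * (\<bar>yukawa s p x\<bar> * 1)"
      using cutoff_bounds[of n x] reg_yukawa_le[OF s \<epsilon> that]
      by (intro mult_mono) auto
    then show ?thesis by (simp add: h_def abs_mult)
  qed
  show ?thesis using that[of h] 1 2 3 4 by blast
qed

text \<open>Subtracting \<open>\<Sum>\<^sub>j \<xi>\<^sub>0\<^sub>j G\<^sub>j\<close> from \<open>f\<close> leaves \<open>U \<in> W\<^sub>2\<^sup>2\<close>. As \<open>f\<close> is in the domain of the adjoint,
  \<open>s\<^sup>2 U - \<Delta>U\<close> is orthogonal to all test functions vanishing at the points. These approximate the Yukawa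
  potential at any point \<open>p\<close>, so Green's formula gives \<open>U(p) = 0\<close>.\<close>

lemma eigenfunction_imp_kernel:
  fixes X :: "'m::finite \<Rightarrow> real^3"
  assumes X: "inj X" and s: "s > 0" and f: "f \<in> eigenspace (H3 \<alpha> X) (- s\<^sup>2)"
  obtains c where "krein_mat \<alpha> X s *v c = 0" "AE x in lborel. f x = yukawa_sum s X c x"
proof -
  from f obtain g0 g1 where adj: "(f, \<lambda>x. of_real (- s\<^sup>2) * f x) \<in> adjoint_op (op_H X)"
    and b: "boundary_values X f g0 g1" and g1: "g1 = B_mat \<alpha> *v g0"
    unfolding eigenspace_def H3_def by auto
  from adj have fL: "f \<in> L2" by (simp add: adjoint_op_def)
  from b obtain c \<xi> fH where fH: "fH \<in> dom_H X" "continuous_on UNIV fH"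
    and fd: "AE x in lborel. f x = decomp X c \<xi> fH x"
    and g0: "g0 = (\<chi> j. of_real (4 * pi) * c $ j)"
    and lim: "\<And>j. ((\<lambda>x. decomp X c \<xi> fH x - c $ j / of_real (dist x (X j))) \<longlongrightarrow> g1 $ j) (at (X j))"
    unfolding boundary_values_def by blast
  \<comment> \<open>The difference of the decomposition and the sum of Yukawa potentials with the same poles.\<close>
  define U where "U x = fH x + ((\<Sum>j\<in>UNIV. \<xi> $ j * of_real (exp (- dist x (X j)))) 
     + (\<Sum>j\<in>UNIV. (- c $ j) * of_real (yukawa_diff s 1 (X j) x)))" for x
  have fHW: "fH \<in> W2 2" using fH(1) by (simp add: dom_H_def)
  have UW: "U \<in> W2 2" unfolding U_def[abs_def]
    by (intro W22_add W22_sum W22_cmult yukawa_diff_W22 exp_dist1_W22 s zero_less_one fHW)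
  have UL: "U \<in> L2" by (rule W22_L2[OF UW])
  have Uc: "continuous_on UNIV U" unfolding U_def
    by (intro continuous_intros continuous_on_of_real continuous_yukawa_diff fH(2))
  have dec: "decomp X c \<xi> fH x = yukawa_sum s X c x + U x" if "x \<notin> range X" for x
  proof -
    have "x \<noteq> X j" for j using that by auto
    then show ?thesis 
      by (simp add: decomp_yukawa U_def yukawa_diff_def yukawa_sum_def sum.distrib sum_subtractf sum_negf algebra_simps)
  qed
  have fU: "AE x in lborel. f x = yukawa_sum s X c x + U x"
    using fd AE_not_in_range[of X] by eventually_elim (simp add: dec)
  obtain V where VL: "V \<in> L2" and V: "has_laplacian U V" using W22_has_laplacian[OF UW] by blast
  let ?W = "\<lambda>x. of_real (s\<^sup>2) * U x - V x"
  have WL: "?W \<in> L2" by (intro L2_diff L2_cmult UL VL)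
  have yL: "yukawa_sum s X c \<in> L2" by (rule yukawa_sum_L2[OF s])
  have test: "(\<integral>x. of_real (h x) * ?W x \<partial>lborel) = 0" if h: "test_function h" "\<And>j. h (X j) = 0" for h
  proof -
    let ?l = "\<lambda>x. complex_of_real (laplacian h x)" and ?h = "\<lambda>x. complex_of_real (h x)"
    have lL: "?l \<in> L2"
      unfolding laplacian_def of_real_sum by (intro L2_sum L2_test_function test_function_partial h)
    have hL: "?h \<in> L2" by (rule L2_test_function[OF h(1)])
    have "?h \<in> dom_H X" unfolding dom_H_def
      using test_function_W22[OF h(1)] h(2) smooth_continuous[OF test_function_smooth[OF h(1)]]
      by (auto intro!: exI[of _ ?h] continuous_on_of_real)
    then have "(?h, \<lambda>x. - ?l x) \<in> op_H X"
      using L2_uminus[OF lL] test_function_has_laplacian[OF h(1)] by (simp add: op_H_def)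
    then have "L2_inner (\<lambda>x. - ?l x) f = L2_inner ?h (\<lambda>x. of_real (- s\<^sup>2) * f x)"
      using adj by (auto simp: adjoint_op_def)
    then have "cnj (L2_inner (\<lambda>x. - ?l x) f) = cnj (L2_inner ?h (\<lambda>x. of_real (- s\<^sup>2) * f x))" by simp
    moreover have "cnj (L2_inner (\<lambda>x. - ?l x) f) = (\<integral>x. - (?l x * f x) \<partial>lborel)"
      unfolding L2_inner_def
      by (rule trans[OF Bochner_Integration.integral_cnj[symmetric]], rule Bochner_Integration.integral_cong) auto
    moreover have "cnj (L2_inner ?h (\<lambda>x. of_real (- s\<^sup>2) * f x)) = (\<integral>x. of_real (- s\<^sup>2) * (?h x * f x) \<partial>lborel)"
      unfolding L2_inner_def
      by (rule trans[OF Bochner_Integration.integral_cnj[symmetric]], rule Bochner_Integration.integral_cong) auto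
    ultimately have "(\<integral>x. - (?l x * f x) \<partial>lborel) = (\<integral>x. of_real (- s\<^sup>2) * (?h x * f x) \<partial>lborel)"
      by simp
    then have lf: "(\<integral>x. ?l x * f x \<partial>lborel) = of_real (s\<^sup>2) * (\<integral>x. ?h x * f x \<partial>lborel)"
      by simp
    define k where "k x = complex_of_real (s\<^sup>2 * h x - laplacian h x)" for x
    have k: "k x = of_real (s\<^sup>2) * ?h x - ?l x" for x by (simp add: k_def)
    have kL: "k \<in> L2" unfolding k[abs_def] by (intro L2_diff L2_cmult hL lL)
    have kint: "(\<integral>x. k x * y x \<partial>lborel) = of_real (s\<^sup>2) * (\<integral>x. ?h x * y x \<partial>lborel) - (\<integral>x. ?l x * y x \<partial>lborel)"
      if "y \<in> L2" for y
    proof -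
      have "(\<integral>x. k x * y x \<partial>lborel) = (\<integral>x. of_real (s\<^sup>2) * (?h x * y x) - ?l x * y x \<partial>lborel)"
        by (simp add: k left_diff_distrib mult.assoc)
      then show ?thesis using L2_mult_integrable[OF hL that] L2_mult_integrable[OF lL that] by simp
    qed
    have 1: "(\<integral>x. k x * f x \<partial>lborel) = 0" using kint[OF fL] lf by simp
    have 2: "(\<integral>x. k x * yukawa_sum s X c x \<partial>lborel) = 0"
    proof -
      have g: "(\<integral>x. of_real (yukawa s (X j) x) * k x \<partial>lborel) = 0" for j
        unfolding k_def using green_test_function[OF s h(1), of "X j"] h(2) by simp
      have int: "integrable lborel (\<lambda>x. of_real (yukawa s (X j) x) * k x)" for j
        by (intro L2_mult_integrable yukawa_L2 s kL)
      have "(\<integral>x. k x * yukawa_sum s X c x \<partial>lborel) = (\<integral>x. (\<Sum>j\<in>UNIV. c $ j * (of_real (yukawa s (X j) x) * k x)) \<partial>lborel)"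
        by (simp add: yukawa_sum_def sum_distrib_left mult_ac)
      also have "\<dots> = 0" using int g by simp
      finally show ?thesis .
    qed
    have "(\<integral>x. k x * f x \<partial>lborel) = (\<integral>x. k x * yukawa_sum s X c x + k x * U x \<partial>lborel)"
    proof (rule integral_cong_AE)
      have [measurable]: "k \<in> borel_measurable borel" "f \<in> borel_measurable borel" "U \<in> borel_measurable borel"
        "yukawa_sum s X c \<in> borel_measurable borel" using kL fL UL yL L2_measurable by auto
      show "(\<lambda>x. k x * f x) \<in> borel_measurable lborel"
        "(\<lambda>x. k x * yukawa_sum s X c x + k x * U x) \<in> borel_measurable lborel" by measurable
      show "AE x in lborel. k x * f x = k x * yukawa_sum s X c x + k x * U x"
        using fU by eventually_elim (simp add: distrib_left)
    qed
    also have "\<dots> = (\<integral>x. k x * yukawa_sum s X c x \<partial>lborel) + (\<integral>x. k x * U x \<partial>lborel)"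
      by (intro Bochner_Integration.integral_add L2_mult_integrable kL yL UL)
    finally have "(\<integral>x. k x * U x \<partial>lborel) = 0" using 1 2 by simp
    then have "of_real (s\<^sup>2) * (\<integral>x. ?h x * U x \<partial>lborel) - (\<integral>x. ?l x * U x \<partial>lborel) = 0"
      using kint[OF UL] by simp
    also have "(\<integral>x. ?l x * U x \<partial>lborel) = (\<integral>x. ?h x * V x \<partial>lborel)"
      by (intro has_laplacian_L2_test V VL test_function_smooth L2_test_function test_function_partial h)
    finally have "(\<integral>x. of_real (s\<^sup>2) * (?h x * U x) - ?h x * V x \<partial>lborel) = 0"
      using L2_mult_integrable[OF hL UL] L2_mult_integrable[OF hL VL] by simp
    then show ?thesis by (simp add: algebra_simps)
  qed
  have "U p = 0" for p
  proof -
    obtain h where h: "\<And>n. test_function (h n)" "\<And>n j. h n (X j) = 0"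
      "\<And>x. x \<noteq> p \<Longrightarrow> x \<notin> range X \<Longrightarrow> (\<lambda>n. h n x) \<longlonglongrightarrow> yukawa s p x"
      "\<And>n x. x \<noteq> p \<Longrightarrow> \<bar>h n x\<bar> \<le> \<bar>yukawa s p x\<bar>"
      using yukawa_approximation[OF s, of X p] by blast
    have [measurable]: "?W \<in> borel_measurable borel" by (rule L2_measurable[OF WL])
    have [measurable]: "h n \<in> borel_measurable borel" for n
      by (rule smooth_measurable[OF test_function_smooth[OF h(1)]])
    have "(\<lambda>n. \<integral>x. of_real (h n x) * ?W x \<partial>lborel) \<longlonglongrightarrow> (\<integral>x. of_real (yukawa s p x) * ?W x \<partial>lborel)"
    proof (rule integral_dominated_convergence[where w = "\<lambda>x. cmod (of_real (yukawa s p x) * ?W x)"])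
      show "integrable lborel (\<lambda>x. cmod (of_real (yukawa s p x) * ?W x))"
        using L2_mult_integrable[OF yukawa_L2[OF s] WL] by (rule integrable_norm)
      show "AE x in lborel. (\<lambda>n. of_real (h n x) * ?W x) \<longlonglongrightarrow> of_real (yukawa s p x) * ?W x"
        using AE_lborel_singleton[of p] AE_not_in_range[of X]
        by eventually_elim (intro tendsto_mult tendsto_of_real tendsto_const h(3))
      show "AE x in lborel. cmod (of_real (h n x) * ?W x) \<le> cmod (of_real (yukawa s p x) * ?W x)" for n
        using AE_lborel_singleton[of p]
      proof eventually_elim
        case (elim x)
        then show ?case unfolding norm_mult norm_of_real by (intro mult_right_mono h(4)) auto
      qed
    qed measurable
    then have "(\<integral>x. of_real (yukawa s p x) * ?W x \<partial>lborel) = 0"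
      by (simp only: test[OF h(1,2)] LIMSEQ_const_iff)
    then show ?thesis
      using green_formula[OF s UL VL V Uc, of p] green_const_pos by simp
  qed
  then have fy: "AE x in lborel. f x = yukawa_sum s X c x" and dy: "\<And>x. x \<notin> range X \<Longrightarrow> decomp X c \<xi> fH x = yukawa_sum s X c x"
    using fU dec by simp_all
  have "(krein_mat \<alpha> X s *v c) $ k = 0" for k
  proof -
    have "((\<lambda>x. yukawa_sum s X c x - c $ k / of_real (dist x (X k))) \<longlongrightarrow> g1 $ k) (at (X k))"
      by (rule Lim_transform_eventually[OF lim])
        (use eventually_not_in_range[OF X, of k] in \<open>auto elim!: eventually_mono simp: dy\<close>)
    from tendsto_unique[OF _ this yukawa_sum_boundary[OF X, of s c k \<alpha>]]
    have "g1 $ k = of_real (4 * pi * \<alpha> k) * c $ k - (krein_mat \<alpha> X s *v c) $ k" by simp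
    then show ?thesis by (simp add: g1 g0 B_mat_mult)
  qed
  then have "krein_mat \<alpha> X s *v c = 0" by (simp add: vec_eq_iff)
  then show ?thesis using fy that by blast
qed

section \<open>Counting singular members of a family of Hermitian matrices\<close>

definition sesq :: "complex^'n^'n \<Rightarrow> complex^'n \<Rightarrow> complex^'n \<Rightarrow> complex" where
  "sesq A x y = (\<Sum>i\<in>UNIV. (A *v x) $ i * cnj (y $ i))"

definition quad :: "complex^'n^'n \<Rightarrow> complex^'n \<Rightarrow> real" where
  "quad A x = Re (sesq A x x)"

definition hermitian :: "complex^'n^'n \<Rightarrow> bool" where
  "hermitian A \<longleftrightarrow> (\<forall>i j. A $ i $ j = cnj (A $ j $ i))"

definition posdef_on :: "complex^'n^'n \<Rightarrow> (complex^'n) set \<Rightarrow> bool" where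
  "posdef_on A V \<longleftrightarrow> (\<forall>x\<in>V. x \<noteq> 0 \<longrightarrow> quad A x > 0)"

definition negdef_on :: "complex^'n^'n \<Rightarrow> (complex^'n) set \<Rightarrow> bool" where
  "negdef_on A V \<longleftrightarrow> (\<forall>x\<in>V. x \<noteq> 0 \<longrightarrow> quad A x < 0)"

definition null_space :: "complex^'n^'n \<Rightarrow> (complex^'n) set" where
  "null_space A = {x. A *v x = 0}"

lemma sesq_expand: "sesq A x y = (\<Sum>i\<in>UNIV. \<Sum>j\<in>UNIV. A $ i $ j * x $ j * cnj (y $ i))"
  by (simp add: sesq_def matrix_vector_mult_def sum_distrib_right)

lemma sesq_add_left: "sesq A (x + y) z = sesq A x z + sesq A y z"
  by (simp add: sesq_def matrix_vector_right_distrib distrib_right sum.distrib)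

lemma sesq_diff_left: "sesq A (x - y) z = sesq A x z - sesq A y z"
  by (simp add: sesq_expand right_diff_distrib left_diff_distrib sum_subtractf)

lemma sesq_add_right: "sesq A z (x + y) = sesq A z x + sesq A z y"
  by (simp add: sesq_def distrib_left sum.distrib)

lemma sesq_cmult_left: "sesq A (c *s x) z = c * sesq A x z"
  by (simp add: sesq_def vec.scale mult.assoc sum_distrib_left)

lemma sesq_cmult_right: "sesq A z (c *s x) = cnj c * sesq A z x"
  by (simp add: sesq_def sum_distrib_left mult_ac)

lemma sesq_zero_left [simp]: "sesq A 0 z = 0"
  by (simp add: sesq_def)

lemma sesq_zero_right [simp]: "sesq A z 0 = 0"
  by (simp add: sesq_def)

lemma sesq_sum_left: "sesq A (\<Sum>b\<in>S. f b) z = (\<Sum>b\<in>S. sesq A (f b) z)"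
  by (induction S rule: infinite_finite_induct) (auto simp: sesq_add_left)

lemma sesq_sum_right: "sesq A z (\<Sum>b\<in>S. f b) = (\<Sum>b\<in>S. sesq A z (f b))"
  by (induction S rule: infinite_finite_induct) (auto simp: sesq_add_right)

lemma sesq_commute: assumes "hermitian A" shows "sesq A y x = cnj (sesq A x y)"
proof -
  have "cnj (A $ i $ j) = A $ j $ i" for i j using assms unfolding hermitian_def by metis
  then have "cnj (sesq A x y) = (\<Sum>i\<in>UNIV. \<Sum>j\<in>UNIV. A $ j $ i * cnj (x $ j) * y $ i)"
    by (simp add: sesq_expand)
  also have "\<dots> = (\<Sum>j\<in>UNIV. \<Sum>i\<in>UNIV. A $ j $ i * cnj (x $ j) * y $ i)" by (rule sum.swap)
  finally show ?thesis by (simp add: sesq_expand mult_ac)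
qed

lemma sesq_self: assumes "hermitian A" shows "sesq A x x = of_real (quad A x)"
proof -
  have "Im (sesq A x x) = 0" using arg_cong[OF sesq_commute[OF assms, of x x], of Im] by simp
  then show ?thesis by (simp add: complex_eq_iff quad_def)
qed

lemma quad_add: 
  assumes "hermitian A" shows "quad A (x + y) = quad A x + quad A y + 2 * Re (sesq A x y)"
  using sesq_commute[OF assms, of y x] 
  by (simp add: quad_def sesq_add_left sesq_add_right)

lemma null_space_sesq: "x \<in> null_space A \<Longrightarrow> sesq A x y = 0"
  by (simp add: null_space_def sesq_def)

lemma sesq_null_space: assumes "\<And>y. sesq A x y = 0" shows "x \<in> null_space A"
proof -
  have "(A *v x) $ i = 0" for i
  proof -
    have "(\<Sum>k\<in>UNIV. (A *v x) $ k * cnj (axis i 1 $ k)) = (\<Sum>k\<in>UNIV. if k = i then (A *v x) $ k else 0)"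
      by (intro sum.cong) (auto simp: axis_def)
    then show ?thesis using assms[of "axis i 1"] unfolding sesq_def by simp
  qed
  then show ?thesis by (simp add: null_space_def vec_eq_iff)
qed

lemma subspace_null_space: "vec.subspace (null_space A)"
  unfolding null_space_def by (rule vec.subspaceI) (auto simp: matrix_vector_right_distrib vec.scale)

text \<open>Sylvester's argument: either the form vanishes on \<open>W\<close>, by polarisation, or a non-isotropic vector
  can be split off.\<close>

lemma orthogonal_basis_exists:
  assumes A: "hermitian A" and W: "vec.subspace W"
  obtains B where "finite B" "vec.independent B" "vec.span B = W" 
    "\<And>x y. x \<in> B \<Longrightarrow> y \<in> B \<Longrightarrow> x \<noteq> y \<Longrightarrow> sesq A x y = 0"
proof -
  have "\<exists>B. finite B \<and> vec.independent B \<and> vec.span B = W \<and> (\<forall>x\<in>B. \<forall>y\<in>B. x \<noteq> y \<longrightarrow> sesq A x y = 0)"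
    using W
  proof (induction "vec.dim W" arbitrary: W rule: less_induct)
    case (less W)
    show ?case
    proof (cases "\<forall>w\<in>W. quad A w = 0")
      case True
      have z: "sesq A x y = 0" if "x \<in> W" "y \<in> W" for x y
      proof -
        have "x + y \<in> W" "\<i> *s y \<in> W" "x + \<i> *s y \<in> W"
          using that less.prems by (auto intro: vec.subspace_add vec.subspace_scale)
        then have "Re (sesq A x y) = 0" "Re (sesq A x (\<i> *s y)) = 0"
          using quad_add[OF A, of x y] quad_add[OF A, of x "\<i> *s y"] True that by auto
        then show ?thesis by (simp add: sesq_cmult_right complex_eq_iff)
      qed
      obtain B where B: "B \<subseteq> W" "vec.independent B" "W \<subseteq> vec.span B" "card B = vec.dim W"
        by (rule vec.basis_exists)
      have "vec.span B = W" by (intro equalityI vec.span_minimal B less.prems)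
      moreover have "finite B" by (rule vec.finiteI_independent[OF B(2)])
      moreover have "sesq A x y = 0" if "x \<in> B" "y \<in> B" for x y using z B(1) that by blast
      ultimately show ?thesis using B(2) by (intro exI[of _ B]) simp
    next
      case False
      then obtain w where w: "w \<in> W" "quad A w \<noteq> 0" by blast
      have ww: "sesq A w w \<noteq> 0" using w(2) by (auto simp: quad_def)
      define W' where "W' = {x \<in> W. sesq A x w = 0}"
      have sub: "vec.subspace W'"
        using less.prems unfolding W'_def
        by (intro vec.subspaceI) (auto simp: sesq_add_left sesq_cmult_left 
            intro: vec.subspace_add vec.subspace_scale vec.subspace_0)
      have "w \<notin> W'" using ww by (simp add: W'_def)
      then have "W' \<subset> W" using w by (auto simp: W'_def)
      then have "vec.dim W' < vec.dim W"
        using vec.dim_psubset[of W' W] vec.span_eq_iff[of W'] vec.span_eq_iff[of W] sub less.prems by metis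
      from less.hyps[OF this sub] obtain B where B: "finite B" "vec.independent B" "vec.span B = W'"
        "\<forall>x\<in>B. \<forall>y\<in>B. x \<noteq> y \<longrightarrow> sesq A x y = 0" by blast
      have BW: "B \<subseteq> W'" using B(3) vec.span_superset by blast
      have orth: "sesq A x w = 0" "sesq A w x = 0" if "x \<in> B" for x
      proof -
        show "sesq A x w = 0" using that BW by (auto simp: W'_def)
        then show "sesq A w x = 0" using sesq_commute[OF A, of w x] by simp
      qed
      have "vec.independent (insert w B)" using B \<open>w \<notin> W'\<close> by (intro vec.independent_insertI) auto
      moreover have "vec.span (insert w B) = W"
      proof
        have "insert w B \<subseteq> W" using w BW by (auto simp: W'_def)
        then show "vec.span (insert w B) \<subseteq> W" using less.prems by (rule vec.span_minimal)
        show "W \<subseteq> vec.span (insert w B)"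
        proof
          fix x assume x: "x \<in> W"
          let ?k = "sesq A x w / sesq A w w"
          have "x - ?k *s w \<in> W"
            by (intro vec.subspace_diff vec.subspace_scale less.prems x w(1))
          moreover have "sesq A (x - ?k *s w) w = 0"
            using ww by (simp add: sesq_diff_left sesq_cmult_left)
          ultimately have "x - ?k *s w \<in> vec.span B" using B(3) by (simp add: W'_def)
          then show "x \<in> vec.span (insert w B)"
            unfolding vec.span_insert by blast
        qed
      qed
      ultimately show ?thesis using B orth
        by (intro exI[of _ "insert w B"]) auto
    qed
  qed
  then show ?thesis using that by blast
qed

lemma quad_orthogonal_sum:
  assumes A: "hermitian A" and S: "finite S" and orth: "\<And>x y. x \<in> S \<Longrightarrow> y \<in> S \<Longrightarrow> x \<noteq> y \<Longrightarrow> sesq A x y = 0"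
  shows "quad A (\<Sum>b\<in>S. u b *s b) = (\<Sum>b\<in>S. (cmod (u b))\<^sup>2 * quad A b)"
proof -
  have "sesq A (\<Sum>b\<in>S. u b *s b) (\<Sum>b\<in>S. u b *s b) = (\<Sum>b\<in>S. \<Sum>c\<in>S. u b * cnj (u c) * sesq A b c)"
    by (simp add: sesq_sum_left sesq_sum_right sesq_cmult_left sesq_cmult_right sum_distrib_left mult_ac)
      (rule sum.swap)
  also have "\<dots> = (\<Sum>b\<in>S. \<Sum>c\<in>S. if c = b then u b * cnj (u b) * sesq A b b else 0)"
    using orth by (intro sum.cong refl) auto
  also have "\<dots> = (\<Sum>b\<in>S. u b * cnj (u b) * sesq A b b)" using S by simp
  also have "\<dots> = (\<Sum>b\<in>S. of_real ((cmod (u b))\<^sup>2 * quad A b))"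
    by (intro sum.cong refl) (simp add: sesq_self[OF A] complex_norm_square[symmetric])
  finally show ?thesis unfolding quad_def[of A "\<Sum>b\<in>S. u b *s b"] by (simp flip: of_real_sum)
qed

lemma span_finite_cases:
  assumes "finite S" "x \<in> vec.span S" "x \<noteq> (0::complex^'n)"
  obtains u b where "x = (\<Sum>b\<in>S. u b *s b)" "b \<in> S" "u b \<noteq> 0"
proof -
  obtain u where u: "x = (\<Sum>b\<in>S. u b *s b)" using assms(2) vec.span_finite[OF assms(1)] by auto
  moreover have "\<exists>b\<in>S. u b \<noteq> 0"
  proof (rule ccontr)
    assume "\<not> ?thesis"
    then have "x = 0" unfolding u by (intro sum.neutral) auto
    then show False using assms(3) by simp
  qed
  ultimately show ?thesis using that by blast
qed

lemma definite_span:
  assumes A: "hermitian A" and S: "finite S" and orth: "\<And>x y. x \<in> S \<Longrightarrow> y \<in> S \<Longrightarrow> x \<noteq> y \<Longrightarrow> sesq A x y = 0"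
  shows "(\<And>b. b \<in> S \<Longrightarrow> quad A b > 0) \<Longrightarrow> posdef_on A (vec.span S)"
    and "(\<And>b. b \<in> S \<Longrightarrow> quad A b < 0) \<Longrightarrow> negdef_on A (vec.span S)"
proof -
  have q: "quad A (\<Sum>b\<in>S. u b *s b) = (\<Sum>b\<in>S. (cmod (u b))\<^sup>2 * quad A b)" for u
    by (rule quad_orthogonal_sum[OF A S]) (rule orth)
  show "posdef_on A (vec.span S)" if p: "\<And>b. b \<in> S \<Longrightarrow> quad A b > 0"
    unfolding posdef_on_def
  proof (intro ballI impI)
    fix x assume "x \<in> vec.span S" "x \<noteq> 0"
    then obtain u b where ub: "x = (\<Sum>b\<in>S. u b *s b)" "b \<in> S" "u b \<noteq> 0"
      using span_finite_cases[OF S] by blast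
    have "0 < (\<Sum>b\<in>S. (cmod (u b))\<^sup>2 * quad A b)"
      using p ub(2,3) by (intro sum_pos2[OF S ub(2)] mult_pos_pos mult_nonneg_nonneg) (auto intro: less_imp_le)
    then show "quad A x > 0" unfolding q[of u, folded ub(1)] .
  qed
  show "negdef_on A (vec.span S)" if p: "\<And>b. b \<in> S \<Longrightarrow> quad A b < 0"
    unfolding negdef_on_def
  proof (intro ballI impI)
    fix x assume "x \<in> vec.span S" "x \<noteq> 0"
    then obtain u b where ub: "x = (\<Sum>b\<in>S. u b *s b)" "b \<in> S" "u b \<noteq> 0"
      using span_finite_cases[OF S] by blast
    have "0 < (\<Sum>b\<in>S. (cmod (u b))\<^sup>2 * (- quad A b))"
      using p ub(2,3) by (intro sum_pos2[OF S ub(2)] mult_pos_pos mult_nonneg_nonneg) (auto intro: less_imp_le)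
    then have "(\<Sum>b\<in>S. (cmod (u b))\<^sup>2 * quad A b) < 0" by (simp add: sum_negf)
    then show "quad A x < 0" unfolding q[of u, folded ub(1)] .
  qed
qed

text \<open>Split an orthogonal basis according to the sign of the form; its isotropic members lie in the null
  space, being orthogonal to the whole basis.\<close>

lemma inertia:
  fixes A :: "complex^'n^'n"
  assumes A: "hermitian A"
  obtains V P z where "vec.subspace V" "negdef_on A V" "vec.subspace P" "posdef_on A P"
    "vec.dim V + z + vec.dim P = CARD('n)" "z \<le> vec.dim (null_space A)"
proof -
  obtain B where B: "finite B" "vec.independent B" "vec.span B = (UNIV :: (complex^'n) set)"
    and orth: "\<And>x y. x \<in> B \<Longrightarrow> y \<in> B \<Longrightarrow> x \<noteq> y \<Longrightarrow> sesq A x y = 0"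
    using orthogonal_basis_exists[OF A vec.subspace_UNIV] by blast
  define N Z P where "N = {b\<in>B. quad A b < 0}" and "Z = {b\<in>B. quad A b = 0}" and "P = {b\<in>B. quad A b > 0}"
  have fin: "finite N" "finite Z" "finite P" using B by (auto simp: N_def Z_def P_def)
  have ind: "vec.independent N" "vec.independent Z" "vec.independent P" 
    by (rule vec.independent_mono[OF B(2)], force simp: N_def Z_def P_def)+
  have "card (N \<union> Z) = card N + card Z"
    by (rule card_Un_disjoint[OF fin(1,2)]) (auto simp: N_def Z_def)
  moreover have "card (N \<union> Z \<union> P) = card (N \<union> Z) + card P"
    by (rule card_Un_disjoint) (use fin in \<open>auto simp: N_def Z_def P_def\<close>)
  moreover have "B = N \<union> Z \<union> P" by (auto simp: N_def Z_def P_def)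
  ultimately have "card B = card N + card Z + card P" by simp
  moreover have "card B = CARD('n)" 
    using vec.dim_eq_card[of B UNIV] B by (simp add: card_cart_basis)
  ultimately have cards: "vec.dim (vec.span N) + card Z + vec.dim (vec.span P) = CARD('n)"
    using ind by (simp add: vec.dim_eq_card_independent)
  have "Z \<subseteq> null_space A"
  proof
    fix b assume b: "b \<in> Z"
    have z: "sesq A b y = 0" if "y \<in> B" for y
      using orth[of b y] that b sesq_self[OF A, of b] by (cases "b = y") (auto simp: Z_def)
    show "b \<in> null_space A"
    proof (rule sesq_null_space)
      fix y
      have "y \<in> vec.span B" using B(3) by simp
      then obtain u where "y = (\<Sum>b\<in>B. u b *s b)" using vec.span_finite[OF B(1)] by auto
      then show "sesq A b y = 0" using z by (simp add: sesq_sum_right sesq_cmult_right)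
    qed
  qed
  then have "card Z \<le> vec.dim (null_space A)" using ind(2) by (rule vec.independent_card_le_dim)
  moreover have "negdef_on A (vec.span N)" "posdef_on A (vec.span P)"
    by (rule definite_span(2)[OF A fin(1)]; use orth in \<open>auto simp: N_def\<close>)
      (rule definite_span(1)[OF A fin(3)]; use orth in \<open>auto simp: P_def\<close>)
  ultimately show ?thesis using that[of "vec.span N" "vec.span P" "card Z"] cards vec.subspace_span by blast
qed

lemma dim_disjoint_le:
  fixes V W :: "(complex^'n) set"
  assumes "vec.subspace V" "vec.subspace W" "V \<inter> W \<subseteq> {0}"
  shows "vec.dim V + vec.dim W \<le> CARD('n)"
proof -
  have "vec.dim (V \<inter> W) = 0" using assms(3) by simp
  then have "vec.dim V + vec.dim W = vec.dim {x + y |x y. x \<in> V \<and> y \<in> W}"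
    using vec.dim_sums_Int[OF assms(1,2)] by linarith
  also have "\<dots> \<le> CARD('n)" by (rule dim_subset_UNIV_cart_gen)
  finally show ?thesis .
qed

lemma neg_pos_disjoint: 
  assumes "negdef_on A V" "posdef_on A W" shows "V \<inter> W \<subseteq> {0}"
proof
  fix x assume "x \<in> V \<inter> W"
  then have "x \<noteq> 0 \<Longrightarrow> quad A x < 0 \<and> quad A x > 0"
    using assms by (simp add: negdef_on_def posdef_on_def)
  then show "x \<in> {0}" by fastforce
qed

lemma quad_diff_bound:
  fixes A B :: "complex^'n^'n"
  assumes "norm x = 1"
  shows "\<bar>quad A x - quad B x\<bar> \<le> (\<Sum>i\<in>UNIV. \<Sum>j\<in>UNIV. cmod (A $ i $ j - B $ i $ j))"
proof -
  have x: "cmod (x $ i) \<le> 1" for i using Finite_Cartesian_Product.norm_nth_le[of x i] assms by simp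
  have "quad A x - quad B x = Re (\<Sum>i\<in>UNIV. \<Sum>j\<in>UNIV. (A $ i $ j - B $ i $ j) * x $ j * cnj (x $ i))"
    by (simp add: quad_def sesq_expand left_diff_distrib sum_subtractf)
  also have "\<bar>\<dots>\<bar> \<le> cmod (\<Sum>i\<in>UNIV. \<Sum>j\<in>UNIV. (A $ i $ j - B $ i $ j) * x $ j * cnj (x $ i))"
    by (rule abs_Re_le_cmod)
  also have "\<dots> \<le> (\<Sum>i\<in>UNIV. \<Sum>j\<in>UNIV. cmod ((A $ i $ j - B $ i $ j) * x $ j * cnj (x $ i)))"
    by (intro order_trans[OF norm_sum] sum_mono norm_sum)
  also have "\<dots> \<le> (\<Sum>i\<in>UNIV. \<Sum>j\<in>UNIV. cmod (A $ i $ j - B $ i $ j))"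
  proof (intro sum_mono)
    fix i j
    have "cmod (A $ i $ j - B $ i $ j) * cmod (x $ j) * cmod (x $ i) \<le> cmod (A $ i $ j - B $ i $ j) * 1 * 1"
      using x by (intro mult_mono) auto
    then show "cmod ((A $ i $ j - B $ i $ j) * x $ j * cnj (x $ i)) \<le> cmod (A $ i $ j - B $ i $ j)"
      by (simp add: norm_mult)
  qed
  finally show ?thesis .
qed

lemma quad_scale: "quad A (of_real r *s x) = r\<^sup>2 * quad A x"
  by (simp add: quad_def sesq_cmult_left sesq_cmult_right power2_eq_square flip: of_real_mult)

lemma continuous_quad: "continuous_on UNIV (quad A)"
  unfolding quad_def sesq_expand by (intro continuous_intros)

lemma closed_vec_subspace: assumes "vec.subspace (V :: (complex^'n) set)" shows "closed V"
proof -
  have "c *\<^sub>R x \<in> V" if "x \<in> V" for c x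
  proof -
    have "c *\<^sub>R x = of_real c *s x" by (simp add: vec_eq_iff) (simp add: scaleR_conv_of_real)
    then show ?thesis using vec.subspace_scale[OF assms that] by simp
  qed
  then have "subspace V" using assms by (auto simp: subspace_def vec.subspace_def)
  then show ?thesis by (rule closed_subspace)
qed

text \<open>By compactness the form is bounded away from zero on the unit sphere of the subspace.\<close>

lemma posdef_open:
  fixes Q :: "real \<Rightarrow> complex^'n^'n"
  assumes V: "vec.subspace V" and p: "posdef_on (Q s) V" and s: "s \<ge> 0"
    and c: "\<And>i j. continuous_on {0..} (\<lambda>s. Q s $ i $ j)"
  obtains \<delta> where "\<delta> > 0" "\<And>t. t \<ge> 0 \<Longrightarrow> \<bar>t - s\<bar> < \<delta> \<Longrightarrow> posdef_on (Q t) V"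
proof -
  let ?K = "V \<inter> sphere 0 1"
  have K: "compact ?K" using closed_vec_subspace[OF V] by (simp add: closed_Int_compact)
  obtain m where m: "m > 0" "\<And>x. x \<in> ?K \<Longrightarrow> quad (Q s) x \<ge> m"
  proof (cases "?K = {}")
    case True
    then show ?thesis using that[of 1] by auto
  next
    case False
    obtain y where y: "y \<in> ?K" "\<And>x. x \<in> ?K \<Longrightarrow> quad (Q s) y \<le> quad (Q s) x"
      using continuous_attains_inf[OF K False continuous_on_subset[OF continuous_quad]] by blast
    have "y \<noteq> 0" using y(1) by auto
    then have "quad (Q s) y > 0" using p y(1) by (auto simp: posdef_on_def)
    then show ?thesis using that y(2) by blast
  qed
  define e where "e t = (\<Sum>i\<in>UNIV. \<Sum>j\<in>UNIV. cmod (Q t $ i $ j - Q s $ i $ j))" for t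
  have "continuous_on {0..} e" unfolding e_def by (intro continuous_intros c)
  moreover have "e s = 0" by (simp add: e_def)
  ultimately obtain \<delta> where \<delta>: "\<delta> > 0" "\<And>t. t \<ge> 0 \<Longrightarrow> \<bar>t - s\<bar> < \<delta> \<Longrightarrow> \<bar>e t\<bar> < m"
    using s m(1) unfolding continuous_on_iff by (fastforce simp: dist_real_def)
  have "posdef_on (Q t) V" if t: "t \<ge> 0" "\<bar>t - s\<bar> < \<delta>" for t
    unfolding posdef_on_def
  proof (intro ballI impI)
    fix x assume x: "x \<in> V" "x \<noteq> 0"
    define y where "y = of_real (1 / norm x) *s x"
    have yR: "y = (1 / norm x) *\<^sub>R x" by (simp add: y_def vec_eq_iff) (simp add: scaleR_conv_of_real divide_inverse)
    have n: "norm y = 1" using x by (simp add: yR)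
    have "y \<in> V" unfolding y_def by (rule vec.subspace_scale[OF V x(1)])
    then have "quad (Q s) y \<ge> m" using m(2) n by simp
    moreover have "\<bar>quad (Q t) y - quad (Q s) y\<bar> < m"
      using quad_diff_bound[OF n, of "Q t" "Q s"] \<delta>(2)[OF t] unfolding e_def by linarith
    ultimately have "quad (Q t) y > 0" by linarith
    then show "quad (Q t) x > 0" unfolding y_def quad_scale by (simp add: zero_less_mult_iff)
  qed
  then show ?thesis using that \<delta>(1) by blast
qed

lemma quad_uminus: "quad (- A) x = - quad A x"
  by (simp add: quad_def sesq_expand sum_negf)

lemma negdef_open:
  fixes Q :: "real \<Rightarrow> complex^'n^'n"
  assumes V: "vec.subspace V" and p: "negdef_on (Q s) V" and s: "s \<ge> 0"
    and c: "\<And>i j. continuous_on {0..} (\<lambda>s. Q s $ i $ j)"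
  obtains \<delta> where "\<delta> > 0" "\<And>t. t \<ge> 0 \<Longrightarrow> \<bar>t - s\<bar> < \<delta> \<Longrightarrow> negdef_on (Q t) V"
proof -
  have eq: "posdef_on (- A) V \<longleftrightarrow> negdef_on A V" for A
    by (simp add: posdef_on_def negdef_on_def quad_uminus)
  have "posdef_on (- Q s) V" using p eq by blast
  moreover have "continuous_on {0..} (\<lambda>s. (- Q s) $ i $ j)" for i j by (simp add: continuous_on_minus c)
  ultimately obtain \<delta> where "\<delta> > 0" "\<And>t. t \<ge> 0 \<Longrightarrow> \<bar>t - s\<bar> < \<delta> \<Longrightarrow> posdef_on (- Q t) V"
    using posdef_open[where Q = "\<lambda>s. - Q s", OF V _ s] by blast
  then show ?thesis using that eq by blast
qed

text \<open>Lower bound: at the parameter up to which \<open>n\<close> negative directions survive, the loss of negative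
  directions is at most the dimension of the null space; continue from there by induction.\<close>

lemma negative_dim_le_null_spaces:
  fixes Q :: "real \<Rightarrow> complex^'n^'n"
  assumes herm: "\<And>s. hermitian (Q s)" 
    and c: "\<And>i j. continuous_on {0..} (\<lambda>s. Q s $ i $ j)"
    and pos: "\<And>s. s > T \<Longrightarrow> posdef_on (Q s) UNIV"
  shows "a \<ge> 0 \<Longrightarrow> vec.subspace V \<Longrightarrow> negdef_on (Q a) V \<Longrightarrow> 
    \<exists>F. finite F \<and> F \<subseteq> {a<..} \<and> vec.dim V \<le> (\<Sum>s\<in>F. vec.dim (null_space (Q s)))"
proof (induction "vec.dim V" arbitrary: a V rule: less_induct)
  case (less V a)
  define n where "n = vec.dim V"
  show ?case
  proof (cases "n = 0")
    case True
    then show ?thesis by (intro exI[of _ "{}"]) (simp add: n_def)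
  next
    case False
    \<comment> \<open>The parameters at which \<open>n\<close> negative directions are left. At the supremum \<open>s0\<close> fewer than \<open>n\<close>
      remain, and the null space accounts for the loss.\<close>
    define S where "S = {s. s \<ge> a \<and> (\<exists>V. vec.subspace V \<and> n \<le> vec.dim V \<and> negdef_on (Q s) V)}"
    have aS: "a \<in> S" unfolding S_def n_def using less.prems by blast
    have bound: "s \<le> T" if sS: "s \<in> S" for s
    proof (rule ccontr)
      assume "\<not> s \<le> T"
      then have p: "posdef_on (Q s) UNIV" by (intro pos) simp
      obtain V where V: "n \<le> vec.dim V" "negdef_on (Q s) V" using sS unfolding S_def by blast
      have "V \<subseteq> {0}" using neg_pos_disjoint[OF V(2) p] by simp
      then have "vec.dim V = 0" by simp
      then show False using V(1) False by linarith
    qed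
    have bdd: "bdd_above S" by (rule bdd_aboveI[where M = T]) (rule bound)
    define s0 where "s0 = Sup S"
    have s0: "s \<le> s0" if "s \<in> S" for s unfolding s0_def using that bdd by (rule cSup_upper)
    have above: "t \<in> S" if "\<delta> > 0" "a \<le> s" "vec.subspace V'" "n \<le> vec.dim V'"
       "\<And>t. t \<ge> 0 \<Longrightarrow> \<bar>t - s\<bar> < \<delta> \<Longrightarrow> negdef_on (Q t) V'" "t = s + \<delta> / 2" for s \<delta> V' t
      using that less.prems(1) unfolding S_def by (auto intro!: exI[of _ V'])
    have as: "a < s0"
    proof -
      obtain \<delta> where \<delta>: "\<delta> > 0" "\<And>t. t \<ge> 0 \<Longrightarrow> \<bar>t - a\<bar> < \<delta> \<Longrightarrow> negdef_on (Q t) V"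
        using negdef_open[OF less.prems(2,3,1) c] by blast
      have "a + \<delta> / 2 \<in> S" by (rule above[OF \<delta>(1) order_refl less.prems(2) _ \<delta>(2) refl]) (auto simp: n_def)
      then show ?thesis using s0 \<delta>(1) by fastforce
    qed
    then have s00: "s0 \<ge> 0" using less.prems(1) by linarith
    obtain N P z where N: "vec.subspace N" "negdef_on (Q s0) N" and P: "vec.subspace P" "posdef_on (Q s0) P"
      and dims: "vec.dim N + z + vec.dim P = CARD('n)" and z: "z \<le> vec.dim (null_space (Q s0))"
      using inertia[OF herm[of s0]] by blast
    have Nn: "vec.dim N < n"
    proof (rule ccontr)
      assume "\<not> vec.dim N < n"
      then have nN: "n \<le> vec.dim N" by simp
      obtain \<delta> where \<delta>: "\<delta> > 0" "\<And>t. t \<ge> 0 \<Longrightarrow> \<bar>t - s0\<bar> < \<delta> \<Longrightarrow> negdef_on (Q t) N"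
        using negdef_open[OF N s00 c] by blast
      have "s0 + \<delta> / 2 \<in> S" by (rule above[OF \<delta>(1) less_imp_le[OF as] N(1) nN \<delta>(2) refl])
      then show False using s0 \<delta>(1) by fastforce
    qed
    have "n \<le> vec.dim N + z"
    proof -
      obtain \<delta> where \<delta>: "\<delta> > 0" "\<And>t. t \<ge> 0 \<Longrightarrow> \<bar>t - s0\<bar> < \<delta> \<Longrightarrow> posdef_on (Q t) P"
        using posdef_open[OF P s00 c] by blast
      have "s0 - \<delta> < Sup S" using \<delta>(1) by (simp add: s0_def)
      then obtain s where s: "s \<in> S" "s0 - \<delta> < s" using less_cSup_iff[of S] aS bdd by blast
      then obtain V' where V': "vec.subspace V'" "n \<le> vec.dim V'" "negdef_on (Q s) V'" "a \<le> s"
        by (auto simp: S_def)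
      have "posdef_on (Q s) P" using \<delta>(2)[of s] s s0[OF s(1)] V'(4) less.prems(1) by auto
      then have "vec.dim V' + vec.dim P \<le> CARD('n)"
        using dim_disjoint_le[OF V'(1) P(1) neg_pos_disjoint[OF V'(3)]] by blast
      then show ?thesis using V'(2) dims by linarith
    qed
    moreover obtain F where F: "finite F" "F \<subseteq> {s0<..}" "vec.dim N \<le> (\<Sum>s\<in>F. vec.dim (null_space (Q s)))"
      using less.hyps[OF Nn[unfolded n_def] s00 N] by blast
    moreover have "s0 \<notin> F" using F(2) by auto
    ultimately have "n \<le> (\<Sum>s\<in>insert s0 F. vec.dim (null_space (Q s)))"
      using z by simp
    then show ?thesis using F as by (intro exI[of _ "insert s0 F"]) (auto simp: n_def)
  qed
qed

text \<open>Upper bound: on the sum of the null space at \<open>b\<close> and a subspace that is negative at \<open>b\<close> the form at \<open>b\<close>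
  is nonpositive, hence negative at every earlier parameter.\<close>

lemma null_spaces_le_negative_dim:
  fixes Q :: "real \<Rightarrow> complex^'n^'n"
  assumes herm: "\<And>s. hermitian (Q s)" 
    and mono: "\<And>s t x. 0 \<le> s \<Longrightarrow> s < t \<Longrightarrow> x \<noteq> 0 \<Longrightarrow> quad (Q s) x < quad (Q t) x"
  shows "finite F \<Longrightarrow> a \<ge> 0 \<Longrightarrow> F \<subseteq> {a<..} \<Longrightarrow> 
    \<exists>V. vec.subspace V \<and> negdef_on (Q a) V \<and> (\<Sum>s\<in>F. vec.dim (null_space (Q s))) \<le> vec.dim V"
proof (induction F arbitrary: a rule: finite_linorder_min_induct)
  case empty
  show ?case by (intro exI[of _ "{0}"]) (auto simp: negdef_on_def vec.subspace_def)
next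
  case (insert b F)
  have ab: "a < b" "0 \<le> b" using insert.prems by auto
  obtain V where V: "vec.subspace V" "negdef_on (Q b) V" "(\<Sum>s\<in>F. vec.dim (null_space (Q s))) \<le> vec.dim V"
    using insert.IH[of b] ab insert.hyps by auto
  let ?N = "null_space (Q b)"
  define W where "W = {x + y |x y. x \<in> V \<and> y \<in> ?N}"
  have W: "vec.subspace W" unfolding W_def by (rule vec.subspace_sums[OF V(1) subspace_null_space])
  have N0: "quad (Q b) y = 0" if "y \<in> ?N" for y using null_space_sesq[OF that] by (simp add: quad_def)
  have "V \<inter> ?N \<subseteq> {0}" using V(2) N0 by (force simp: negdef_on_def)
  then have "vec.dim (V \<inter> ?N) = 0" by simp
  then have dimW: "vec.dim W = vec.dim V + vec.dim ?N"
    using vec.dim_sums_Int[OF V(1) subspace_null_space[of "Q b"]] unfolding W_def by linarith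
  have "negdef_on (Q a) W" unfolding negdef_on_def
  proof (intro ballI impI)
    fix w assume w: "w \<in> W" "w \<noteq> 0"
    then obtain x y where xy: "w = x + y" "x \<in> V" "y \<in> ?N" by (auto simp: W_def)
    have "sesq (Q b) x y = 0" 
      using sesq_commute[OF herm, of b x y] null_space_sesq[OF xy(3)] by simp
    then have "quad (Q b) w = quad (Q b) x" by (simp add: xy(1) quad_add[OF herm] N0[OF xy(3)])
    also have "\<dots> \<le> 0" using V(2) xy(2) by (cases "x = 0") (auto simp: negdef_on_def quad_def)
    finally show "quad (Q a) w < 0" using mono[OF insert.prems(1) ab(1) w(2)] by linarith
  qed
  moreover have "b \<notin> F" using insert.hyps by auto
  then have "(\<Sum>s\<in>insert b F. vec.dim (null_space (Q s))) \<le> vec.dim W"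
    using V(3) insert.hyps(1) dimW by simp
  ultimately show ?case using W by blast
qed

text \<open>Bound the off-diagonal terms by \<open>|x\<^sub>i||x\<^sub>j| \<le> (|x\<^sub>i|\<^sup>2 + |x\<^sub>j|\<^sup>2)/2\<close> and use the symmetry.\<close>

lemma gershgorin:
  fixes A :: "complex^'n^'n"
  assumes A: "hermitian A"
  shows "\<bar>quad A x - (\<Sum>i\<in>UNIV. Re (A $ i $ i) * (cmod (x $ i))\<^sup>2)\<bar> 
    \<le> (\<Sum>i\<in>UNIV. (\<Sum>j\<in>UNIV - {i}. cmod (A $ i $ j)) * (cmod (x $ i))\<^sup>2)"
proof -
  let ?n = "\<lambda>i. cmod (x $ i)"
  define a where "a i j = (if i = j then 0 else cmod (A $ i $ j))" for i j
  have a: "a i j = a j i" for i j using A unfolding hermitian_def a_def by (metis complex_mod_cnj)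
  have row: "(\<Sum>j\<in>UNIV - {i}. cmod (A $ i $ j)) = (\<Sum>j\<in>UNIV. a i j)" for i
    by (subst sum.remove[of UNIV i]) (auto simp: a_def intro!: sum.cong)
  let ?t = "\<lambda>i j. Re (A $ i $ j * x $ j * cnj (x $ i))"
  have "quad A x = (\<Sum>i\<in>UNIV. \<Sum>j\<in>UNIV. ?t i j)"
    by (simp only: quad_def sesq_expand Re_sum)
  also have "\<dots> = (\<Sum>i\<in>UNIV. ?t i i + (\<Sum>j\<in>UNIV - {i}. ?t i j))"
    by (intro sum.cong refl sum.remove) auto
  finally have e: "quad A x = (\<Sum>i\<in>UNIV. ?t i i) + (\<Sum>i\<in>UNIV. \<Sum>j\<in>UNIV - {i}. ?t i j)"
    by (simp only: sum.distrib)
  have d: "?t i i = Re (A $ i $ i) * (?n i)\<^sup>2" for i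
  proof -
    have "A $ i $ i * x $ i * cnj (x $ i) = A $ i $ i * of_real ((?n i)\<^sup>2)"
      unfolding complex_norm_square by (simp only: mult.assoc)
    then show ?thesis by (simp only: Re_complex_of_real times_complex.sel Im_complex_of_real mult_zero_right diff_zero)
  qed
  have "quad A x - (\<Sum>i\<in>UNIV. Re (A $ i $ i) * (?n i)\<^sup>2) = (\<Sum>i\<in>UNIV. \<Sum>j\<in>UNIV - {i}. ?t i j)"
    unfolding e d by simp
  also have "\<bar>\<dots>\<bar> \<le> (\<Sum>i\<in>UNIV. \<Sum>j\<in>UNIV - {i}. \<bar>Re (A $ i $ j * x $ j * cnj (x $ i))\<bar>)"
    by (intro order_trans[OF sum_abs] sum_mono sum_abs)
  also have "\<dots> \<le> (\<Sum>i\<in>UNIV. \<Sum>j\<in>UNIV - {i}. a i j * (((?n i)\<^sup>2 + (?n j)\<^sup>2) / 2))"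
  proof (intro sum_mono)
    fix i j :: 'n assume "j \<in> UNIV - {i}"
    then have ij: "a i j = cmod (A $ i $ j)" by (auto simp: a_def)
    have "\<bar>Re (A $ i $ j * x $ j * cnj (x $ i))\<bar> \<le> cmod (A $ i $ j) * (?n j * ?n i)"
      using abs_Re_le_cmod[of "A $ i $ j * x $ j * cnj (x $ i)"] by (simp add: norm_mult mult.assoc)
    also have "\<dots> \<le> cmod (A $ i $ j) * (((?n i)\<^sup>2 + (?n j)\<^sup>2) / 2)"
    proof (rule mult_left_mono)
      show "?n j * ?n i \<le> ((?n i)\<^sup>2 + (?n j)\<^sup>2) / 2"
        using sum_squares_bound[of "?n j" "?n i"]
        by (simp only: pos_le_divide_eq[OF zero_less_numeral] mult_ac add_ac)
    qed simp
    finally show "\<bar>Re (A $ i $ j * x $ j * cnj (x $ i))\<bar> \<le> a i j * (((?n i)\<^sup>2 + (?n j)\<^sup>2) / 2)" by (simp add: ij)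
  qed
  also have "\<dots> = (\<Sum>i\<in>UNIV. \<Sum>j\<in>UNIV. a i j * (((?n i)\<^sup>2 + (?n j)\<^sup>2) / 2))"
  proof (rule sum.cong[OF refl])
    fix i show "(\<Sum>j\<in>UNIV - {i}. a i j * (((?n i)\<^sup>2 + (?n j)\<^sup>2) / 2)) = (\<Sum>j\<in>UNIV. a i j * (((?n i)\<^sup>2 + (?n j)\<^sup>2) / 2))"
      by (intro sum.mono_neutral_left) (auto simp: a_def)
  qed
  also have "\<dots> = (\<Sum>i\<in>UNIV. \<Sum>j\<in>UNIV. a i j * (?n i)\<^sup>2) / 2 + (\<Sum>i\<in>UNIV. \<Sum>j\<in>UNIV. a i j * (?n j)\<^sup>2) / 2"
    by (simp add: sum.distrib add_divide_distrib distrib_left sum_divide_distrib)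
  also have "(\<Sum>i\<in>UNIV. \<Sum>j\<in>UNIV. a i j * (?n j)\<^sup>2) = (\<Sum>j\<in>UNIV. \<Sum>i\<in>UNIV. a j i * (?n j)\<^sup>2)"
    by (subst sum.swap) (simp add: a)
  finally show ?thesis unfolding row by (simp add: sum_distrib_right)
qed

section \<open>Multiplicities of negative eigenvalues\<close>

lemma yukawa_sum_linear: 
  "yukawa_sum s X (\<Sum>f\<in>S. u f *s \<phi> f) x = (\<Sum>f\<in>S. u f * yukawa_sum s X (\<phi> f) x)"
proof -
  have "yukawa_sum s X (\<Sum>f\<in>S. u f *s \<phi> f) x = (\<Sum>j\<in>UNIV. \<Sum>f\<in>S. u f * (\<phi> f $ j * of_real (yukawa s (X j) x)))"
    by (simp add: yukawa_sum_def sum_component sum_distrib_right mult.assoc)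
  also have "\<dots> = (\<Sum>f\<in>S. \<Sum>j\<in>UNIV. u f * (\<phi> f $ j * of_real (yukawa s (X j) x)))" by (rule sum.swap)
  finally show ?thesis by (simp add: yukawa_sum_def sum_distrib_left)
qed

lemma card_le_dim_if_independent_family:
  fixes \<phi> :: "'a \<Rightarrow> complex^'n"
  assumes S: "finite S" and W: "\<And>f. f \<in> S \<Longrightarrow> \<phi> f \<in> W"
    and ind: "\<And>u f. (\<Sum>f\<in>S. u f *s \<phi> f) = 0 \<Longrightarrow> f \<in> S \<Longrightarrow> u f = 0"
  shows "card S \<le> vec.dim W"
proof -
  have inj: "inj_on \<phi> S"
  proof (rule inj_onI, rule ccontr)
    fix f g assume fg: "f \<in> S" "g \<in> S" "\<phi> f = \<phi> g" "f \<noteq> g"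
    define u where "u h = (if h = f then 1 else 0) - (if h = g then 1 else 0 :: complex)" for h
    have "(\<Sum>h\<in>S. u h *s \<phi> h) = (\<Sum>h\<in>S. if h = f then \<phi> h else 0) - (\<Sum>h\<in>S. if h = g then \<phi> h else 0)"
      unfolding sum_subtractf[symmetric] by (intro sum.cong refl) (auto simp: u_def vec.scale_left_diff_distrib)
    also have "\<dots> = 0" using fg S by simp
    finally have "u f = 0" using ind fg(1) by blast
    then show False using fg(4) by (simp add: u_def)
  qed
  have "vec.independent (\<phi> ` S)"
  proof (rule vec.independent_if_scalars_zero)
    show "finite (\<phi> ` S)" using S by simp
    fix u v assume z: "(\<Sum>x\<in>\<phi> ` S. u x *s x) = 0" and v: "v \<in> \<phi> ` S"
    then have "(\<Sum>f\<in>S. u (\<phi> f) *s \<phi> f) = 0" by (simp add: sum.reindex[OF inj])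
    then show "u v = 0" using ind[of "\<lambda>f. u (\<phi> f)"] v by auto
  qed
  then have "card (\<phi> ` S) \<le> vec.dim W" by (intro vec.independent_card_le_dim) (use W in auto)
  then show ?thesis by (simp add: card_image[OF inj])
qed

text \<open>The map \<open>c \<mapsto> \<Sum>\<^sub>j c\<^sub>j G\<^sub>j\<close> is an isomorphism of the kernel onto the eigenspace modulo null functions.\<close>

lemma multiplicity_H3:
  fixes X :: "'m::finite \<Rightarrow> real^3"
  assumes X: "inj X" and s: "s > 0"
  shows "multiplicity_op (H3 \<alpha> X) (- s\<^sup>2) = enat (vec.dim (null_space (krein_mat \<alpha> X s)))"
proof (rule antisym)
  let ?N = "null_space (krein_mat \<alpha> X s)"
  show "multiplicity_op (H3 \<alpha> X) (- s\<^sup>2) \<le> enat (vec.dim ?N)"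
    unfolding multiplicity_op_def
  proof (rule SUP_least)
    fix S assume "S \<in> {S. finite S \<and> S \<subseteq> eigenspace (H3 \<alpha> X) (- s\<^sup>2) \<and> independent_ae S}"
    then have S: "finite S" "S \<subseteq> eigenspace (H3 \<alpha> X) (- s\<^sup>2)" "independent_ae S" by auto
    have "\<exists>c. krein_mat \<alpha> X s *v c = 0 \<and> (AE x in lborel. f x = yukawa_sum s X c x)" if "f \<in> S" for f
      using eigenfunction_imp_kernel[OF X s, of f \<alpha>] S(2) that by blast
    then obtain \<phi> where \<phi>: "\<And>f. f \<in> S \<Longrightarrow> krein_mat \<alpha> X s *v \<phi> f = 0"
      "\<And>f. f \<in> S \<Longrightarrow> AE x in lborel. f x = yukawa_sum s X (\<phi> f) x" by metis
    have "card S \<le> vec.dim ?N"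
    proof (rule card_le_dim_if_independent_family[where \<phi> = \<phi>])
      show "finite S" by (rule S(1))
      show "\<phi> f \<in> ?N" if "f \<in> S" for f using \<phi>(1)[OF that] by (simp add: null_space_def)
      fix u f assume z: "(\<Sum>f\<in>S. u f *s \<phi> f) = 0" and f: "f \<in> S"
      have "AE x in lborel. \<forall>f\<in>S. f x = yukawa_sum s X (\<phi> f) x"
        using \<phi>(2) S(1) by (intro AE_finite_allI) auto
      then have "AE x in lborel. (\<Sum>f\<in>S. u f * f x) = 0"
      proof eventually_elim
        case (elim x)
        then have "(\<Sum>f\<in>S. u f * f x) = yukawa_sum s X (\<Sum>f\<in>S. u f *s \<phi> f) x"
          unfolding yukawa_sum_linear by (intro sum.cong) auto
        then show ?case by (simp add: z yukawa_sum_def)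
      qed
      then show "u f = 0" using S(3) f unfolding independent_ae_def by blast
    qed
    then show "enat (card S) \<le> enat (vec.dim ?N)" by simp
  qed
  obtain B where B: "B \<subseteq> ?N" "vec.independent B" "?N \<subseteq> vec.span B" "card B = vec.dim ?N"
    by (rule vec.basis_exists)
  have fin: "finite B" by (rule vec.finiteI_independent[OF B(2)])
  let ?y = "yukawa_sum s X"
  have inj: "inj_on ?y B"
  proof (rule inj_onI)
    fix b c assume "?y b = ?y c"
    moreover have "?y (b - c) x = ?y b x - ?y c x" for x
      by (simp add: yukawa_sum_def left_diff_distrib sum_subtractf)
    ultimately have "?y (b - c) x = 0" for x by simp
    then have "b - c = 0" by (intro yukawa_sum_independent[OF X, of s]) simp
    then show "b = c" by simp
  qed
  have "independent_ae (?y ` B)"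
    unfolding independent_ae_def
  proof (intro allI impI ballI)
    fix c g assume z: "AE x in lborel. (\<Sum>f\<in>?y ` B. c f * f x) = 0" and g: "g \<in> ?y ` B"
    have "(\<Sum>f\<in>?y ` B. c f * f x) = ?y (\<Sum>b\<in>B. c (?y b) *s b) x" for x
      by (simp add: sum.reindex[OF inj] yukawa_sum_linear)
    then have "(\<Sum>b\<in>B. c (?y b) *s b) = 0" using z yukawa_sum_independent[OF X, of s] by simp
    then have "\<forall>b\<in>B. c (?y b) = 0" 
      using vec.independentD[OF B(2) fin subset_refl, of "\<lambda>b. c (?y b)"] by blast
    then show "c g = 0" using g by auto
  qed
  moreover have "?y ` B \<subseteq> eigenspace (H3 \<alpha> X) (- s\<^sup>2)"
    using kernel_imp_eigenfunction[OF X s] B(1) by (auto simp: null_space_def)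
  ultimately have "enat (card (?y ` B)) \<le> multiplicity_op (H3 \<alpha> X) (- s\<^sup>2)"
    unfolding multiplicity_op_def using fin by (intro SUP_upper) auto
  then show "enat (vec.dim ?N) \<le> multiplicity_op (H3 \<alpha> X) (- s\<^sup>2)"
    by (simp add: card_image[OF inj] B(4))
qed

text \<open>The parameter \<open>s > 0\<close> and the eigenvalue \<open>-s\<^sup>2\<close> determine each other.\<close>

lemma sum_multiplicity_H3:
  fixes X :: "'m::finite \<Rightarrow> real^3"
  assumes X: "inj X" and G: "finite G" "G \<subseteq> {0<..}"
  shows "(\<Sum>\<mu>\<in>(\<lambda>s. - s\<^sup>2) ` G. multiplicity_op (H3 \<alpha> X) \<mu>) = enat (\<Sum>s\<in>G. vec.dim (null_space (krein_mat \<alpha> X s)))"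
proof -
  have inj: "inj_on (\<lambda>s. - s\<^sup>2 :: real) G"
  proof (rule inj_onI)
    fix s t assume "s \<in> G" "t \<in> G" "- s\<^sup>2 = - t\<^sup>2"
    moreover from this have "0 \<le> s" "0 \<le> t" using G(2) by (auto intro: less_imp_le)
    ultimately show "s = t" by simp
  qed
  have "(\<Sum>\<mu>\<in>(\<lambda>s. - s\<^sup>2) ` G. multiplicity_op (H3 \<alpha> X) \<mu>) = (\<Sum>s\<in>G. enat (vec.dim (null_space (krein_mat \<alpha> X s))))"
    unfolding sum.reindex[OF inj] o_def using G(2) multiplicity_H3[OF X] by (intro sum.cong) auto
  then show ?thesis by (simp flip: of_nat_eq_enat)
qed

lemma kappa_minus_H3_ge:
  fixes X :: "'m::finite \<Rightarrow> real^3"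
  assumes "inj X" "finite G" "G \<subseteq> {0<..}" "n \<le> (\<Sum>s\<in>G. vec.dim (null_space (krein_mat \<alpha> X s)))"
  shows "enat n \<le> kappa_minus (H3 \<alpha> X)"
proof -
  have "enat n \<le> (\<Sum>\<mu>\<in>(\<lambda>s. - s\<^sup>2) ` G. multiplicity_op (H3 \<alpha> X) \<mu>)"
    using assms by (simp add: sum_multiplicity_H3)
  also have "\<dots> \<le> kappa_minus (H3 \<alpha> X)" unfolding kappa_minus_def
    using assms by (intro SUP_upper) auto
  finally show ?thesis .
qed

lemma kappa_minus_H3_le:
  fixes X :: "'m::finite \<Rightarrow> real^3"
  assumes X: "inj X" and b: "\<And>G. finite G \<Longrightarrow> G \<subseteq> {0<..} \<Longrightarrow> (\<Sum>s\<in>G. vec.dim (null_space (krein_mat \<alpha> X s))) \<le> n"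
  shows "kappa_minus (H3 \<alpha> X) \<le> enat n"
  unfolding kappa_minus_def
proof (rule SUP_least)
  fix F :: "real set" assume "F \<in> {F. finite F \<and> F \<subseteq> {..<0}}"
  then have F: "finite F" "F \<subseteq> {..<0}" by auto
  let ?G = "(\<lambda>\<mu>. sqrt (- \<mu>)) ` F"
  have G: "finite ?G" "?G \<subseteq> {0<..}" using F by auto
  have "(\<lambda>s. - s\<^sup>2) ` ?G = F"
  proof -
    have "(\<lambda>s. - s\<^sup>2) ` ?G = (\<lambda>\<mu>. \<mu>) ` F" unfolding image_image using F(2) by (intro image_cong) auto
    then show ?thesis by simp
  qed
  then show "(\<Sum>\<mu>\<in>F. multiplicity_op (H3 \<alpha> X) \<mu>) \<le> enat n"
    using sum_multiplicity_H3[OF X G, of \<alpha>] b[OF G] by simp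
qed

section \<open>Properties of the Krein matrix\<close>

lemma hermitian_krein_mat: "hermitian (krein_mat \<alpha> X s)"
  by (simp add: hermitian_def krein_mat_def yukawa_def dist_commute)

lemma continuous_krein_mat: 
  "continuous_on {0..} (\<lambda>s. krein_mat \<alpha> X s $ i $ j)"
proof -
  have "continuous_on {0..} (\<lambda>s. - (exp (- s * dist (X i) (X j)) * inverse (dist (X i) (X j))))"
    by (intro continuous_intros)
  moreover have "continuous_on {0..} (\<lambda>s. 4 * pi * \<alpha> i + s)" by (intro continuous_intros)
  ultimately have "continuous_on {0..} (\<lambda>s. if i = j then 4 * pi * \<alpha> i + s else - yukawa s (X j) (X i))"
    by (cases "i = j") (simp_all add: yukawa_def divide_inverse)
  then show ?thesis unfolding krein_mat_def by (simp add: continuous_on_of_real)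
qed

lemma krein_mat_diag: "Re (krein_mat \<alpha> X s $ i $ i) = 4 * pi * \<alpha> i + s"
  by (simp add: krein_mat_def)

lemma krein_mat_row:
  "(\<Sum>j\<in>UNIV - {i}. cmod (krein_mat \<alpha> X s $ i $ j)) = (\<Sum>j\<in>UNIV - {i}. exp (- s * dist (X j) (X i)) / dist (X j) (X i))"
  by (intro sum.cong) (auto simp: krein_mat_def yukawa_def norm_divide dist_commute)

text \<open>Diagonal dominance; for \<open>s \<ge> 0\<close> the exponential factors off the diagonal are at most one.\<close>

lemma krein_quad_bounds:
  fixes X :: "'m::finite \<Rightarrow> real^3" and x :: "complex^'m"
  assumes s: "s \<ge> 0"
  shows "quad (krein_mat \<alpha> X s) x \<le> (\<Sum>i\<in>UNIV. (4 * pi * \<alpha> i + s + (\<Sum>j\<in>UNIV - {i}. 1 / dist (X j) (X i))) * (cmod (x $ i))\<^sup>2)"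
    and "quad (krein_mat \<alpha> X s) x \<ge> (\<Sum>i\<in>UNIV. (4 * pi * \<alpha> i + s - (\<Sum>j\<in>UNIV - {i}. 1 / dist (X j) (X i))) * (cmod (x $ i))\<^sup>2)"
proof -
  let ?r = "\<lambda>i. \<Sum>j\<in>UNIV - {i}. cmod (krein_mat \<alpha> X s $ i $ j)" and ?d = "\<lambda>i. \<Sum>j\<in>UNIV - {i}. 1 / dist (X j) (X i)"
  have r: "?r i \<le> ?d i" for i
    unfolding krein_mat_row using s by (intro sum_mono divide_right_mono) auto
  have "(\<Sum>i\<in>UNIV. ?r i * (cmod (x $ i))\<^sup>2) \<le> (\<Sum>i\<in>UNIV. ?d i * (cmod (x $ i))\<^sup>2)"
    by (rule sum_mono) (intro mult_right_mono r, simp)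
  with gershgorin[OF hermitian_krein_mat[of \<alpha> X s], of x]
  have "\<bar>quad (krein_mat \<alpha> X s) x - (\<Sum>i\<in>UNIV. (4 * pi * \<alpha> i + s) * (cmod (x $ i))\<^sup>2)\<bar> \<le> (\<Sum>i\<in>UNIV. ?d i * (cmod (x $ i))\<^sup>2)"
    unfolding krein_mat_diag by (rule order_trans)
  then show "quad (krein_mat \<alpha> X s) x \<le> (\<Sum>i\<in>UNIV. (4 * pi * \<alpha> i + s + ?d i) * (cmod (x $ i))\<^sup>2)"
    "quad (krein_mat \<alpha> X s) x \<ge> (\<Sum>i\<in>UNIV. (4 * pi * \<alpha> i + s - ?d i) * (cmod (x $ i))\<^sup>2)"
    unfolding distrib_right[of "4 * pi * \<alpha> i + s" "?d i" for i] left_diff_distrib[of "4 * pi * \<alpha> i + s" "?d i" for i]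
      sum.distrib sum_subtractf by linarith+
qed

lemma krein_mat_eventually_posdef:
  fixes X :: "'m::finite \<Rightarrow> real^3"
  shows "\<exists>T. \<forall>s>T. posdef_on (krein_mat \<alpha> X s) UNIV"
proof -
  let ?d = "\<lambda>i. \<Sum>j\<in>UNIV - {i}. 1 / dist (X j) (X i)"
  define T where "T = (\<Sum>i\<in>UNIV. \<bar>4 * pi * \<alpha> i\<bar> + ?d i)"
  have d0: "0 \<le> ?d i" for i by (intro sum_nonneg) auto
  have T0: "T \<ge> 0" unfolding T_def using d0 by (intro sum_nonneg) (simp add: add_nonneg_nonneg)
  have T: "\<bar>4 * pi * \<alpha> i\<bar> + ?d i \<le> T" for i
    unfolding T_def using d0 by (intro member_le_sum) auto
  have "posdef_on (krein_mat \<alpha> X s) UNIV" if s: "s > T" for s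
    unfolding posdef_on_def
  proof (intro ballI impI)
    fix x :: "complex^'m" assume "x \<noteq> 0"
    then obtain k where k: "x $ k \<noteq> 0" by (auto simp: vec_eq_iff)
    have pos: "0 < 4 * pi * \<alpha> i + s - ?d i" for i using T[of i] s abs_ge_minus_self[of "4 * pi * \<alpha> i"] by linarith
    have "0 < (\<Sum>i\<in>UNIV. (4 * pi * \<alpha> i + s - ?d i) * (cmod (x $ i))\<^sup>2)"
      using k pos by (intro sum_pos2[of UNIV k] mult_pos_pos mult_nonneg_nonneg) (auto intro: less_imp_le)
    also have "\<dots> \<le> quad (krein_mat \<alpha> X s) x" using s T0 by (intro krein_quad_bounds) simp
    finally show "0 < quad (krein_mat \<alpha> X s) x" .
  qed
  then show ?thesis by blast
qed

text \<open>The derivative in \<open>s\<close> is the form with the positive definite kernel \<open>exp(-s|x\<^sub>i - x\<^sub>j|)\<close>.\<close>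

lemma krein_quad_strict_mono:
  fixes X :: "'m::finite \<Rightarrow> real^3" and x :: "complex^'m"
  assumes X: "inj X" and st: "0 \<le> s" "s < t" and x: "x \<noteq> 0"
  shows "quad (krein_mat \<alpha> X s) x < quad (krein_mat \<alpha> X t) x"
proof (rule DERIV_pos_imp_increasing_open[OF st(2)])
  define e where "e i j \<tau> = (if i = j then 4 * pi * \<alpha> i + \<tau> else - yukawa \<tau> (X j) (X i))" for i j \<tau>
  have q: "quad (krein_mat \<alpha> X \<tau>) x = (\<Sum>i\<in>UNIV. \<Sum>j\<in>UNIV. e i j \<tau> * Re (x $ j * cnj (x $ i)))" for \<tau>
    unfolding quad_def sesq_expand Re_sum krein_mat_def e_def
    by (intro sum.cong refl) (simp add: algebra_simps)
  have de: "((\<lambda>\<tau>. e i j \<tau>) has_real_derivative exp (- \<tau> * dist (X j) (X i))) (at \<tau>)" for i j \<tau>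
  proof (cases "i = j")
    case False
    then have "dist (X j) (X i) \<noteq> 0" using X by (auto dest: injD)
    then show ?thesis unfolding e_def yukawa_def using False
      by (auto intro!: derivative_eq_intros simp: dist_commute)
  qed (auto simp: e_def intro!: derivative_eq_intros)
  have d: "((\<lambda>\<tau>. quad (krein_mat \<alpha> X \<tau>) x) has_real_derivative 
      (\<Sum>i\<in>UNIV. \<Sum>j\<in>UNIV. exp (- \<tau> * dist (X j) (X i)) * Re (x $ j * cnj (x $ i)))) (at \<tau>)" for \<tau>
    unfolding q by (intro DERIV_sum DERIV_cmult_right de)
  have pos: "0 < (\<Sum>i\<in>UNIV. \<Sum>j\<in>UNIV. exp (- \<tau> * dist (X j) (X i)) * Re (x $ j * cnj (x $ i)))" if "\<tau> > 0" for \<tau>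
  proof -
    have "0 < Re (\<Sum>j\<in>UNIV. \<Sum>i\<in>UNIV. x $ j * cnj (x $ i) * of_real (exp (- \<tau> * dist (X j) (X i))))"
      by (rule exp_dist_posdef[OF X that x])
    also have "\<dots> = (\<Sum>j\<in>UNIV. \<Sum>i\<in>UNIV. exp (- \<tau> * dist (X j) (X i)) * Re (x $ j * cnj (x $ i)))"
      by (simp add: mult.commute)
    also have "\<dots> = (\<Sum>i\<in>UNIV. \<Sum>j\<in>UNIV. exp (- \<tau> * dist (X j) (X i)) * Re (x $ j * cnj (x $ i)))" by (rule sum.swap)
    finally show ?thesis .
  qed
  show "\<exists>y. ((\<lambda>\<tau>. quad (krein_mat \<alpha> X \<tau>) x) has_real_derivative y) (at \<tau>) \<and> 0 < y" if "s < \<tau>" "\<tau> < t" for \<tau>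
    using d[of \<tau>] pos[of \<tau>] that st by (intro exI conjI) auto
  show "continuous_on {s..t} (\<lambda>\<tau>. quad (krein_mat \<alpha> X \<tau>) x)"
    using d by (intro continuous_at_imp_continuous_on ballI DERIV_isCont)
qed

section \<open>The number of negative eigenvalues\<close>

lemma coordinate_subspace: 
  "vec.subspace {x::complex^'m. \<forall>i. i \<notin> K \<longrightarrow> x $ i = 0}"
  by (rule vec.subspaceI) auto

theorem proposition4p11:
  fixes X :: "'m::finite \<Rightarrow> real^3" and \<alpha> :: "'m \<Rightarrow> real" and K :: "'m set" and m' :: nat
  assumes distinct: "inj X"
    and card_K: "card K = m'"
    and strength_K: "\<And>k. k \<in> K \<Longrightarrow> \<alpha> k < - (\<Sum>j\<in>UNIV - {k}. 1 / (4 * pi * dist (X j) (X k)))"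
  shows "kappa_minus (H3 \<alpha> X) \<ge> enat m' \<and>
    ((\<forall>k. k \<notin> K \<longrightarrow> \<alpha> k \<ge> (\<Sum>j\<in>UNIV - {k}. 1 / (4 * pi * dist (X j) (X k)))) \<longrightarrow>
      kappa_minus (H3 \<alpha> X) = enat m')"
proof -
  let ?Q = "krein_mat \<alpha> X" and ?d = "\<lambda>i. \<Sum>j\<in>UNIV - {i}. 1 / dist (X j) (X i)"
  let ?C = "\<lambda>K. {x::complex^'m. \<forall>i. i \<notin> K \<longrightarrow> x $ i = 0}"
  have d: "(\<Sum>j\<in>UNIV - {k}. 1 / (4 * pi * dist (X j) (X k))) = ?d k / (4 * pi)" for k
    unfolding sum_divide_distrib by (intro sum.cong) (auto simp: field_simps)
  have neg: "4 * pi * \<alpha> k + ?d k < 0" if "k \<in> K" for k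
    using strength_K[OF that] unfolding d by (simp add: field_simps)
  have nd: "negdef_on (?Q 0) (?C K)"
    unfolding negdef_on_def
  proof (intro ballI impI)
    fix x assume x: "x \<in> ?C K" "x \<noteq> 0"
    then obtain k where k: "x $ k \<noteq> 0" by (auto simp: vec_eq_iff)
    with x(1) have kK: "k \<in> K" by auto
    have nonneg: "0 \<le> - (4 * pi * \<alpha> i + 0 + ?d i) * (cmod (x $ i))\<^sup>2" for i
    proof (cases "i \<in> K")
      case True
      then show ?thesis using neg[OF True] by (intro mult_nonneg_nonneg) auto
    qed (use x(1) in simp)
    have "quad (?Q 0) x \<le> (\<Sum>i\<in>UNIV. (4 * pi * \<alpha> i + 0 + ?d i) * (cmod (x $ i))\<^sup>2)"
      by (rule krein_quad_bounds) simp
    moreover have "0 < - (4 * pi * \<alpha> k + 0 + ?d k) * (cmod (x $ k))\<^sup>2"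
      using k neg[OF kK] by (intro mult_pos_pos) auto
    then have "0 < (\<Sum>i\<in>UNIV. - (4 * pi * \<alpha> i + 0 + ?d i) * (cmod (x $ i))\<^sup>2)"
      by (rule sum_pos2[OF finite UNIV_I]) (rule nonneg)
    then have "(\<Sum>i\<in>UNIV. (4 * pi * \<alpha> i + 0 + ?d i) * (cmod (x $ i))\<^sup>2) < 0"
      unfolding mult_minus_left sum_negf by linarith
    ultimately show "quad (?Q 0) x < 0" by linarith
  qed
  obtain T where T: "\<And>s. s > T \<Longrightarrow> posdef_on (?Q s) UNIV"
    using krein_mat_eventually_posdef[of \<alpha> X] by blast
  have "\<exists>G. finite G \<and> G \<subseteq> {0<..} \<and> vec.dim (?C K) \<le> (\<Sum>s\<in>G. vec.dim (null_space (?Q s)))"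
    by (rule negative_dim_le_null_spaces[where Q = ?Q and T = T])
      (intro hermitian_krein_mat continuous_krein_mat T order_refl coordinate_subspace nd | assumption)+
  then obtain G where G: "finite G" "G \<subseteq> {0<..}" "vec.dim (?C K) \<le> (\<Sum>s\<in>G. vec.dim (null_space (?Q s)))"
    by blast
  then have ge: "enat m' \<le> kappa_minus (H3 \<alpha> X)"
    by (intro kappa_minus_H3_ge[OF distinct G(1,2)]) (simp add: dim_substandard_cart card_K)
  have le: "kappa_minus (H3 \<alpha> X) \<le> enat m'" 
    if strong: "\<And>k. k \<notin> K \<Longrightarrow> \<alpha> k \<ge> (\<Sum>j\<in>UNIV - {k}. 1 / (4 * pi * dist (X j) (X k)))"
  proof (rule kappa_minus_H3_le[OF distinct])
    fix G :: "real set" assume G: "finite G" "G \<subseteq> {0<..}"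
    have "\<exists>V. vec.subspace V \<and> negdef_on (?Q 0) V \<and> (\<Sum>s\<in>G. vec.dim (null_space (?Q s))) \<le> vec.dim V"
      by (rule null_spaces_le_negative_dim[where Q = ?Q])
        (intro hermitian_krein_mat krein_quad_strict_mono distinct G order_refl | assumption)+
    then obtain V where V: "vec.subspace V" "negdef_on (?Q 0) V" "(\<Sum>s\<in>G. vec.dim (null_space (?Q s))) \<le> vec.dim V"
      by blast
    have nonneg: "0 \<le> quad (?Q 0) x" if "x \<in> ?C (- K)" for x
    proof -
      have "0 \<le> (\<Sum>i\<in>UNIV. (4 * pi * \<alpha> i + 0 - ?d i) * (cmod (x $ i))\<^sup>2)"
      proof (rule sum_nonneg)
        fix i
        show "0 \<le> (4 * pi * \<alpha> i + 0 - ?d i) * (cmod (x $ i))\<^sup>2"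
        proof (cases "i \<in> K")
          case False
          then have "0 \<le> 4 * pi * \<alpha> i + 0 - ?d i" using strong[OF False] unfolding d by (simp add: field_simps)
          then show ?thesis by (intro mult_nonneg_nonneg) auto
        qed (use that in simp)
      qed
      also have "\<dots> \<le> quad (?Q 0) x" by (rule krein_quad_bounds) simp
      finally show ?thesis .
    qed
    have "V \<inter> ?C (- K) \<subseteq> {0}" using V(2) nonneg by (force simp: negdef_on_def not_less[symmetric])
    then have "vec.dim V + vec.dim (?C (- K)) \<le> CARD('m)"
      by (intro dim_disjoint_le V(1) coordinate_subspace)
    moreover have "vec.dim (?C (- K)) = CARD('m) - card K" 
      unfolding dim_substandard_cart Compl_eq_Diff_UNIV by (rule card_Diff_subset) auto
    moreover have "card K \<le> CARD('m)" by (intro card_mono) auto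
    ultimately show "(\<Sum>s\<in>G. vec.dim (null_space (?Q s))) \<le> m'" using V(3) card_K by linarith
  qed
  show ?thesis using ge le by (blast intro: antisym)
qed

end
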